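(* Let $s\ge0$ and let $\varphi\in L^2(\mathbb R)$ be such that, for some $\epsilon>0$ and some constant $C>0$, $$|\widehat\varphi(\omega)|\le\frac{C}{(1+|\omega|)^{s+1+\epsilon}}\quad\text{for all }\omega\in\mathbb R,$$ such that $\widehat\varphi$ has definite sign, and such that, for some $a>0$, $|\widehat\varphi(\omega)|\ge a$ for all $\omega\in I_\bullet=(-\tfrac12,\tfrac12)$. Then for all $\nu>0$ small enough the system of functions $$\{T_\lambda\varphi:\lambda\in\nu\mathbb Z\}\cup\{\varphi_{j,k,\lambda}:j\in\mathbb N,\ k\in\{+,-\},\ \lambda\in\nu\mathbb Z\}$$ is a frame describing the $H^s$-norm, i.e. there exist $A,B>0$ such that for all $f\in H^s(\mathbb R)$ $$A\|f\|_s^2\le\sum_{\lambda\in\nu\mathbb Z}|\langle f,T_\lambda\varphi\rangle|^2+\sum_{j\in\mathbb N,\,k=\pm,\,\lambda\in\nu\mathbb Z}2^{2js}|\langle f,\varphi_{j,k,\lambda}\rangle|^2\le B\|f\|_s^2 .$$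
   Context: $\mathbb N=\{0,1,2,\dots\}$. Fourier transform: $\widehat u(\omega)=\int e^{-2\pi i x\omega}u(x)\,dx$. $T_xf(t)=f(t-x)$. $\langle\cdot,\cdot\rangle$ is the $L^2(\mathbb R)$ inner product. $\|f\|_s=\|(1+|\omega|)^s\widehat f(\omega)\|_{L^2}$. "Definite sign" means that $\widehat\varphi$ is real-valued and either $\widehat\varphi\ge0$ everywhere or $\widehat\varphi\le0$ everywhere. Pointwise conditions on $\widehat\varphi$ are understood almost everywhere. The frequency partition is $I_\bullet=(-\frac12,\frac12)$, $I_{j,+}=[2^j-\frac12,2^{j+1}-\frac12)$, $I_{j,-}=(-2^{j+1}+\frac12,-2^j+\frac12]$ for $j\in\mathbb N$, and $Z_{j,k}=I_{j,k}\cap\mathbb Z$, so $Z_{j,+}=\{2^j,\dots,2^{j+1}-1\}$ and $Z_{j,-}=\{-2^{j+1}+1,\dots,-2^j\}$. For $\nu>0$, $\lambda\in\nu\mathbb Z$, $$\varphi_{j,k,\lambda}=T_{\lambda/2^j}\Big(\frac1{2^{j/2}}\sum_{\eta\in Z_{j,k}}e^{2\pi i\eta t}\varphi(t)\Big).$$ *)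

theory Defs
  imports "HOL-Analysis.Analysis"
begin

definition L2 :: "(real \<Rightarrow> complex) set" where
  "L2 = {f \<in> borel_measurable lborel. integrable lborel (\<lambda>x. (cmod (f x))\<^sup>2)}"

text \<open>Linear in the first argument.\<close>
definition L2_inner :: "(real \<Rightarrow> complex) \<Rightarrow> (real \<Rightarrow> complex) \<Rightarrow> complex" where
  "L2_inner f g = (LINT x|lborel. f x * cnj (g x))"

text \<open>
  The Fourier transform on the whole of \<open>L2\<close>, with kernel \<open>exp (- 2 \<pi> i x \<omega>)\<close>: for
  \<open>u\<close> that is not integrable the Fourier integral is the limit in the \<open>L2\<close>-norm of the
  integrals over \<open>{- n..n}\<close>. The distance is a nonnegative integral in \<open>ennreal\<close> since
  the Bochner integral of a non-integrable function would be \<open>0\<close>.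
\<close>
definition truncated_fourier :: "(real \<Rightarrow> complex) \<Rightarrow> real \<Rightarrow> real \<Rightarrow> complex" where
  "truncated_fourier u R \<omega> =
     (LINT x:{- R..R}|lborel. exp (- 2 * of_real pi * \<i> * of_real x * of_real \<omega>) * u x)"

definition is_fourier_transform :: "(real \<Rightarrow> complex) \<Rightarrow> (real \<Rightarrow> complex) \<Rightarrow> bool" where
  "is_fourier_transform u v \<longleftrightarrow>
     v \<in> L2 \<and>
     (\<lambda>n. \<integral>\<^sup>+ \<omega>. ennreal ((cmod (truncated_fourier u (real n) \<omega> - v \<omega>))\<^sup>2) \<partial>lborel)
       \<longlonglongrightarrow> 0"

text \<open>
  A representative of the Fourier transform, which is determined only almost everywhere;
  everything below depends only on its almost-everywhere class.
\<close>
definition fourier :: "(real \<Rightarrow> complex) \<Rightarrow> (real \<Rightarrow> complex)" where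
  "fourier u = (SOME v. is_fourier_transform u v)"

definition sobolev_space :: "real \<Rightarrow> (real \<Rightarrow> complex) set" where
  "sobolev_space s =
     {f \<in> L2. integrable lborel (\<lambda>\<omega>. ((1 + \<bar>\<omega>\<bar>) powr s * cmod (fourier f \<omega>))\<^sup>2)}"

definition sobolev_norm :: "real \<Rightarrow> (real \<Rightarrow> complex) \<Rightarrow> real" where
  "sobolev_norm s f =
     sqrt (LINT \<omega>|lborel. ((1 + \<bar>\<omega>\<bar>) powr s * cmod (fourier f \<omega>))\<^sup>2)"

definition definite_sign :: "(real \<Rightarrow> complex) \<Rightarrow> bool" where
  "definite_sign g \<longleftrightarrow>
     (AE \<omega> in lborel. g \<omega> \<in> \<real> \<and> Re (g \<omega>) \<ge> 0) \<or>
     (AE \<omega> in lborel. g \<omega> \<in> \<real> \<and> Re (g \<omega>) \<le> 0)"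

definition translate :: "real \<Rightarrow> (real \<Rightarrow> complex) \<Rightarrow> (real \<Rightarrow> complex)" where
  "translate x f = (\<lambda>t. f (t - x))"

datatype freq_sign = Plus | Minus

definition I_centre :: "real set" where
  "I_centre = {- (1/2) <..< 1/2}"

fun I_band :: "nat \<Rightarrow> freq_sign \<Rightarrow> real set" where
  "I_band j Plus = {2 ^ j - 1/2 ..< 2 ^ (j + 1) - 1/2}"
| "I_band j Minus = {- (2 ^ (j + 1)) + 1/2 <.. - (2 ^ j) + 1/2}"

definition Z_band :: "nat \<Rightarrow> freq_sign \<Rightarrow> int set" where
  "Z_band j k = {\<eta>. real_of_int \<eta> \<in> I_band j k}"

definition band_atom ::
  "(real \<Rightarrow> complex) \<Rightarrow> nat \<Rightarrow> freq_sign \<Rightarrow> real \<Rightarrow> (real \<Rightarrow> complex)" where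
  "band_atom \<phi> j k l =
     translate (l / 2 ^ j)
       (\<lambda>t. of_real (1 / 2 powr (real j / 2)) *
            (\<Sum>\<eta>\<in>Z_band j k. exp (2 * of_real pi * \<i> * of_int \<eta> * of_real t) * \<phi> t))"

definition lattice :: "real \<Rightarrow> real set" where
  "lattice \<nu> = range (\<lambda>m::int. \<nu> * of_int m)"

text \<open>The intervals are half-open, so check that they contain the intended integers.\<close>

lemma Z_band_Plus: "Z_band j Plus = {2 ^ j .. 2 ^ (j + 1) - 1}"
proof -
  have half: "(of_int m - 1/2 \<le> (of_int n :: real)) = (m \<le> n)"
    "((of_int n :: real) < of_int m - 1/2) = (n \<le> m - 1)" for m n :: int
    by linarith+
  have pow: "(2 :: real) ^ i = of_int (2 ^ i)" for i
    by simp
  show ?thesis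
    unfolding Z_band_def I_band.simps atLeastLessThan_iff pow half
    by (simp only: atLeastAtMost_def atLeast_def atMost_def Collect_conj_eq)
qed

lemma Z_band_Minus: "Z_band j Minus = {- (2 ^ (j + 1)) + 1 .. - (2 ^ j)}"
proof -
  have half: "((of_int n :: real) \<le> - of_int m + 1/2) = (n \<le> - m)"
    "(- of_int m + 1/2 < (of_int n :: real)) = (- m + 1 \<le> n)" for m n :: int
    by linarith+
  have pow: "(2 :: real) ^ i = of_int (2 ^ i)" for i
    by simp
  show ?thesis
    unfolding Z_band_def I_band.simps greaterThanAtMost_iff pow half
    by (simp only: atLeastAtMost_def atLeast_def atMost_def Collect_conj_eq)
qed

end

theory Submission
  imports Defs
begin

text \<open>
  On the frequency side, a translation becomes a modulation and a modulation a translation. Let \<open>g\<close> and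
  \<open>\<psi>\<close> be the Fourier transforms of \<open>f\<close> and \<open>\<phi>\<close>. For a band at scale \<open>j\<close>, with the set \<open>Z\<close> of integers, the
  coefficients of \<open>f\<close> are, up to the factor \<open>2 powr (- j / 2)\<close>, the Fourier coefficients for the period
  \<open>P = 2 ^ j / \<nu>\<close> of the function \<open>h = g * cnj \<Psi>\<close>, where \<open>\<Psi> \<omega> = (\<Sum>\<eta>\<in>Z. \<psi> (\<omega> - \<eta>))\<close>
  (\<open>wave_atom_coefficient\<close>). The band has length about \<open>2 ^ j\<close>, so for small \<open>\<nu>\<close> the interval
  \<open>{- P / 2..<P / 2}\<close> is much longer than the band and carries most of \<open>\<Psi>\<close>.

  If \<open>h\<close> lived on this interval, Parseval's identity for Fourier series would give the sum of the squared
  coefficients as \<open>P\<close> times the integral of \<open>\<bar>h\<bar>\<^sup>2\<close>. The rest of \<open>h\<close> is cut into translates of the interval,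
  each of which obeys Parseval's identity too; combining them with weights \<open>m\<^sup>2\<close> for the translate \<open>m\<close>
  bounds the error (\<open>sampling_sandwich\<close>). On those translates the decay of \<open>\<psi>\<close> makes \<open>\<Psi>\<close> so small that the
  errors of all bands together are at most a constant times \<open>\<nu>\<close> times the squared Sobolev norm of \<open>f\<close>
  (\<open>decay_sum_far\<close>).

  The main terms add up to \<open>1 / \<nu>\<close> times an integral of \<open>\<bar>g\<bar>\<^sup>2\<close> against the sum of the squares of
  \<open>2 powr (j * s) * \<bar>\<Psi>\<bar>\<close> over all bands, and this weight is comparable to \<open>(1 + \<bar>\<omega>\<bar>) powr (2 * s)\<close>. It is not
  larger because the bands partition the integers and \<open>2 ^ j \<le> (1 + \<bar>\<omega>\<bar>) * (1 + \<bar>\<omega> - \<eta>\<bar>)\<close> lets the decay of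
  \<open>\<psi>\<close> pay for the weight (\<open>band_envelope_le\<close>). It is not smaller because the definite sign excludes
  cancellation in \<open>\<Psi>\<close>, and near each frequency there is an integer \<open>\<eta>\<close> at which \<open>\<psi> (\<omega> - \<eta>)\<close> is at least
  \<open>a\<close> in modulus (\<open>band_envelope_lower\<close>). For small \<open>\<nu>\<close> the main terms dominate the errors.

  The analytic foundation is Parseval's identity for Fourier series (\<open>Parseval_interval\<close>), which follows
  from the Stone-Weierstrass theorem on the circle. Averaged over all shifts of the sampling
  lattice it yields Plancherel's theorem for functions with bounded support
  (\<open>Plancherel_compact_support\<close>). Together with completeness of the space \<open>L2\<close> (\<open>L2_complete\<close>), that gives the Fourier
  transform on \<open>L2\<close> (\<open>fourier_transform_exists\<close>).
\<close>


section \<open>Square-integrable functions\<close>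

text \<open>
  Scaling one factor against the other in \<open>2 \<bar>f g\<bar> \<le> t f\<^sup>2 + g\<^sup>2 / t\<close> and choosing the best \<open>t\<close>.
  For nonnegative integrals, infinite values included, so that integrability need not be known in advance.
\<close>
lemma nn_integral_Cauchy_Schwarz:
  fixes f g :: "'a \<Rightarrow> real"
  assumes [measurable]: "f \<in> borel_measurable M" "g \<in> borel_measurable M"
  shows "(\<integral>\<^sup>+x. ennreal \<bar>f x * g x\<bar> \<partial>M)\<^sup>2 \<le> (\<integral>\<^sup>+x. ennreal ((f x)\<^sup>2) \<partial>M) * (\<integral>\<^sup>+x. ennreal ((g x)\<^sup>2) \<partial>M)"
    (is "?I\<^sup>2 \<le> ?A * ?B")
proof -
  have sharp: "?I \<le> ennreal (t / 2) * ?A + ennreal (inverse t / 2) * ?B" if "t > 0" for t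
  proof -
    have "\<bar>f x * g x\<bar> \<le> t / 2 * (f x)\<^sup>2 + inverse t / 2 * (g x)\<^sup>2" for x
    proof -
      have "0 \<le> (t * \<bar>f x\<bar> - \<bar>g x\<bar>)\<^sup>2"
        by simp
      hence "2 * t * (\<bar>f x\<bar> * \<bar>g x\<bar>) \<le> t\<^sup>2 * (f x)\<^sup>2 + (g x)\<^sup>2"
        by (simp add: power2_diff power_mult_distrib)
      thus ?thesis
        using that by (simp add: field_simps power2_eq_square abs_mult)
    qed
    hence "?I \<le> (\<integral>\<^sup>+x. ennreal (t / 2) * ennreal ((f x)\<^sup>2) + ennreal (inverse t / 2) * ennreal ((g x)\<^sup>2) \<partial>M)"
      using that by (intro nn_integral_mono) (simp add: ennreal_mult[symmetric] ennreal_plus[symmetric] del: ennreal_plus)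
    also have "\<dots> = ennreal (t / 2) * ?A + ennreal (inverse t / 2) * ?B"
      by (simp add: nn_integral_add nn_integral_cmult)
    finally show ?thesis .
  qed
  have zeroA: "?I = 0" if "?A = 0"
  proof -
    have "AE x in M. f x = 0"
      using that by (subst (asm) nn_integral_0_iff_AE) auto
    thus ?thesis
      by (subst nn_integral_0_iff_AE) (auto elim!: eventually_mono)
  qed
  have zeroB: "?I = 0" if "?B = 0"
  proof -
    have "AE x in M. g x = 0"
      using that by (subst (asm) nn_integral_0_iff_AE) auto
    thus ?thesis
      by (subst nn_integral_0_iff_AE) (auto elim!: eventually_mono)
  qed
  show ?thesis
  proof (cases "?A = 0 \<or> ?B = 0 \<or> ?A = top \<or> ?B = top")
    case True
    thus ?thesis
      using zeroA zeroB by (auto simp: ennreal_mult_top ennreal_top_mult)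
  next
    case False
    obtain A B where AB: "?A = ennreal A" "?B = ennreal B" "A > 0" "B > 0"
      using False by (cases ?A; cases ?B) (auto simp: ennreal_eq_0_iff not_le intro!: that)
    \<comment> \<open>the minimiser of \<open>t A / 2 + B / (2 t)\<close>\<close>
    define t where "t = sqrt B / sqrt A"
    have t: "t > 0" using AB by (simp add: t_def)
    have "?I \<le> ennreal (t / 2 * A + inverse t / 2 * B)"
      using sharp[OF t] AB t by (simp add: ennreal_mult[symmetric] ennreal_plus[symmetric] del: ennreal_plus)
    also have "t / 2 * A + inverse t / 2 * B = sqrt A * sqrt B"
    proof -
      have "sqrt B / sqrt A * A = sqrt B * sqrt A" "sqrt A / sqrt B * B = sqrt B * sqrt A"
        using AB by (simp_all add: field_simps)
      thus ?thesis by (simp add: t_def field_simps)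
    qed
    finally have "?I\<^sup>2 \<le> (ennreal (sqrt A * sqrt B))\<^sup>2"
      by (rule power_mono) simp
    also have "\<dots> = ?A * ?B"
      using AB by (simp add: ennreal_power power_mult_distrib ennreal_mult[symmetric])
    finally show ?thesis .
  qed
qed

lemma borel_measurable_cnj [measurable]:
  "f \<in> borel_measurable M \<Longrightarrow> (\<lambda>x. cnj (f x)) \<in> borel_measurable M"
  by (rule measurable_compose[OF _ borel_measurable_continuous_onI[OF continuous_on_cnj[OF continuous_on_id]]])

lemma L2_measurable [measurable_dest]: "f \<in> L2 \<Longrightarrow> f \<in> borel_measurable borel"
  by (simp add: L2_def)

lemma L2_square_integrable: "f \<in> L2 \<Longrightarrow> integrable lborel (\<lambda>x. (cmod (f x))\<^sup>2)"
  by (simp add: L2_def)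

lemma L2_iff_nn_integral:
  assumes "f \<in> borel_measurable borel"
  shows "f \<in> L2 \<longleftrightarrow> (\<integral>\<^sup>+x. ennreal ((cmod (f x))\<^sup>2) \<partial>lborel) < \<infinity>"
  using assms by (auto simp: L2_def integrable_iff_bounded)

text \<open>
  The square of the norm rather than the norm: most estimates below only need
  \<open>\<bar>a + b\<bar>\<^sup>2 \<le> 2 \<bar>a\<bar>\<^sup>2 + 2 \<bar>b\<bar>\<^sup>2\<close>, which avoids square roots.
\<close>
definition L2_sq :: "(real \<Rightarrow> complex) \<Rightarrow> real" where
  "L2_sq f = (LINT x|lborel. (cmod (f x))\<^sup>2)"

lemma L2_sq_nonneg [simp]: "L2_sq f \<ge> 0"
  by (simp add: L2_sq_def)

lemma nn_integral_L2:
  "f \<in> L2 \<Longrightarrow> (\<integral>\<^sup>+x. ennreal ((cmod (f x))\<^sup>2) \<partial>lborel) = ennreal (L2_sq f)"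
  unfolding L2_sq_def by (intro nn_integral_eq_integral L2_square_integrable) auto

lemma L2I_dominated:
  assumes "f \<in> borel_measurable borel" "integrable lborel g" "\<And>x. (cmod (f x))\<^sup>2 \<le> g x"
  shows "f \<in> L2"
proof -
  have "integrable lborel (\<lambda>x. (cmod (f x))\<^sup>2)"
    by (rule Bochner_Integration.integrable_bound[OF assms(2)])
       (use assms in \<open>auto intro!: AE_I2 order_trans[OF assms(3) abs_ge_self]\<close>)
  thus ?thesis using assms by (simp add: L2_def)
qed

lemma cmod_add_sq_le: "(cmod (x + y))\<^sup>2 \<le> 2 * (cmod x)\<^sup>2 + 2 * (cmod y)\<^sup>2"
proof -
  have "(cmod (x + y))\<^sup>2 \<le> (cmod x + cmod y)\<^sup>2"
    by (intro power_mono norm_triangle_ineq) simp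
  also have "\<dots> \<le> 2 * (cmod x)\<^sup>2 + 2 * (cmod y)\<^sup>2"
    using zero_le_power2[of "cmod x - cmod y"] by (simp add: power2_sum power2_diff)
  finally show ?thesis .
qed

lemma L2_add: "f \<in> L2 \<Longrightarrow> g \<in> L2 \<Longrightarrow> (\<lambda>x. f x + g x) \<in> L2"
  by (rule L2I_dominated[where g = "\<lambda>x. 2 * (cmod (f x))\<^sup>2 + 2 * (cmod (g x))\<^sup>2"])
     (auto intro!: cmod_add_sq_le L2_square_integrable borel_measurable_add simp: L2_measurable)

lemma L2_bounded_mult:
  assumes [measurable]: "f \<in> L2" "b \<in> borel_measurable borel" and bound: "\<And>x. cmod (b x) \<le> K"
  shows "(\<lambda>x. b x * f x) \<in> L2"
proof (rule L2I_dominated[where g = "\<lambda>x. K\<^sup>2 * (cmod (f x))\<^sup>2"])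
  show "integrable lborel (\<lambda>x. K\<^sup>2 * (cmod (f x))\<^sup>2)"
    by (intro integrable_mult_right L2_square_integrable assms)
  show "(cmod (b x * f x))\<^sup>2 \<le> K\<^sup>2 * (cmod (f x))\<^sup>2" for x
    using bound[of x] by (simp add: norm_mult power_mult_distrib mult_right_mono power_mono)
qed measurable

lemma L2_cmult: "f \<in> L2 \<Longrightarrow> (\<lambda>x. c * f x) \<in> L2"
  by (rule L2_bounded_mult[where b = "\<lambda>_. c" and K = "cmod c"]) auto

lemma L2_diff: "f \<in> L2 \<Longrightarrow> g \<in> L2 \<Longrightarrow> (\<lambda>x. f x - g x) \<in> L2"
  using L2_add[of f "\<lambda>x. - 1 * g x"] L2_cmult[of g "-1"] by simp

lemma L2_indicator: 
  assumes "f \<in> L2" "A \<in> sets borel"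
  shows "(\<lambda>x. indicator A x * f x) \<in> L2"
  by (rule L2_bounded_mult[where K = 1]) (use assms in \<open>auto simp: indicator_def\<close>)

lemma L2_zero: "(\<lambda>x. 0) \<in> L2"
  by (simp add: L2_def)

lemma L2_sum: "(\<And>i. i \<in> I \<Longrightarrow> f i \<in> L2) \<Longrightarrow> (\<lambda>x. \<Sum>i\<in>I. f i x) \<in> L2"
  by (induction I rule: infinite_finite_induct) (auto intro: L2_add L2_zero)

lemma L2_translate: "f \<in> L2 \<Longrightarrow> (\<lambda>x. f (x - t)) \<in> L2"
  using lborel_integrable_real_affine[of "\<lambda>x. (cmod (f x))\<^sup>2" 1 "-t"]
  by (auto simp: L2_def)

lemma L2_cnj: "f \<in> L2 \<Longrightarrow> (\<lambda>x. cnj (f x)) \<in> L2"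
  by (auto simp: L2_def)

lemma L2_cong_AE:
  assumes "f \<in> L2" "g \<in> borel_measurable borel" "AE x in lborel. f x = g x"
  shows "g \<in> L2"
proof -
  have "integrable lborel (\<lambda>x. (cmod (g x))\<^sup>2)"
    by (rule integrable_cong_AE_imp[OF L2_square_integrable[OF assms(1)]])
       (use assms in \<open>auto elim: eventually_mono\<close>)
  thus ?thesis using assms by (simp add: L2_def)
qed

lemma L2_inner_integrable:
  assumes "f \<in> L2" "g \<in> L2"
  shows "integrable lborel (\<lambda>x. f x * cnj (g x))"
proof (rule Bochner_Integration.integrable_bound)
  show "integrable lborel (\<lambda>x. (cmod (f x))\<^sup>2 + (cmod (g x))\<^sup>2)"
    using assms by (intro Bochner_Integration.integrable_add L2_square_integrable)
  show "(\<lambda>x. f x * cnj (g x)) \<in> borel_measurable lborel"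
    using assms by measurable
  have "a * b \<le> a\<^sup>2 + b\<^sup>2" if "a \<ge> 0" "b \<ge> 0" for a b :: real
    using zero_le_power2[of "a - b"] mult_nonneg_nonneg[OF that] unfolding power2_diff by linarith
  thus "AE x in lborel. norm (f x * cnj (g x)) \<le> norm ((cmod (f x))\<^sup>2 + (cmod (g x))\<^sup>2)"
    by (auto simp: norm_mult)
qed

lemma L2_inner_Cauchy_Schwarz:
  assumes "f \<in> L2" "g \<in> L2"
  shows "(cmod (L2_inner f g))\<^sup>2 \<le> L2_sq f * L2_sq g"
proof -
  have "ennreal (cmod (L2_inner f g)) \<le> (\<integral>\<^sup>+x. ennreal (norm (f x * cnj (g x))) \<partial>lborel)"
    unfolding L2_inner_def by (intro integral_norm_bound_ennreal L2_inner_integrable assms)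
  also have "\<dots> = (\<integral>\<^sup>+x. ennreal \<bar>cmod (f x) * cmod (g x)\<bar> \<partial>lborel)"
    by (simp add: norm_mult)
  finally have "(ennreal (cmod (L2_inner f g)))\<^sup>2 \<le> \<dots>\<^sup>2"
    by (rule power_mono) simp
  also have "\<dots> \<le> (\<integral>\<^sup>+x. ennreal ((cmod (f x))\<^sup>2) \<partial>lborel) * (\<integral>\<^sup>+x. ennreal ((cmod (g x))\<^sup>2) \<partial>lborel)"
    using assms by (intro nn_integral_Cauchy_Schwarz) (auto simp: L2_measurable)
  also have "\<dots> = ennreal (L2_sq f * L2_sq g)"
    using assms by (simp add: nn_integral_L2 ennreal_mult)
  finally show ?thesis
    by (simp add: ennreal_power ennreal_le_iff)
qed

lemma L2_inner_diff_left:
  "f \<in> L2 \<Longrightarrow> g \<in> L2 \<Longrightarrow> h \<in> L2 \<Longrightarrow> L2_inner (\<lambda>x. f x - g x) h = L2_inner f h - L2_inner g h"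
  unfolding L2_inner_def
  by (simp add: left_diff_distrib L2_inner_integrable)

lemma L2_inner_diff_right:
  "f \<in> L2 \<Longrightarrow> g \<in> L2 \<Longrightarrow> h \<in> L2 \<Longrightarrow> L2_inner h (\<lambda>x. f x - g x) = L2_inner h f - L2_inner h g"
  unfolding L2_inner_def
  by (simp add: right_diff_distrib L2_inner_integrable)

lemma L2_inner_cmult_right: "L2_inner f (\<lambda>x. c * g x) = cnj c * L2_inner f g"
  unfolding L2_inner_def by (simp add: mult.left_commute)

lemma L2_inner_sum_right:
  assumes "f \<in> L2" "\<And>i. i \<in> I \<Longrightarrow> g i \<in> L2"
  shows "L2_inner f (\<lambda>x. \<Sum>i\<in>I. g i x) = (\<Sum>i\<in>I. L2_inner f (g i))"
  unfolding L2_inner_def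
  by (simp add: sum_distrib_left Bochner_Integration.integral_sum L2_inner_integrable assms)

lemma L2_sq_add_le:
  assumes "f \<in> L2" "g \<in> L2"
  shows "L2_sq (\<lambda>x. f x + g x) \<le> 2 * L2_sq f + 2 * L2_sq g"
proof -
  have "L2_sq (\<lambda>x. f x + g x) \<le> (LINT x|lborel. 2 * (cmod (f x))\<^sup>2 + 2 * (cmod (g x))\<^sup>2)"
    unfolding L2_sq_def using assms
    by (intro integral_mono L2_square_integrable L2_add cmod_add_sq_le Bochner_Integration.integrable_add
          integrable_mult_right)
  also have "\<dots> = 2 * L2_sq f + 2 * L2_sq g"
    unfolding L2_sq_def using assms by (simp add: L2_square_integrable)
  finally show ?thesis .
qed

lemma L2_sq_minus_commute: "L2_sq (\<lambda>x. f x - g x) = L2_sq (\<lambda>x. g x - f x)"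
  by (simp add: L2_sq_def norm_minus_commute)

lemma L2_sq_diff_triangle:
  assumes "f \<in> L2" "g \<in> L2" "h \<in> L2"
  shows "L2_sq (\<lambda>x. f x - h x) \<le> 2 * L2_sq (\<lambda>x. f x - g x) + 2 * L2_sq (\<lambda>x. g x - h x)"
  using L2_sq_add_le[of "\<lambda>x. f x - g x" "\<lambda>x. g x - h x"] assms by (simp add: L2_diff)

lemma L2_sq_polarization:
  assumes "f \<in> L2" "g \<in> L2"
  shows "L2_sq (\<lambda>x. f x + g x) = L2_sq f + L2_sq g + 2 * Re (L2_inner f g)"
proof -
  have "(cmod (a + b))\<^sup>2 = (cmod a)\<^sup>2 + (cmod b)\<^sup>2 + 2 * Re (a * cnj b)" for a b
    unfolding cmod_power2 by (simp add: power2_eq_square algebra_simps)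
  hence "L2_sq (\<lambda>x. f x + g x) = (LINT x|lborel. (cmod (f x))\<^sup>2 + (cmod (g x))\<^sup>2 + 2 * Re (f x * cnj (g x)))"
    by (simp add: L2_sq_def)
  also have "\<dots> = L2_sq f + L2_sq g + 2 * (LINT x|lborel. Re (f x * cnj (g x)))"
    unfolding L2_sq_def
    by (subst Bochner_Integration.integral_add, intro Bochner_Integration.integrable_add L2_square_integrable assms,
        intro integrable_mult_right integrable_Re L2_inner_integrable assms,
        subst Bochner_Integration.integral_add, (intro L2_square_integrable assms)+, subst integral_mult_right_zero, rule refl)
  also have "(LINT x|lborel. Re (f x * cnj (g x))) = Re (L2_inner f g)"
    unfolding L2_inner_def by (intro integral_Re L2_inner_integrable assms)
  finally show ?thesis .
qed

lemma L2_inner_tendsto: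
  assumes f: "f \<in> L2" "\<And>n. F n \<in> L2" "(\<lambda>n. L2_sq (\<lambda>x. F n x - f x)) \<longlonglongrightarrow> 0"
    and g: "g \<in> L2" "\<And>n. G n \<in> L2" "(\<lambda>n. L2_sq (\<lambda>x. G n x - g x)) \<longlonglongrightarrow> 0"
  shows "(\<lambda>n. L2_inner (F n) (G n)) \<longlonglongrightarrow> L2_inner f g"
proof -
  let ?a = "\<lambda>n. L2_sq (\<lambda>x. F n x - f x)" and ?b = "\<lambda>n. L2_sq (\<lambda>x. G n x - g x)"
  have sqrtI: "cmod (L2_inner u v) \<le> sqrt (L2_sq u * L2_sq v)" if "u \<in> L2" "v \<in> L2" for u v
    using L2_inner_Cauchy_Schwarz[OF that] by (rule real_le_rsqrt)
  have "cmod (L2_inner (F n) (G n) - L2_inner f g)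
      \<le> sqrt (?a n * (2 * ?b n + 2 * L2_sq g)) + sqrt (L2_sq f * ?b n)" for n
  proof -
    have "L2_inner (F n) (G n) - L2_inner f g
        = L2_inner (\<lambda>x. F n x - f x) (G n) + L2_inner f (\<lambda>x. G n x - g x)"
      using f g by (simp add: L2_inner_diff_left L2_inner_diff_right)
    also have "cmod \<dots> \<le> sqrt (?a n * L2_sq (G n)) + sqrt (L2_sq f * ?b n)"
      using f g by (intro order_trans[OF norm_triangle_ineq] add_mono sqrtI L2_diff)
    also have "L2_sq (G n) \<le> 2 * ?b n + 2 * L2_sq g"
      using L2_sq_add_le[of "\<lambda>x. G n x - g x" g] g by (simp add: L2_diff)
    finally show ?thesis
      by (simp add: mult_left_mono)
  qed
  moreover have "(\<lambda>n. sqrt (?a n * (2 * ?b n + 2 * L2_sq g)) + sqrt (L2_sq f * ?b n)) \<longlonglongrightarrow> 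
      sqrt (0 * (2 * 0 + 2 * L2_sq g)) + sqrt (L2_sq f * 0)"
    by (intro tendsto_intros f g)
  hence "(\<lambda>n. sqrt (?a n * (2 * ?b n + 2 * L2_sq g)) + sqrt (L2_sq f * ?b n)) \<longlonglongrightarrow> 0"
    by simp
  ultimately have "(\<lambda>n. L2_inner (F n) (G n) - L2_inner f g) \<longlonglongrightarrow> 0"
    by (rule Lim_null_comparison[OF always_eventually[OF allI]])
  thus ?thesis by (simp add: LIM_zero_iff)
qed


text \<open>
  The Riesz-Fischer theorem. Along a subsequence whose increments \<open>d k\<close> satisfy
  \<open>L2_sq (d k) \<le> (1/4) ^ k\<close>, the function \<open>\<Sum>k. 2 ^ k * \<bar>d k\<bar>\<^sup>2\<close> has finite integral. It is therefore finite almost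
  everywhere, where it forces geometric decay of \<open>d k\<close> and so pointwise convergence. Fatou's lemma
  turns the pointwise limit into a limit in norm.
\<close>
theorem L2_complete:
  assumes F: "\<And>n. F n \<in> L2"
    and Cauchy: "\<And>e. e > 0 \<Longrightarrow> \<exists>N. \<forall>m\<ge>N. \<forall>n\<ge>N. L2_sq (\<lambda>x. F m x - F n x) < e"
  shows "\<exists>f\<in>L2. (\<lambda>n. L2_sq (\<lambda>x. F n x - f x)) \<longlonglongrightarrow> 0"
proof -
  note [measurable] = F
  have "\<exists>N. \<forall>k. \<forall>m\<ge>N k. \<forall>n\<ge>N k. L2_sq (\<lambda>x. F m x - F n x) < (1/4) ^ k"
    by (intro choice allI Cauchy) simp
  then obtain N where N: "\<And>k m n. m \<ge> N k \<Longrightarrow> n \<ge> N k \<Longrightarrow> L2_sq (\<lambda>x. F m x - F n x) < (1/4) ^ k"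
    by blast
  \<comment> \<open>a sum rather than \<open>N k\<close> itself, so that \<open>r\<close> is monotone and stays beyond every earlier threshold\<close>
  define r where "r k = (\<Sum>i\<le>k. N i)" for k
  have r_ge: "r k \<ge> N i" if "i \<le> k" for i k
    unfolding r_def using that by (intro member_le_sum) auto
  define d where "d k x = F (r (Suc k)) x - F (r k) x" for k x
  have d: "d k \<in> L2" for k
    unfolding d_def by (intro L2_diff F)
  note [measurable] = d
  have d_small: "L2_sq (d k) \<le> (1/4) ^ k" for k
    unfolding d_def by (rule less_imp_le, rule N) (auto intro!: r_ge)
  have "(\<integral>\<^sup>+x. (\<Sum>k. ennreal (2 ^ k * (cmod (d k x))\<^sup>2)) \<partial>lborel)
      = (\<Sum>k. \<integral>\<^sup>+x. ennreal (2 ^ k * (cmod (d k x))\<^sup>2) \<partial>lborel)"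
    by (rule nn_integral_suminf) measurable
  also have "\<dots> = (\<Sum>k. ennreal (2 ^ k * L2_sq (d k)))"
    by (simp add: ennreal_mult nn_integral_cmult nn_integral_L2 d)
  also have "\<dots> \<le> (\<Sum>k. ennreal ((1/2) ^ k))"
  proof (intro suminf_le ennreal_leI)
    fix k
    have "2 ^ k * L2_sq (d k) \<le> 2 ^ k * (1/4) ^ k"
      by (intro mult_left_mono d_small) simp
    thus "2 ^ k * L2_sq (d k) \<le> (1/2) ^ k"
      by (simp flip: power_mult_distrib)
  qed auto
  also have "\<dots> = ennreal (\<Sum>k. (1/2) ^ k)"
    by (intro suminf_ennreal2) (auto intro: summable_geometric)
  finally have "(\<integral>\<^sup>+x. (\<Sum>k. ennreal (2 ^ k * (cmod (d k x))\<^sup>2)) \<partial>lborel) \<noteq> \<infinity>"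
    by (auto simp: top_unique)
  hence fin: "AE x in lborel. (\<Sum>k. ennreal (2 ^ k * (cmod (d k x))\<^sup>2)) \<noteq> \<infinity>"
    by (intro nn_integral_noteq_infinite) measurable
  have conv: "AE x in lborel. convergent (\<lambda>k. F (r k) x)"
    using fin
  proof (rule eventually_mono)
    fix x assume *: "(\<Sum>k. ennreal (2 ^ k * (cmod (d k x))\<^sup>2)) \<noteq> \<infinity>"
    define u where "u k = ennreal (2 ^ k * (cmod (d k x))\<^sup>2)" for k
    have "suminf u \<noteq> \<infinity>"
      using * unfolding u_def[abs_def] .
    then obtain B where B: "suminf u = ennreal B" "B \<ge> 0"
      by (cases "suminf u") auto
    have bnd: "norm (d k x) \<le> sqrt B * (sqrt (1/2)) ^ k" for k
    proof -
      have "ennreal (2 ^ k * (cmod (d k x))\<^sup>2) \<le> ennreal B"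
        using sum_le_suminf[OF summableI, of "{k}" u] by (simp add: u_def flip: B(1))
      hence "2 ^ k * (cmod (d k x))\<^sup>2 \<le> B"
        using B(2) by (simp add: ennreal_le_iff)
      hence "(cmod (d k x))\<^sup>2 \<le> B * (1/2) ^ k"
        by (simp add: field_simps power_divide)
      hence "cmod (d k x) \<le> sqrt (B * (1/2) ^ k)"
        by (rule real_le_rsqrt)
      thus ?thesis
        by (simp add: real_sqrt_mult real_sqrt_power)
    qed
    have "sqrt (1/2) < (1::real)"
      by simp
    hence "summable (\<lambda>k. sqrt B * (sqrt (1/2)) ^ k)"
      by (intro summable_mult summable_geometric) simp
    hence "summable (\<lambda>k. d k x)"
      by (rule summable_comparison_test'[where N = 0]) (rule bnd)
    hence "(\<lambda>n. F (r 0) x + (\<Sum>k<n. d k x)) \<longlonglongrightarrow> F (r 0) x + (\<Sum>k. d k x)"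
      by (intro tendsto_intros summable_LIMSEQ)
    also have "(\<lambda>n. F (r 0) x + (\<Sum>k<n. d k x)) = (\<lambda>n. F (r n) x)"
      unfolding d_def by (subst sum_lessThan_telescope[of "\<lambda>k. F (r k) x"]) simp
    finally show "convergent (\<lambda>k. F (r k) x)"
      by (rule convergentI)
  qed
  define f where "f x = lim (\<lambda>k. F (r k) x)" for x
  have [measurable]: "f \<in> borel_measurable borel"
    unfolding f_def by (rule borel_measurable_lim_metric[of _ borel]) measurable
  have lim: "AE x in lborel. (\<lambda>k. F (r k) x) \<longlonglongrightarrow> f x"
    using conv by (rule eventually_mono) (simp add: f_def convergent_LIMSEQ_iff)
  have fatou: "(\<integral>\<^sup>+x. ennreal ((cmod (F n x - f x))\<^sup>2) \<partial>lborel) \<le> ennreal ((1/4) ^ k)" if n: "n \<ge> N k" for n k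
  proof -
    have "(\<integral>\<^sup>+x. ennreal ((cmod (F n x - f x))\<^sup>2) \<partial>lborel)
        = (\<integral>\<^sup>+x. liminf (\<lambda>i. ennreal ((cmod (F n x - F (r i) x))\<^sup>2)) \<partial>lborel)"
    proof (rule nn_integral_cong_AE, use lim in eventually_elim)
      fix x assume "(\<lambda>k. F (r k) x) \<longlonglongrightarrow> f x"
      hence "(\<lambda>i. ennreal ((cmod (F n x - F (r i) x))\<^sup>2)) \<longlonglongrightarrow> ennreal ((cmod (F n x - f x))\<^sup>2)"
        by (intro tendsto_intros)
      thus "ennreal ((cmod (F n x - f x))\<^sup>2) = liminf (\<lambda>i. ennreal ((cmod (F n x - F (r i) x))\<^sup>2))"
        by (intro lim_imp_Liminf[symmetric]) auto
    qed
    also have "\<dots> \<le> liminf (\<lambda>i. \<integral>\<^sup>+x. ennreal ((cmod (F n x - F (r i) x))\<^sup>2) \<partial>lborel)"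
      by (rule nn_integral_liminf) measurable
    also have "\<dots> = liminf (\<lambda>i. ennreal (L2_sq (\<lambda>x. F n x - F (r i) x)))"
      using nn_integral_L2[OF L2_diff[OF F F]] by simp
    also have "\<dots> \<le> ennreal ((1/4) ^ k)"
    proof (rule Liminf_le)
      show "\<forall>\<^sub>F i in sequentially. ennreal (L2_sq (\<lambda>x. F n x - F (r i) x)) \<le> ennreal ((1/4) ^ k)"
        using eventually_ge_at_top[of k]
        by eventually_elim (intro ennreal_leI less_imp_le[OF N] n r_ge)
    qed auto
    finally show ?thesis .
  qed
  have diff: "(\<lambda>x. F n x - f x) \<in> L2" if "n \<ge> N 0" for n
  proof -
    have "(\<lambda>x. F n x - f x) \<in> borel_measurable borel"
      by measurable
    thus ?thesis
      using le_less_trans[OF fatou[OF that] ennreal_less_top] by (simp add: L2_iff_nn_integral)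
  qed
  have "f \<in> L2"
    using L2_diff[OF F diff[OF order_refl], of "N 0"] by simp
  moreover have "(\<lambda>n. L2_sq (\<lambda>x. F n x - f x)) \<longlonglongrightarrow> 0"
  proof (rule LIMSEQ_I)
    fix e :: real assume "e > 0"
    then obtain k where k: "(1/4) ^ k < e"
      using real_arch_pow_inv[of e "1/4"] by auto
    have "L2_sq (\<lambda>x. F n x - f x) < e" if "n \<ge> N k" for n
      using fatou[OF that] k \<open>f \<in> L2\<close> F by (simp add: nn_integral_L2 L2_diff ennreal_le_iff)
    thus "\<exists>no. \<forall>n\<ge>no. norm (L2_sq (\<lambda>x. F n x - f x) - 0) < e"
      by auto
  qed
  ultimately show ?thesis by blast
qed


text \<open>
  Frame sums are unordered infinite sums; as integrals against counting measure they can be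
  exchanged with each other and with Lebesgue integrals.
\<close>
lemma infsum_eq_nn_integral_count_space:
  fixes f :: "'a \<Rightarrow> ennreal"
  assumes "countable A"
  shows "infsum f A = (\<integral>\<^sup>+x. f x \<partial>count_space A)"
proof (rule antisym)
  have SUP: "infsum f A = (SUP F\<in>{F. finite F \<and> F \<subseteq> A}. sum f F)"
    by (rule nonneg_infsum_complete) simp
  show "infsum f A \<le> (\<integral>\<^sup>+x. f x \<partial>count_space A)"
    unfolding SUP
  proof (rule SUP_least, clarify)
    fix F assume F: "finite F" "F \<subseteq> A"
    have "sum f F = (\<integral>\<^sup>+x. f x * indicator F x \<partial>count_space A)"
      using F by (subst nn_integral_count_space'[of F]) auto
    also have "\<dots> \<le> (\<integral>\<^sup>+x. f x \<partial>count_space A)"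
      by (intro nn_integral_mono) (auto simp: indicator_def)
    finally show "sum f F \<le> (\<integral>\<^sup>+x. f x \<partial>count_space A)" .
  qed
  show "(\<integral>\<^sup>+x. f x \<partial>count_space A) \<le> infsum f A"
  proof (cases "finite A")
    case True
    thus ?thesis by (simp add: nn_integral_count_space_finite)
  next
    case False
    note bij = bij_betw_from_nat_into[OF assms False]
    have "(\<integral>\<^sup>+x. f x \<partial>count_space A) = (\<Sum>n. f (from_nat_into A n))"
      by (simp add: nn_integral_bij_count_space[symmetric, OF bij] nn_integral_count_space_nat)
    also have "\<dots> = (SUP n. \<Sum>i<n. f (from_nat_into A i))"
      by (rule suminf_eq_SUP)
    also have "\<dots> \<le> infsum f A"
      unfolding SUP
    proof (rule SUP_least, rule SUP_upper2)
      fix n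
      show "from_nat_into A ` {..<n} \<in> {F. finite F \<and> F \<subseteq> A}"
        using bij by (auto simp: bij_betw_def)
      show "(\<Sum>i<n. f (from_nat_into A i)) \<le> sum f (from_nat_into A ` {..<n})"
        using bij by (subst sum.reindex) (auto simp: bij_betw_def intro: inj_on_subset)
    qed
    finally show ?thesis .
  qed
qed


section \<open>Parseval's identity on an interval\<close>

definition fourier_char :: "real \<Rightarrow> int \<Rightarrow> real \<Rightarrow> complex" where
  "fourier_char P n x = cis (2 * pi * of_int n * x / P)"

lemma fourier_char_measurable [measurable]: "fourier_char P n \<in> borel_measurable borel"
  unfolding fourier_char_def[abs_def] cis_conv_exp by measurable

lemma norm_fourier_char [simp]: "cmod (fourier_char P n x) = 1"
  by (simp add: fourier_char_def)

lemma fourier_char_mult: "fourier_char P n x * fourier_char P m x = fourier_char P (n + m) x"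
  by (simp add: fourier_char_def cis_mult add_divide_distrib ring_distribs)

lemma cnj_fourier_char: "cnj (fourier_char P n x) = fourier_char P (- n) x"
  by (simp add: fourier_char_def cis_cnj)

text \<open>
  Characters of period \<open>P\<close> cut off to one period. Cutting off makes them elements of \<open>L2\<close>, so that
  inner products over an interval are inner products on the line. The window is open because the two
  end points are the same point of the circle, which matters for the approximation below.
\<close>
definition windowed_char :: "real \<Rightarrow> real \<Rightarrow> int \<Rightarrow> real \<Rightarrow> complex" where
  "windowed_char c P n x = indicator {c<..<c+P} x * fourier_char P n x"

lemma windowed_char_L2: "windowed_char c P n \<in> L2"
proof (rule L2I_dominated[where g = "indicator {c<..<c+P}"])
  show "windowed_char c P n \<in> borel_measurable borel"
    unfolding windowed_char_def[abs_def] by measurable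
  show "integrable lborel (indicat_real {c<..<c+P})"
    by (cases "P \<ge> 0") (auto intro!: integrable_real_indicator)
  show "(cmod (windowed_char c P n x))\<^sup>2 \<le> indicator {c<..<c+P} x" for x
    by (simp add: windowed_char_def norm_mult indicator_def)
qed

lemma windowed_char_orthogonal:
  assumes "P > 0"
  shows "L2_inner (windowed_char c P n) (windowed_char c P m) = (if n = m then of_real P else 0)"
proof -
  have "L2_inner (windowed_char c P n) (windowed_char c P m)
      = (LINT x|lborel. indicator {c<..<c+P} x *\<^sub>R fourier_char P (n - m) x)"
    unfolding L2_inner_def
    by (intro Bochner_Integration.integral_cong)
       (auto simp: windowed_char_def cnj_fourier_char fourier_char_mult indicator_def)
  also have "\<dots> = (LINT x|lborel. indicator {c..c+P} x *\<^sub>R fourier_char P (n - m) x)"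
    using AE_lborel_singleton[of c] AE_lborel_singleton[of "c+P"]
    by (intro integral_cong_AE) (auto simp: indicator_def elim!: eventually_elim2)
  also have "\<dots> = (if n = m then of_real P else 0)"
  proof (cases "n = m")
    case True
    thus ?thesis using assms by (simp add: fourier_char_def scaleR_conv_of_real)
  next
    case False
    define k where "k = 2 * pi * of_int (n - m) / P"
    have k: "k \<noteq> 0" using False assms by (simp add: k_def)
    have eq: "fourier_char P (n - m) x = cis (k * x)" for x
      by (simp add: fourier_char_def k_def)
    have "has_bochner_integral lborel (\<lambda>x. indicator {c..c+P} x *\<^sub>R cis (k * x))
        (cis (k * (c + P)) / (\<i> * k) - cis (k * c) / (\<i> * k))"
    proof (rule has_bochner_integral_FTC_Icc)
      show "((\<lambda>x. cis (k * x) / (\<i> * k)) has_vector_derivative cis (k * x)) (at x within {c..c+P})" for x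
      proof -
        have "((\<lambda>z. exp (\<i> * (k * z)) / (\<i> * k)) has_field_derivative cis (k * x)) (at (of_real x))"
          using k by (auto intro!: derivative_eq_intros simp: cis_conv_exp complex_eq_iff)
        from has_vector_derivative_real_field[OF this] show ?thesis
          by (simp add: cis_conv_exp)
      qed
      show "continuous_on {c..c+P} (\<lambda>x. cis (k * x))"
        by (intro continuous_intros)
    qed (use assms in auto)
    moreover have "cis (k * (c + P)) = cis (k * c)"
    proof -
      have "k * (c + P) = k * c + 2 * pi * of_int (n - m)"
        using assms by (simp add: k_def field_simps)
      thus ?thesis
        by (simp add: cis_mult[symmetric] cis_multiple_2pi del: of_int_diff)
    qed
    ultimately have "(LINT x|lborel. indicator {c..c+P} x *\<^sub>R cis (k * x)) = 0"
      by (auto dest: has_bochner_integral_integral_eq)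
    thus ?thesis using False by (simp add: eq)
  qed
  finally show ?thesis .
qed


text \<open>
  Completing the square. With \<open>a n = k n / P\<close> the last sum vanishes and this is Bessel's inequality;
  for any other \<open>a\<close> it shows that a good trigonometric approximation makes Bessel's inequality almost
  an equality.
\<close>
lemma L2_sq_diff_trig_sum:
  fixes h :: "real \<Rightarrow> complex" and c P :: real and a :: "int \<Rightarrow> complex"
  assumes "P > 0" "h \<in> L2" "finite N"
  defines "k \<equiv> \<lambda>n. L2_inner h (windowed_char c P n)"
  shows "L2_sq (\<lambda>x. h x - (\<Sum>n\<in>N. a n * windowed_char c P n x))
       = L2_sq h - (\<Sum>n\<in>N. (cmod (k n))\<^sup>2) / P + P * (\<Sum>n\<in>N. (cmod (a n - k n / P))\<^sup>2)"
proof -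
  define p where "p x = (\<Sum>n\<in>N. a n * windowed_char c P n x)" for x
  have p: "p \<in> L2"
    unfolding p_def[abs_def] by (intro L2_sum L2_cmult windowed_char_L2)
  have hp: "L2_inner h p = (\<Sum>n\<in>N. cnj (a n) * k n)"
    unfolding p_def[abs_def] k_def
    by (simp add: L2_inner_sum_right L2_inner_cmult_right assms L2_cmult windowed_char_L2)
  have kp: "L2_inner p (windowed_char c P n) = a n * P" if "n \<in> N" for n
  proof -
    have "L2_inner p (windowed_char c P n)
        = (\<Sum>m\<in>N. a m * L2_inner (windowed_char c P m) (windowed_char c P n))"
      unfolding p_def[abs_def] L2_inner_def sum_distrib_right mult.assoc
      by (subst Bochner_Integration.integral_sum)
         (auto intro!: L2_inner_integrable windowed_char_L2)
    also have "\<dots> = (\<Sum>m\<in>N. if m = n then a n * P else 0)"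
      using assms by (intro sum.cong) (auto simp: windowed_char_orthogonal)
    finally show ?thesis using that assms by simp
  qed
  have pp: "L2_inner p p = (\<Sum>n\<in>N. cnj (a n) * (a n * P))"
  proof -
    have "L2_inner p (\<lambda>x. (\<Sum>n\<in>N. a n * windowed_char c P n x)) = (\<Sum>n\<in>N. cnj (a n) * L2_inner p (windowed_char c P n))"
      by (simp add: L2_inner_sum_right L2_inner_cmult_right p L2_cmult windowed_char_L2)
    thus ?thesis by (simp add: kp flip: p_def)
  qed
  have neg: "L2_inner h (\<lambda>x. -1 * p x) = - L2_inner h p"
    by (subst L2_inner_cmult_right) simp
  have sq: "of_real (L2_sq u) = L2_inner u u" for u
    unfolding L2_sq_def L2_inner_def by (simp only: integral_complex_of_real[symmetric] complex_norm_square)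
  have "L2_sq (\<lambda>x. h x - p x) = L2_sq h + L2_sq p - 2 * Re (L2_inner h p)"
    using L2_sq_polarization[of h "\<lambda>x. -1 * p x"] neg p assms L2_cmult[OF p, of "-1"]
    by (simp add: L2_sq_def)
  also have "L2_sq p = Re (L2_inner p p)"
    by (simp flip: sq)
  also have "L2_sq h + Re (L2_inner p p) - 2 * Re (L2_inner h p)
      = L2_sq h + (\<Sum>n\<in>N. P * (cmod (a n))\<^sup>2 - 2 * Re (cnj (a n) * k n))"
  proof -
    have "Re (cnj (a n) * (a n * P)) = P * (cmod (a n))\<^sup>2" for n
      unfolding cmod_power2 by (simp add: power2_eq_square algebra_simps)
    hence "Re (L2_inner p p) = (\<Sum>n\<in>N. P * (cmod (a n))\<^sup>2)"
      by (simp only: pp Re_sum)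
    moreover have "2 * Re (L2_inner h p) = (\<Sum>n\<in>N. 2 * Re (cnj (a n) * k n))"
      unfolding hp Re_sum sum_distrib_left ..
    ultimately show ?thesis
      by (simp only: sum_subtractf)
  qed
  also have "(\<Sum>n\<in>N. P * (cmod (a n))\<^sup>2 - 2 * Re (cnj (a n) * k n))
      = (\<Sum>n\<in>N. P * (cmod (a n - k n / P))\<^sup>2 - (cmod (k n))\<^sup>2 / P)"
  proof (intro sum.cong refl)
    fix n
    have "P * (cmod (a n - k n / P))\<^sup>2 = P * (Re (a n) - Re (k n) / P)\<^sup>2 + P * (Im (a n) - Im (k n) / P)\<^sup>2"
      unfolding cmod_power2 by (simp add: distrib_left)
    also have "\<dots> = P * (cmod (a n))\<^sup>2 - 2 * Re (cnj (a n) * k n) + (cmod (k n))\<^sup>2 / P"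
      using assms(1) unfolding cmod_power2 by (simp add: field_simps power2_eq_square)
    finally show "P * (cmod (a n))\<^sup>2 - 2 * Re (cnj (a n) * k n) 
        = P * (cmod (a n - k n / P))\<^sup>2 - (cmod (k n))\<^sup>2 / P"
      by simp
  qed
  finally show ?thesis
    by (simp add: p_def sum_subtractf sum_distrib_left sum_divide_distrib)
qed

definition trig_polys :: "real \<Rightarrow> (real \<Rightarrow> complex) set" where
  "trig_polys P = {p. \<exists>N a. finite N \<and> p = (\<lambda>x. \<Sum>n\<in>N. a n * fourier_char P n x)}"

lemma trig_polys_char: "(\<lambda>x. c * fourier_char P n x) \<in> trig_polys P"
  unfolding trig_polys_def by (intro CollectI exI[of _ "{n}"] exI[of _ "\<lambda>_. c"]) simp

lemma trig_polys_add:
  assumes "p \<in> trig_polys P" "q \<in> trig_polys P"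
  shows "(\<lambda>x. p x + q x) \<in> trig_polys P"
proof -
  obtain N a M b where *: "finite N" "p = (\<lambda>x. \<Sum>n\<in>N. a n * fourier_char P n x)"
    "finite M" "q = (\<lambda>x. \<Sum>n\<in>M. b n * fourier_char P n x)"
    using assms unfolding trig_polys_def by blast
  have "p x + q x = (\<Sum>n\<in>N \<union> M. ((if n \<in> N then a n else 0) + (if n \<in> M then b n else 0)) * fourier_char P n x)" for x
  proof -
    have "p x = (\<Sum>n\<in>N \<union> M. (if n \<in> N then a n else 0) * fourier_char P n x)"
         "q x = (\<Sum>n\<in>N \<union> M. (if n \<in> M then b n else 0) * fourier_char P n x)"
      unfolding *(2,4) by (intro sum.mono_neutral_cong_left; use *(1,3) in simp)+
    thus ?thesis by (simp add: sum.distrib distrib_right)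
  qed
  hence "(\<lambda>x. p x + q x)
      = (\<lambda>x. \<Sum>n\<in>N \<union> M. ((if n \<in> N then a n else 0) + (if n \<in> M then b n else 0)) * fourier_char P n x)"
    by (rule ext)
  moreover have "finite (N \<union> M)"
    using *(1,3) by simp
  ultimately show ?thesis
    unfolding trig_polys_def mem_Collect_eq
    by (intro exI[of _ "N \<union> M"] exI[of _ "\<lambda>n. (if n \<in> N then a n else 0) + (if n \<in> M then b n else 0)"] conjI)
qed

lemma trig_polys_sum:
  assumes "finite I" "\<And>i. i \<in> I \<Longrightarrow> p i \<in> trig_polys P"
  shows "(\<lambda>x. \<Sum>i\<in>I. p i x) \<in> trig_polys P"
  using assms
proof (induction I rule: finite_induct)
  case empty
  show ?case using trig_polys_char[of 0 P 0] by simp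
qed (auto intro: trig_polys_add)

lemma trig_polys_mult:
  assumes "p \<in> trig_polys P" "q \<in> trig_polys P"
  shows "(\<lambda>x. p x * q x) \<in> trig_polys P"
proof -
  obtain N a M b where *: "finite N" "p = (\<lambda>x. \<Sum>n\<in>N. a n * fourier_char P n x)"
    "finite M" "q = (\<lambda>x. \<Sum>n\<in>M. b n * fourier_char P n x)"
    using assms unfolding trig_polys_def by blast
  have "(\<lambda>x. p x * q x) = (\<lambda>x. \<Sum>n\<in>N. \<Sum>m\<in>M. (a n * b m) * fourier_char P (n + m) x)"
    unfolding * by (simp add: sum_product fourier_char_mult[symmetric] mult_ac)
  thus ?thesis
    using * by (auto intro!: trig_polys_sum trig_polys_char)
qed

text \<open>
  The link from polynomials in two real variables, which the Stone-Weierstrass theorem provides, to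
  trigonometric polynomials: on the circle a real linear form is a combination of \<open>z\<close> and \<open>1/z\<close>.
\<close>
lemma real_polynomial_on_circle_trig:
  assumes "real_polynomial_function g"
  shows "(\<lambda>x. complex_of_real (g (fourier_char P 1 x))) \<in> trig_polys P"
  using assms
proof induction
  case (linear f)
  then interpret bounded_linear f .
  have "complex_of_real (f (fourier_char P 1 x))
      = (of_real (f 1) / 2 + of_real (f \<i>) / (2 * \<i>)) * fourier_char P 1 x
      + (of_real (f 1) / 2 - of_real (f \<i>) / (2 * \<i>)) * fourier_char P (-1) x" for x
  proof -
    define z where "z = fourier_char P 1 x"
    have "z = Re z *\<^sub>R 1 + Im z *\<^sub>R \<i>"
      by (simp add: complex_eq_iff)
    hence "f z = Re z * f 1 + Im z * f \<i>"
      by (metis add scale real_scaleR_def)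
    hence "complex_of_real (f z) = of_real (Re z) * of_real (f 1) + of_real (Im z) * of_real (f \<i>)"
      by simp
    also have "\<dots> = (of_real (f 1) / 2 + of_real (f \<i>) / (2 * \<i>)) * z + (of_real (f 1) / 2 - of_real (f \<i>) / (2 * \<i>)) * cnj z"
      by (simp add: complex_eq_iff field_simps)
    finally show ?thesis by (simp add: z_def cnj_fourier_char)
  qed
  thus ?case by (simp add: trig_polys_add trig_polys_char)
next
  case (const c)
  show ?case using trig_polys_char[of "of_real c" P 0] by (simp add: fourier_char_def)
qed (auto intro: trig_polys_add trig_polys_mult)

text \<open>
  Membership in the \<open>L2\<close>-closure of the trigonometric polynomials cut off to the window.
\<close>
definition trig_approximable :: "real \<Rightarrow> real \<Rightarrow> (real \<Rightarrow> complex) \<Rightarrow> bool" where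
  "trig_approximable c P h \<longleftrightarrow> h \<in> L2 \<and>
     (\<forall>\<delta>>0. \<exists>p\<in>trig_polys P. L2_sq (\<lambda>x. h x - indicator {c<..<c+P} x * p x) < \<delta>)"

lemma trig_poly_windowed_L2:
  assumes "p \<in> trig_polys P"
  shows "(\<lambda>x. indicator {c<..<c+P} x * p x) \<in> L2"
proof -
  obtain N a where *: "finite N" "p = (\<lambda>x. \<Sum>n\<in>N. a n * fourier_char P n x)"
    using assms unfolding trig_polys_def by blast
  have "(\<lambda>x. indicator {c<..<c+P} x * p x) = (\<lambda>x. \<Sum>n\<in>N. a n * windowed_char c P n x)"
    by (simp add: * windowed_char_def sum_distrib_left mult_ac)
  thus ?thesis by (simp add: L2_sum L2_cmult windowed_char_L2)
qed

lemma trig_approximable_limit: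
  assumes h: "h \<in> L2" and near: "\<And>\<delta>. \<delta> > 0 \<Longrightarrow> \<exists>g. trig_approximable c P g \<and> L2_sq (\<lambda>x. h x - g x) < \<delta>"
  shows "trig_approximable c P h"
  unfolding trig_approximable_def
proof (intro conjI h allI impI)
  fix \<delta> :: real assume \<delta>: "\<delta> > 0"
  obtain g where g: "trig_approximable c P g" "L2_sq (\<lambda>x. h x - g x) < \<delta> / 4"
    using near[of "\<delta> / 4"] \<delta> by auto
  obtain p where p: "p \<in> trig_polys P" "L2_sq (\<lambda>x. g x - indicator {c<..<c+P} x * p x) < \<delta> / 4"
    using g(1) \<delta> unfolding trig_approximable_def by (meson zero_less_divide_iff zero_less_numeral)
  have "L2_sq (\<lambda>x. h x - indicator {c<..<c+P} x * p x) < \<delta>"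
    using L2_sq_diff_triangle[OF h _ trig_poly_windowed_L2[OF p(1)], of g c] g p
    by (auto simp: trig_approximable_def)
  thus "\<exists>p\<in>trig_polys P. L2_sq (\<lambda>x. h x - indicator {c<..<c+P} x * p x) < \<delta>"
    using p(1) by blast
qed

lemma trig_approximable_add:
  assumes "trig_approximable c P f" "trig_approximable c P g"
  shows "trig_approximable c P (\<lambda>x. f x + g x)"
  unfolding trig_approximable_def
proof (intro conjI allI impI)
  show "(\<lambda>x. f x + g x) \<in> L2"
    using assms by (simp add: trig_approximable_def L2_add)
  fix \<delta> :: real assume \<delta>: "\<delta> > 0"
  obtain p q where pq: "p \<in> trig_polys P" "L2_sq (\<lambda>x. f x - indicator {c<..<c+P} x * p x) < \<delta> / 4"
      "q \<in> trig_polys P" "L2_sq (\<lambda>x. g x - indicator {c<..<c+P} x * q x) < \<delta> / 4"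
    using assms \<delta> unfolding trig_approximable_def by (meson zero_less_divide_iff zero_less_numeral)
  let ?u = "\<lambda>x. f x - indicator {c<..<c+P} x * p x" and ?v = "\<lambda>x. g x - indicator {c<..<c+P} x * q x"
  have "L2_sq (\<lambda>x. ?u x + ?v x) \<le> 2 * L2_sq ?u + 2 * L2_sq ?v"
    using assms pq by (intro L2_sq_add_le L2_diff trig_poly_windowed_L2) (auto simp: trig_approximable_def)
  also have "(\<lambda>x. ?u x + ?v x) = (\<lambda>x. f x + g x - indicator {c<..<c+P} x * (p x + q x))"
    by (simp add: algebra_simps)
  finally have "L2_sq (\<lambda>x. f x + g x - indicator {c<..<c+P} x * (p x + q x)) < \<delta>"
    using pq by simp
  thus "\<exists>p\<in>trig_polys P. L2_sq (\<lambda>x. f x + g x - indicator {c<..<c+P} x * p x) < \<delta>"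
    by (intro bexI[of _ "\<lambda>x. p x + q x"] trig_polys_add pq)
qed

lemma L2_sq_cmult: "L2_sq (\<lambda>x. k * f x) = (cmod k)\<^sup>2 * L2_sq f"
  by (simp add: L2_sq_def norm_mult power_mult_distrib)

lemma trig_approximable_cmult:
  assumes "trig_approximable c P f"
  shows "trig_approximable c P (\<lambda>x. k * f x)"
  unfolding trig_approximable_def
proof (intro conjI allI impI)
  show "(\<lambda>x. k * f x) \<in> L2"
    using assms by (simp add: trig_approximable_def L2_cmult)
  fix \<delta> :: real assume \<delta>: "\<delta> > 0"
  have pos: "1 + (cmod k)\<^sup>2 > 0"
    by (simp add: add_pos_nonneg)
  obtain p where p: "p \<in> trig_polys P" "L2_sq (\<lambda>x. f x - indicator {c<..<c+P} x * p x) < \<delta> / (1 + (cmod k)\<^sup>2)"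
    using assms \<delta> pos unfolding trig_approximable_def by (meson zero_less_divide_iff)
  have "(\<lambda>x. k * p x) \<in> trig_polys P"
    using trig_polys_mult[OF trig_polys_char[of k P 0] p(1)] by (simp add: fourier_char_def)
  moreover have "L2_sq (\<lambda>x. k * f x - indicator {c<..<c+P} x * (k * p x)) < \<delta>"
  proof -
    have "(\<lambda>x. k * f x - indicator {c<..<c+P} x * (k * p x)) = (\<lambda>x. k * (f x - indicator {c<..<c+P} x * p x))"
      by (simp add: algebra_simps)
    hence "L2_sq (\<lambda>x. k * f x - indicator {c<..<c+P} x * (k * p x)) 
        = (cmod k)\<^sup>2 * L2_sq (\<lambda>x. f x - indicator {c<..<c+P} x * p x)"
      by (simp only: L2_sq_cmult)
    also have "\<dots> \<le> (1 + (cmod k)\<^sup>2) * L2_sq (\<lambda>x. f x - indicator {c<..<c+P} x * p x)"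
      by (intro mult_right_mono) auto
    also have "\<dots> < \<delta>"
      using p(2) pos by (simp add: field_simps)
    finally show ?thesis .
  qed
  ultimately show "\<exists>p\<in>trig_polys P. L2_sq (\<lambda>x. k * f x - indicator {c<..<c+P} x * p x) < \<delta>"
    by (intro bexI[of _ "\<lambda>x. k * p x"])
qed


text \<open>
  Two points less than a period apart have different images on the circle; this keeps sets that are
  disjoint in the window disjoint on the circle.
\<close>
lemma fourier_char_inj:
  assumes "P > 0" "\<bar>x - y\<bar> < P" "fourier_char P 1 x = fourier_char P 1 y"
  shows "x = y"
proof -
  have "cis (2 * pi * (x - y) / P) = fourier_char P 1 x / fourier_char P 1 y"
    by (simp add: fourier_char_def cis_divide right_diff_distrib diff_divide_distrib)
  also have "\<dots> = 1"
    using assms(3) by (simp add: fourier_char_def)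
  finally have "cos (2 * pi * (x - y) / P) = 1"
    by (metis cis.sel(1) one_complex.sel(1))
  then obtain n :: int where n: "2 * pi * (x - y) / P = of_int n * 2 * pi"
    using cos_one_2pi_int by auto
  hence "2 * pi * ((x - y) / P) = 2 * pi * of_int n"
    by simp
  hence "(x - y) / P = of_int n"
    by (subst (asm) mult_cancel_left) simp
  hence eq: "x - y = of_int n * P"
    using assms(1) by (simp add: field_simps)
  hence "\<bar>of_int n :: real\<bar> < 1"
    using assms(1,2) by (simp add: abs_mult)
  hence "n = 0" by linarith
  thus ?thesis using eq by simp
qed

lemma continuous_on_fourier_char [continuous_intros]: "continuous_on A (fourier_char P n)"
  unfolding fourier_char_def[abs_def] divide_inverse by (intro continuous_intros)

text \<open>
  By regularity of Lebesgue measure, \<open>B\<close> lies between a compact \<open>C\<close> and an open \<open>U\<close> inside the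
  window that differ by little. The images of \<open>C\<close> and of the complement of \<open>U\<close> are disjoint compact
  subsets of the circle, so Urysohn's lemma gives a continuous function on the plane separating them,
  and Stone-Weierstrass a polynomial close to it on the circle.
\<close>
lemma trig_approximable_indicator:
  assumes P: "P > 0" and B: "B \<in> sets borel" "B \<subseteq> {c<..<c+P}"
  shows "trig_approximable c P (indicator B)"
  unfolding trig_approximable_def
proof (intro conjI allI impI)
  have B': "indicator B = (\<lambda>x. indicator B x * windowed_char c P 0 x)"
    using B(2) by (auto simp: fun_eq_iff windowed_char_def fourier_char_def indicator_def)
  show BL2: "indicator B \<in> L2"
    by (subst B', intro L2_indicator windowed_char_L2 B)
  fix \<delta> :: real assume \<delta>: "\<delta> > 0"
  obtain U0 where U0: "open U0" "B \<subseteq> U0" "emeasure lborel (U0 - B) < ennreal (\<delta>/8)"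
    using outer_regular_lborel[OF B(1), of "\<delta>/8"] \<delta> by auto
  define U where "U = U0 \<inter> {c<..<c+P}"
  have U: "open U" "B \<subseteq> U" "U \<subseteq> {c<..<c+P}"
    using U0 B by (auto simp: U_def)
  have "emeasure lborel (U - B) \<le> emeasure lborel (U0 - B)"
    using U0 B by (intro emeasure_mono) (auto simp: U_def)
  hence UB: "emeasure lborel (U - B) < ennreal (\<delta>/8)"
    using U0(3) by (rule le_less_trans)
  obtain V where V: "open V" "- B \<subseteq> V" "emeasure lborel (V - (- B)) < ennreal (\<delta>/8)"
    using outer_regular_lborel[of "- B" "\<delta>/8"] B \<delta> by auto
  define C where "C = - V"
  have C: "closed C" "C \<subseteq> B"
    using V by (auto simp: C_def)
  have BC: "emeasure lborel (B - C) < ennreal (\<delta>/8)"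
    using V(3) by (simp add: C_def Diff_eq Int_commute)
  have "bounded C"
    by (rule bounded_subset[of "{c..c+P}"]) (use C(2) B(2) in \<open>force simp: subset_eq\<close>)+
  hence "compact C"
    using C by (simp add: compact_eq_bounded_closed)
  define w where "w = fourier_char P 1"
  define T where "T = w ` ({c..c+P} - U)"
  have cont: "continuous_on A w" for A
    unfolding w_def by (intro continuous_intros)
  have "closed (w ` C)"
    by (intro compact_imp_closed compact_continuous_image cont \<open>compact C\<close>)
  moreover have "closed T"
    unfolding T_def by (intro compact_imp_closed compact_continuous_image cont compact_diff U) auto
  moreover have "w ` C \<inter> T = {}"
  proof -
    have False if "x \<in> C" "y \<in> {c..c+P}" "y \<notin> U" "w x = w y" for x y
    proof -
      have "x \<in> {c<..<c+P}" using that C B by auto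
      hence "\<bar>x - y\<bar> < P" using that by auto
      hence "x = y"
        using that P unfolding w_def by (intro fourier_char_inj)
      thus False using that C U by auto
    qed
    thus ?thesis unfolding T_def by fastforce
  qed
  ultimately obtain f :: "complex \<Rightarrow> real" where f: "continuous_on UNIV f"
      "\<And>x. f x \<in> closed_segment 1 0" "\<And>x. x \<in> w ` C \<Longrightarrow> f x = 1" "\<And>x. x \<in> T \<Longrightarrow> f x = 0"
    using Urysohn[of "w ` C" T "1::real" 0] by metis
  have f01: "0 \<le> f x" "f x \<le> 1" for x
    using f(2)[of x] by (auto simp: closed_segment_eq_real_ivl)
  \<comment> \<open>uniform error \<open>\<eta>\<close> costs \<open>2 \<eta>\<^sup>2 P = \<delta> / 4\<close>, and \<open>U - C\<close> costs at most \<open>2 (\<delta> / 8 + \<delta> / 8) = \<delta> / 2\<close>\<close>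
  define \<eta> where "\<eta> = sqrt (\<delta> / (8 * P))"
  have \<eta>: "\<eta> > 0" "\<eta>\<^sup>2 = \<delta> / (8 * P)"
    using \<delta> P by (simp_all add: \<eta>_def)
  obtain g where g: "real_polynomial_function g" "\<And>z. z \<in> sphere 0 1 \<Longrightarrow> \<bar>f z - g z\<bar> < \<eta>"
    using Stone_Weierstrass_real_polynomial_function[of "sphere 0 1" f \<eta>] f(1) \<eta>
    by (metis compact_sphere continuous_on_subset subset_UNIV)
  define p where "p x = complex_of_real (g (w x))" for x
  have p: "p \<in> trig_polys P"
    unfolding p_def[abs_def] w_def by (rule real_polynomial_on_circle_trig[OF g(1)])
  have pointwise: "(cmod (indicator B x - indicator {c<..<c+P} x * p x))\<^sup>2
      \<le> 2 * indicator (U - C) x + 2 * \<eta>\<^sup>2 * indicator {c<..<c+P} x" for x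
  proof (cases "x \<in> {c<..<c+P}")
    case False
    hence "x \<notin> B" using B by auto
    thus ?thesis using False by (auto simp: indicator_def)
  next
    case True
    have "indicator B x - p x = of_real (indicator B x - f (w x)) + of_real (f (w x) - g (w x))"
      by (simp add: p_def indicator_def)
    hence "(cmod (indicator B x - p x))\<^sup>2 \<le> 2 * (indicator B x - f (w x))\<^sup>2 + 2 * (f (w x) - g (w x))\<^sup>2"
      using cmod_add_sq_le[of "of_real (indicator B x - f (w x))" "of_real (f (w x) - g (w x))"]
      by (metis norm_of_real power2_abs)
    also have "(indicator B x - f (w x))\<^sup>2 \<le> indicator (U - C) x"
    proof -
      consider "x \<in> C" | "x \<in> U" "x \<notin> C" | "x \<notin> U" by blast
      thus ?thesis
      proof cases
        case 1
        thus ?thesis using f(3)[of "w x"] C by auto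
      next
        case 2
        have "(indicator B x - f (w x))\<^sup>2 \<le> 1"
          using f01[of "w x"] by (auto simp: abs_square_le_1 indicator_def)
        thus ?thesis using 2 by simp
      next
        case 3
        hence "w x \<in> T" using True by (auto simp: T_def)
        thus ?thesis using 3 f(4)[of "w x"] U by (auto simp: indicator_def)
      qed
    qed
    also have "(f (w x) - g (w x))\<^sup>2 \<le> \<eta>\<^sup>2"
      using g(2)[of "w x"] \<eta> by (intro power2_le_iff_abs_le[THEN iffD2]) (auto simp: w_def)
    finally show ?thesis
      using True by simp
  qed
  have "ennreal (L2_sq (\<lambda>x. indicator B x - indicator {c<..<c+P} x * p x))
      = (\<integral>\<^sup>+x. ennreal ((cmod (indicator B x - indicator {c<..<c+P} x * p x))\<^sup>2) \<partial>lborel)"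
    by (rule nn_integral_L2[symmetric]) (intro L2_diff BL2 trig_poly_windowed_L2 p)
  also have "\<dots> \<le> (\<integral>\<^sup>+x. ennreal (2 * indicator (U - C) x + 2 * \<eta>\<^sup>2 * indicator {c<..<c+P} x) \<partial>lborel)"
    by (intro nn_integral_mono ennreal_leI pointwise)
  also have "\<dots> = (\<integral>\<^sup>+x. 2 * indicator (U - C) x + ennreal (2 * \<eta>\<^sup>2) * indicator {c<..<c+P} x \<partial>lborel)"
    by (intro nn_integral_cong) (auto simp: indicator_def)
  also have "\<dots> = 2 * emeasure lborel (U - C) + ennreal (2 * \<eta>\<^sup>2) * emeasure lborel {c<..<c+P}"
  proof -
    have [measurable]: "U - C \<in> sets borel"
      using U C by auto
    show ?thesis
      by (simp add: nn_integral_add nn_integral_cmult)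
  qed
  also have "\<dots> \<le> 2 * (ennreal (\<delta>/8) + ennreal (\<delta>/8)) + ennreal (\<delta> / 4)"
  proof (intro add_mono mult_left_mono)
    have "U - C = (U - B) \<union> (B - C)"
      using U C by auto
    hence "emeasure lborel (U - C) \<le> emeasure lborel (U - B) + emeasure lborel (B - C)"
      using U B C by (auto intro!: emeasure_subadditive)
    also have "\<dots> \<le> ennreal (\<delta>/8) + ennreal (\<delta>/8)"
      using UB BC by (intro add_mono) auto
    finally show "emeasure lborel (U - C) \<le> ennreal (\<delta>/8) + ennreal (\<delta>/8)" .
    show "ennreal (2 * \<eta>\<^sup>2) * emeasure lborel {c<..<c+P} \<le> ennreal (\<delta> / 4)"
      using P \<delta> by (simp add: \<eta> ennreal_mult[symmetric])
  qed auto
  also have "\<dots> = ennreal (3 * \<delta> / 4)"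
    using \<delta> by (simp add: ennreal_plus[symmetric] ennreal_mult[symmetric] ennreal_numeral[symmetric]
          del: ennreal_plus ennreal_numeral)
  finally have "L2_sq (\<lambda>x. indicator B x - indicator {c<..<c+P} x * p x) \<le> 3 * \<delta> / 4"
    using \<delta> by (subst (asm) ennreal_le_iff) auto
  hence "L2_sq (\<lambda>x. indicator B x - indicator {c<..<c+P} x * p x) < \<delta>"
    using \<delta> by simp
  thus "\<exists>p\<in>trig_polys P. L2_sq (\<lambda>x. indicator B x - indicator {c<..<c+P} x * p x) < \<delta>"
    using p by blast
qed


lemma trig_approximable_simple:
  assumes P: "P > 0" and F: "simple_function borel F" "\<And>x. x \<notin> {c<..<c+P} \<Longrightarrow> F x = 0"
  shows "trig_approximable c P F"
proof -
  have sum: "trig_approximable c P (\<lambda>x. \<Sum>i\<in>I. g i x)" if "finite I" "\<And>i. i \<in> I \<Longrightarrow> trig_approximable c P (g i)"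
    for I :: "complex set" and g
    using that
  proof (induction I rule: finite_induct)
    case empty
    show ?case using trig_approximable_indicator[OF P, of "{}" c] by (simp add: indicator_def[abs_def])
  qed (auto intro: trig_approximable_add)
  have "F x = (\<Sum>y\<in>F ` UNIV - {0}. y * indicator (F -` {y}) x)" for x
  proof -
    have "F x = (\<Sum>y\<in>F ` UNIV. indicator (F -` {y}) x *\<^sub>R y)"
      by (rule simple_function_indicator_representation_banach[OF F(1), unfolded space_borel Int_UNIV_right, OF UNIV_I])
    also have "\<dots> = (\<Sum>y\<in>F ` UNIV - {0}. y * indicator (F -` {y}) x)"
      using F(1) by (intro sum.mono_neutral_cong_right)
        (auto simp: simple_function_def indicator_def)
    finally show ?thesis .
  qed
  hence eq: "(\<lambda>x. \<Sum>y\<in>F ` UNIV - {0}. y * indicator (F -` {y}) x) = F"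
    by (intro ext) (rule sym)
  have "trig_approximable c P (\<lambda>x. \<Sum>y\<in>F ` UNIV - {0}. y * indicator (F -` {y}) x)"
  proof (intro sum trig_approximable_cmult trig_approximable_indicator P)
    fix y assume y: "y \<in> F ` UNIV - {0}"
    show "F -` {y} \<in> sets borel"
      using F(1) y by (auto simp: simple_function_def)
    show "F -` {y} \<subseteq> {c<..<c+P}"
      using F(2) y by fastforce
  qed (use F(1) in \<open>auto simp: simple_function_def\<close>)
  thus ?thesis
    by (rule back_subst[where P = "trig_approximable c P"]) (rule eq)
qed

lemma trig_approximable_L2:
  assumes P: "P > 0" and h: "h \<in> L2" "\<And>x. x \<notin> {c<..<c+P} \<Longrightarrow> h x = 0"
  shows "trig_approximable c P h"
proof (rule trig_approximable_limit[OF h(1)])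
  obtain F where F: "\<And>i. simple_function borel (F i)" "\<And>x. (\<lambda>i. F i x) \<longlonglongrightarrow> h x"
      "\<And>i x. dist (F i x) 0 \<le> 2 * dist (h x) 0"
    using borel_measurable_implies_sequence_metric[OF L2_measurable[OF h(1)], of 0] by auto
  have approx: "trig_approximable c P (F i)" for i
  proof (rule trig_approximable_simple[OF P F(1)])
    fix x assume "x \<notin> {c<..<c+P}"
    thus "F i x = 0" using F(3)[of i x] h(2)[of x] by simp
  qed
  have "(\<lambda>i. LINT x|lborel. (cmod (h x - F i x))\<^sup>2) \<longlonglongrightarrow> (LINT (x::real)|lborel. 0)"
  proof (rule integral_dominated_convergence[where w = "\<lambda>x. 9 * (cmod (h x))\<^sup>2"])
    show "integrable lborel (\<lambda>x. 9 * (cmod (h x))\<^sup>2)"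
      by (intro integrable_mult_right L2_square_integrable h)
    have [measurable]: "F i \<in> borel_measurable borel" "h \<in> borel_measurable borel" for i
      using approx[of i] h(1) by (auto simp: trig_approximable_def L2_measurable)
    show "(\<lambda>x. (cmod (h x - F i x))\<^sup>2) \<in> borel_measurable lborel" for i
      by measurable
    show "AE x in lborel. (\<lambda>i. (cmod (h x - F i x))\<^sup>2) \<longlonglongrightarrow> 0"
    proof (rule AE_I2)
      fix x
      have "(\<lambda>i. (cmod (h x - F i x))\<^sup>2) \<longlonglongrightarrow> (cmod (h x - h x))\<^sup>2"
        by (intro tendsto_intros F)
      thus "(\<lambda>i. (cmod (h x - F i x))\<^sup>2) \<longlonglongrightarrow> 0" by simp
    qed
    show "AE x in lborel. norm ((cmod (h x - F i x))\<^sup>2) \<le> 9 * (cmod (h x))\<^sup>2" for i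
    proof (rule AE_I2)
      fix x
      have "cmod (h x - F i x) \<le> 3 * cmod (h x)"
        using norm_triangle_ineq4[of "h x" "F i x"] F(3)[of i x] by simp
      hence "(cmod (h x - F i x))\<^sup>2 \<le> (3 * cmod (h x))\<^sup>2"
        by (intro power_mono) auto
      thus "norm ((cmod (h x - F i x))\<^sup>2) \<le> 9 * (cmod (h x))\<^sup>2"
        by (simp add: power_mult_distrib)
    qed
  qed simp
  hence lim: "(\<lambda>i. L2_sq (\<lambda>x. h x - F i x)) \<longlonglongrightarrow> 0"
    by (simp add: L2_sq_def)
  fix \<delta> :: real assume "\<delta> > 0"
  then obtain i where "L2_sq (\<lambda>x. h x - F i x) < \<delta>"
    using order_tendstoD(2)[OF lim, of \<delta>] by (meson eventually_happens trivial_limit_sequentially)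
  thus "\<exists>g. trig_approximable c P g \<and> L2_sq (\<lambda>x. h x - g x) < \<delta>"
    using approx by blast
qed

text \<open>
  Completeness of the trigonometric system: Bessel's inequality bounds the sum from above, and density
  of the trigonometric polynomials from below.
\<close>
theorem Parseval_interval:
  assumes P: "P > 0" and h: "h \<in> L2" "\<And>x. x \<notin> {c<..<c+P} \<Longrightarrow> h x = 0"
  shows "(\<integral>\<^sup>+n. ennreal ((cmod (LINT x|lborel. h x * fourier_char P n x))\<^sup>2) \<partial>count_space UNIV)
       = ennreal (P * L2_sq h)"
proof -
  define k where "k n = L2_inner h (windowed_char c P n)" for n
  have k: "(LINT x|lborel. h x * fourier_char P n x) = k (- n)" for n
    unfolding k_def L2_inner_def
    by (intro Bochner_Integration.integral_cong)
       (use h(2) in \<open>auto simp: windowed_char_def cnj_fourier_char indicator_def\<close>)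
  have "(\<integral>\<^sup>+n. ennreal ((cmod (k (- n)))\<^sup>2) \<partial>count_space UNIV)
      = (\<integral>\<^sup>+n. ennreal ((cmod (k n))\<^sup>2) \<partial>count_space UNIV)"
    by (rule nn_integral_bij_count_space[of uminus UNIV UNIV "\<lambda>n. ennreal ((cmod (k n))\<^sup>2)"])
       (auto intro!: bij_betwI[where g = uminus])
  also have "\<dots> = (SUP N\<in>{N. finite N \<and> N \<subseteq> UNIV}. \<Sum>n\<in>N. ennreal ((cmod (k n))\<^sup>2))"
    by (simp add: infsum_eq_nn_integral_count_space[symmetric] nonneg_infsum_complete)
  also have "\<dots> = ennreal (P * L2_sq h)"
  proof (rule antisym)
    show "(SUP N\<in>{N. finite N \<and> N \<subseteq> UNIV}. \<Sum>n\<in>N. ennreal ((cmod (k n))\<^sup>2)) \<le> ennreal (P * L2_sq h)"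
    proof (rule SUP_least, clarify)
      fix N :: "int set" assume N: "finite N"
      have "0 \<le> L2_sq h - (\<Sum>n\<in>N. (cmod (k n))\<^sup>2) / P"
        using L2_sq_diff_trig_sum[OF P h(1) N, of "\<lambda>n. k n / P" c] 
          L2_sq_nonneg[of "\<lambda>x. h x - (\<Sum>n\<in>N. k n / P * windowed_char c P n x)"]
        unfolding k_def by simp
      hence "(\<Sum>n\<in>N. (cmod (k n))\<^sup>2) \<le> P * L2_sq h"
        using P by (simp add: field_simps)
      thus "(\<Sum>n\<in>N. ennreal ((cmod (k n))\<^sup>2)) \<le> ennreal (P * L2_sq h)"
        by (simp add: ennreal_leI)
    qed
    show "ennreal (P * L2_sq h) \<le> (SUP N\<in>{N. finite N \<and> N \<subseteq> UNIV}. \<Sum>n\<in>N. ennreal ((cmod (k n))\<^sup>2))"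
      (is "_ \<le> ?S")
    proof (rule ennreal_le_epsilon)
      fix e :: real assume e: "e > 0"
      obtain p where p: "p \<in> trig_polys P" "L2_sq (\<lambda>x. h x - indicator {c<..<c+P} x * p x) < e / P"
        using trig_approximable_L2[OF P h] e P unfolding trig_approximable_def by (meson zero_less_divide_iff)
      then obtain N a where N: "finite N" "p = (\<lambda>x. \<Sum>n\<in>N. a n * fourier_char P n x)"
        unfolding trig_polys_def by blast
      have "indicator {c<..<c+P} x * p x = (\<Sum>n\<in>N. a n * windowed_char c P n x)" for x
        by (simp add: N windowed_char_def sum_distrib_left mult_ac)
      hence "L2_sq (\<lambda>x. h x - (\<Sum>n\<in>N. a n * windowed_char c P n x)) < e / P"
        using p(2) by (simp only:)
      moreover have "P * (\<Sum>n\<in>N. (cmod (a n - k n / P))\<^sup>2) \<ge> 0"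
        using P by (intro mult_nonneg_nonneg sum_nonneg) auto
      ultimately have "L2_sq h - (\<Sum>n\<in>N. (cmod (k n))\<^sup>2) / P < e / P"
        unfolding L2_sq_diff_trig_sum[OF P h(1) N(1)] k_def by linarith
      hence "L2_sq h < ((\<Sum>n\<in>N. (cmod (k n))\<^sup>2) + e) / P"
        by (simp add: add_divide_distrib)
      hence "P * L2_sq h \<le> (\<Sum>n\<in>N. (cmod (k n))\<^sup>2) + e"
        using P by (simp add: pos_less_divide_eq mult.commute)
      hence "ennreal (P * L2_sq h) \<le> ennreal ((\<Sum>n\<in>N. (cmod (k n))\<^sup>2) + e)"
        by (rule ennreal_leI)
      also have "\<dots> = (\<Sum>n\<in>N. ennreal ((cmod (k n))\<^sup>2)) + ennreal e"
        using e by (simp add: sum_nonneg)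
      also have "\<dots> \<le> ?S + ennreal e"
        using N(1) by (intro add_right_mono SUP_upper) auto
      finally show "ennreal (P * L2_sq h) \<le> ?S + ennreal e" .
    qed
  qed
  finally show ?thesis by (simp add: k)
qed


section \<open>Plancherel's theorem and the Fourier transform on L2\<close>

lemma borel_measurable_cis [measurable (raw)]:
  "f \<in> borel_measurable M \<Longrightarrow> (\<lambda>x. cis (f x)) \<in> borel_measurable M"
  by (rule measurable_compose[OF _ borel_measurable_continuous_onI[OF continuous_on_cis[OF continuous_on_id]]])

text \<open>
  Half-open intervals, so that for a fixed \<open>P > 0\<close> they partition the whole line and the index of the
  tile containing a point is a floor.
\<close>
definition tile :: "real \<Rightarrow> real \<Rightarrow> int \<Rightarrow> real set" where
  "tile c P m = {c + of_int m * P..<c + of_int m * P + P}"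

lemma tile_borel [measurable]: "tile c P m \<in> sets borel"
  by (simp add: tile_def)

lemma mem_tile_iff:
  assumes "P > 0"
  shows "x \<in> tile c P m \<longleftrightarrow> m = \<lfloor>(x - c) / P\<rfloor>"
proof -
  have "x \<in> tile c P m \<longleftrightarrow> of_int m \<le> (x - c) / P \<and> (x - c) / P < of_int m + 1"
    using assms by (auto simp: tile_def pos_le_divide_eq pos_divide_less_eq algebra_simps)
  also have "\<dots> \<longleftrightarrow> m = \<lfloor>(x - c) / P\<rfloor>"
    by (auto simp: floor_unique intro: sym)
  finally show ?thesis .
qed

lemma nn_integral_count_space_tile:
  fixes F :: "int \<Rightarrow> ennreal"
  assumes "P > 0"
  shows "(\<integral>\<^sup>+m. indicator (tile c P m) x * F m \<partial>count_space UNIV) = F \<lfloor>(x - c) / P\<rfloor>"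
proof -
  have "(\<integral>\<^sup>+m. indicator (tile c P m) x * F m \<partial>count_space UNIV)
      = (\<Sum>m\<in>{\<lfloor>(x - c) / P\<rfloor>}. indicator (tile c P m) x * F m)"
    by (rule nn_integral_count_space') (auto simp: mem_tile_iff[OF assms] indicator_def)
  thus ?thesis
    using mem_tile_iff[OF assms, of x c "\<lfloor>(x - c) / P\<rfloor>"] by simp
qed

lemma nn_integral_tiles:
  fixes u :: "real \<Rightarrow> ennreal" and F :: "int \<Rightarrow> ennreal"
  assumes "P > 0" and [measurable]: "u \<in> borel_measurable borel"
  shows "(\<integral>\<^sup>+x. F \<lfloor>(x - c) / P\<rfloor> * u x \<partial>lborel)
       = (\<integral>\<^sup>+m. F m * (\<integral>\<^sup>+x. indicator (tile c P m) x * u x \<partial>lborel) \<partial>count_space UNIV)"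
proof -
  have "(\<integral>\<^sup>+x. F \<lfloor>(x - c) / P\<rfloor> * u x \<partial>lborel)
      = (\<integral>\<^sup>+x. (\<integral>\<^sup>+m. indicator (tile c P m) x * F m * u x \<partial>count_space UNIV) \<partial>lborel)"
    by (simp add: nn_integral_multc nn_integral_count_space_tile[OF assms(1)])
  also have "\<dots> = (\<integral>\<^sup>+m. (\<integral>\<^sup>+x. indicator (tile c P m) x * F m * u x \<partial>lborel) \<partial>count_space UNIV)"
    by (rule nn_integral_count_space_nn_integral) auto
  also have "\<dots> = (\<integral>\<^sup>+m. (\<integral>\<^sup>+x. F m * (indicator (tile c P m) x * u x) \<partial>lborel) \<partial>count_space UNIV)"
    by (simp add: mult_ac)
  also have "\<dots> = (\<integral>\<^sup>+m. F m * (\<integral>\<^sup>+x. indicator (tile c P m) x * u x \<partial>lborel) \<partial>count_space UNIV)"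
    by (simp add: nn_integral_cmult)
  finally show ?thesis .
qed

definition fourier_integral :: "(real \<Rightarrow> complex) \<Rightarrow> real \<Rightarrow> complex" where
  "fourier_integral f \<omega> = (LINT x|lborel. cis (- (2 * pi * x * \<omega>)) * f x)"

lemma fourier_integral_measurable:
  assumes [measurable]: "f \<in> borel_measurable borel"
  shows "fourier_integral f \<in> borel_measurable borel"
  unfolding fourier_integral_def[abs_def] by measurable

lemma truncated_fourier_eq:
  "truncated_fourier u R = fourier_integral (\<lambda>x. indicator {-R..R} x * u x)"
proof
  fix \<omega>
  have "exp (- 2 * of_real pi * \<i> * of_real x * of_real \<omega>) = cis (- (2 * pi * x * \<omega>))" for x
    by (simp add: cis_conv_exp mult_ac)
  thus "truncated_fourier u R \<omega> = fourier_integral (\<lambda>x. indicator {-R..R} x * u x) \<omega>"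
    unfolding truncated_fourier_def fourier_integral_def set_lebesgue_integral_def
    by (intro Bochner_Integration.integral_cong) (auto simp: indicator_def)
qed

definition vanishes_outside :: "real \<Rightarrow> (real \<Rightarrow> complex) \<Rightarrow> bool" where
  "vanishes_outside R f \<longleftrightarrow> (\<forall>x. \<bar>x\<bar> > R \<longrightarrow> f x = 0)"

lemma vanishes_outside_mono: "vanishes_outside R f \<Longrightarrow> R \<le> R' \<Longrightarrow> vanishes_outside R' f"
  by (auto simp: vanishes_outside_def)

lemma vanishes_outside_truncation: "vanishes_outside R (\<lambda>x. indicator {-R..R} x * f x)"
  by (auto simp: vanishes_outside_def indicator_def)

lemma integrable_vanishes_outside:
  assumes "f \<in> L2" "vanishes_outside R f"
  shows "integrable lborel f"
proof -
  define R' where "R' = \<bar>R\<bar> + 1"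
  have "integrable lborel (\<lambda>x. f x * cnj (windowed_char (- R') (2 * R') 0 x))"
    by (intro L2_inner_integrable assms windowed_char_L2)
  also have "(\<lambda>x. f x * cnj (windowed_char (- R') (2 * R') 0 x)) = f"
  proof
    fix x
    show "f x * cnj (windowed_char (- R') (2 * R') 0 x) = f x"
    proof (cases "f x = 0")
      case False
      hence "\<bar>x\<bar> \<le> R"
        using assms(2) by (force simp: vanishes_outside_def)
      hence "x \<in> {- R'<..<- R' + 2 * R'}"
        by (auto simp: R'_def)
      thus ?thesis by (simp add: windowed_char_def fourier_char_def)
    qed simp
  qed
  finally show ?thesis .
qed

lemma fourier_integrand_integrable:
  assumes "integrable lborel f"
  shows "integrable lborel (\<lambda>x. cis (- (2 * pi * x * \<omega>)) * f x)"
proof (rule Bochner_Integration.integrable_bound[OF assms])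
  have [measurable]: "f \<in> borel_measurable borel"
    using borel_measurable_integrable[OF assms] by simp
  show "(\<lambda>x. cis (- (2 * pi * x * \<omega>)) * f x) \<in> borel_measurable lborel"
    by measurable
qed (auto simp: norm_mult)

lemma fourier_integral_add:
  assumes "integrable lborel f" "integrable lborel g"
  shows "fourier_integral (\<lambda>x. f x + g x) = (\<lambda>\<omega>. fourier_integral f \<omega> + fourier_integral g \<omega>)"
  unfolding fourier_integral_def
  by (simp add: distrib_left fourier_integrand_integrable assms)

lemma fourier_integral_diff:
  assumes "integrable lborel f" "integrable lborel g"
  shows "fourier_integral (\<lambda>x. f x - g x) = (\<lambda>\<omega>. fourier_integral f \<omega> - fourier_integral g \<omega>)"
  unfolding fourier_integral_def
  by (simp add: right_diff_distrib fourier_integrand_integrable assms)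

lemma fourier_integral_cmult:
  "fourier_integral (\<lambda>x. k * f x) = (\<lambda>\<omega>. k * fourier_integral f \<omega>)"
  unfolding fourier_integral_def by (simp add: mult.left_commute)

text \<open>
  Plancherel from Fourier series. If \<open>f\<close> is supported in a window of length \<open>P\<close>, then the samples of
  its transform at \<open>\<theta> + m / P\<close> are the Fourier coefficients of \<open>cis (- 2 \<pi> \<theta> x) f x\<close>, whose squares add up to
  \<open>P * L2_sq f\<close> whatever \<open>\<theta>\<close> is. Integrating over \<open>0 \<le> \<theta> < 1 / P\<close> covers the frequency line once.
\<close>
lemma Plancherel_compact_support:
  assumes f: "f \<in> L2" "vanishes_outside R f"
  shows "fourier_integral f \<in> L2" "L2_sq (fourier_integral f) = L2_sq f"
proof -
  define P where "P = 2 * (\<bar>R\<bar> + 1)"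
  have P: "P > 0" by (simp add: P_def add_pos_nonneg)
  note [measurable] = f(1)
  have [measurable]: "fourier_integral f \<in> borel_measurable borel"
    by (rule fourier_integral_measurable) measurable
  have sampled: "(\<integral>\<^sup>+m. ennreal ((cmod (fourier_integral f (\<theta> - of_int m * (1 / P))))\<^sup>2) \<partial>count_space UNIV)
      = ennreal (P * L2_sq f)" for \<theta>
  proof -
    define h where "h x = cis (- (2 * pi * x * \<theta>)) * f x" for x
    have "h \<in> L2"
      unfolding h_def[abs_def] by (rule L2_bounded_mult[where K = 1]) (use f in auto)
    moreover have "h x = 0" if "x \<notin> {- (P / 2)<..< - (P / 2) + P}" for x
    proof -
      have "P / 2 = \<bar>R\<bar> + 1" by (simp add: P_def)
      hence "\<bar>x\<bar> > R" using that unfolding greaterThanLessThan_iff by linarith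
      thus ?thesis using f(2) by (simp add: h_def vanishes_outside_def)
    qed
    ultimately have "(\<integral>\<^sup>+n. ennreal ((cmod (LINT x|lborel. h x * fourier_char P n x))\<^sup>2) \<partial>count_space UNIV)
        = ennreal (P * L2_sq h)"
      by (rule Parseval_interval[OF P])
    moreover have "L2_sq h = L2_sq f"
      by (simp add: L2_sq_def h_def norm_mult)
    moreover have "(LINT x|lborel. h x * fourier_char P n x) = fourier_integral f (\<theta> - of_int n * (1 / P))" for n
    proof -
      have "h x * fourier_char P n x = cis (- (2 * pi * x * (\<theta> - of_int n * (1 / P)))) * f x" for x
      proof -
        have "cis (- (2 * pi * x * \<theta>)) * fourier_char P n x = cis (- (2 * pi * x * (\<theta> - of_int n * (1 / P))))"
          unfolding fourier_char_def cis_mult by (rule arg_cong[where f = cis]) (simp add: algebra_simps)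
        thus ?thesis by (simp add: h_def mult_ac)
      qed
      thus ?thesis by (simp add: fourier_integral_def)
    qed
    ultimately show ?thesis by simp
  qed
  let ?u = "\<lambda>\<omega>. ennreal ((cmod (fourier_integral f \<omega>))\<^sup>2)"
  have shift: "(\<integral>\<^sup>+\<omega>. indicator (tile 0 (1 / P) m) \<omega> * ?u \<omega> \<partial>lborel)
      = (\<integral>\<^sup>+\<theta>. indicator {0..<1/P} \<theta> * ?u (\<theta> - of_int (- m) * (1 / P)) \<partial>lborel)" for m
    by (subst nn_integral_real_affine[where c = 1 and t = "of_int m * (1 / P)"])
       (auto intro!: nn_integral_cong simp: tile_def indicator_def algebra_simps)
  have "(\<integral>\<^sup>+\<omega>. ?u \<omega> \<partial>lborel) = (\<integral>\<^sup>+m. (\<integral>\<^sup>+\<omega>. indicator (tile 0 (1 / P) m) \<omega> * ?u \<omega> \<partial>lborel)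
         \<partial>count_space (UNIV :: int set))"
    using P nn_integral_tiles[of "1 / P" ?u "\<lambda>_. 1" 0] by simp
  also have "\<dots> = (\<integral>\<^sup>+m. (\<integral>\<^sup>+\<theta>. indicator {0..<1/P} \<theta> * ?u (\<theta> - of_int (- m) * (1 / P)) \<partial>lborel) \<partial>count_space (UNIV :: int set))"
    by (simp only: shift)
  also have "\<dots> = (\<integral>\<^sup>+m. (\<integral>\<^sup>+\<theta>. indicator {0..<1/P} \<theta> * ?u (\<theta> - of_int m * (1 / P)) \<partial>lborel) \<partial>count_space (UNIV :: int set))"
    by (rule nn_integral_bij_count_space[of uminus UNIV UNIV 
          "\<lambda>m. \<integral>\<^sup>+\<theta>. indicator {0..<1/P} \<theta> * ?u (\<theta> - of_int m * (1 / P)) \<partial>lborel"])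
       (auto intro!: bij_betwI[where g = uminus])
  also have "\<dots> = (\<integral>\<^sup>+\<theta>. (\<integral>\<^sup>+m. indicator {0..<1/P} \<theta> * ?u (\<theta> - of_int m * (1 / P)) \<partial>count_space (UNIV :: int set)) \<partial>lborel)"
    by (rule nn_integral_count_space_nn_integral[symmetric]) auto
  also have "\<dots> = (\<integral>\<^sup>+\<theta>. ennreal (P * L2_sq f) * indicator {0..<1/P} \<theta> \<partial>lborel)"
    using sampled by (simp add: nn_integral_cmult mult.commute)
  also have "\<dots> = ennreal (L2_sq f)"
    using P by (simp add: nn_integral_cmult_indicator ennreal_mult[symmetric])
  finally have *: "(\<integral>\<^sup>+\<omega>. ?u \<omega> \<partial>lborel) = ennreal (L2_sq f)" .
  show L2: "fourier_integral f \<in> L2"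
    by (subst L2_iff_nn_integral) (auto simp: *)
  show "L2_sq (fourier_integral f) = L2_sq f"
    using * nn_integral_L2[OF L2] by simp
qed

lemma vanishes_outside_add:
  "vanishes_outside R f \<Longrightarrow> vanishes_outside R g \<Longrightarrow> vanishes_outside R (\<lambda>x. f x + g x)"
  by (auto simp: vanishes_outside_def)

lemma vanishes_outside_diff:
  "vanishes_outside R f \<Longrightarrow> vanishes_outside R g \<Longrightarrow> vanishes_outside R (\<lambda>x. f x - g x)"
  by (auto simp: vanishes_outside_def)

lemma vanishes_outside_cmult: "vanishes_outside R f \<Longrightarrow> vanishes_outside R (\<lambda>x. k * f x)"
  by (auto simp: vanishes_outside_def)

lemma Parseval_compact_support:
  assumes f: "f \<in> L2" "vanishes_outside R f" and g: "g \<in> L2" "vanishes_outside R g"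
  shows "L2_inner (fourier_integral f) (fourier_integral g) = L2_inner f g"
proof -
  have Re: "Re (L2_inner (fourier_integral f) (fourier_integral u)) = Re (L2_inner f u)"
    if u: "u \<in> L2" "vanishes_outside R u" for u
  proof -
    have "L2_sq (\<lambda>\<omega>. fourier_integral f \<omega> + fourier_integral u \<omega>) = L2_sq (\<lambda>x. f x + u x)"
      using Plancherel_compact_support(2)[OF L2_add[OF f(1) u(1)] vanishes_outside_add[OF f(2) u(2)]]
      by (simp add: fourier_integral_add integrable_vanishes_outside[OF f] integrable_vanishes_outside[OF u])
    thus ?thesis
      by (simp add: L2_sq_polarization f u Plancherel_compact_support[OF f] Plancherel_compact_support[OF u])
  qed
  have "Re (L2_inner (fourier_integral f) (\<lambda>\<omega>. \<i> * fourier_integral g \<omega>)) = Re (L2_inner f (\<lambda>x. \<i> * g x))"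
    using Re[OF L2_cmult[OF g(1), of \<i>] vanishes_outside_cmult[OF g(2)]] by (simp add: fourier_integral_cmult)
  hence "Im (L2_inner (fourier_integral f) (fourier_integral g)) = Im (L2_inner f g)"
    by (simp add: L2_inner_cmult_right)
  with Re[OF g] show ?thesis
    by (simp add: complex_eq_iff)
qed

lemma truncation_L2: "f \<in> L2 \<Longrightarrow> (\<lambda>x. indicator {-R..R} x * f x) \<in> L2"
  by (rule L2_indicator) auto

lemma truncation_tendsto:
  assumes f: "f \<in> L2"
  shows "(\<lambda>n. L2_sq (\<lambda>x. indicator {-real n..real n} x * f x - f x)) \<longlonglongrightarrow> 0"
proof -
  have "(\<lambda>n. LINT x|lborel. (cmod (indicator {-real n..real n} x * f x - f x))\<^sup>2) \<longlonglongrightarrow> (LINT (x::real)|lborel. 0)"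
  proof (rule integral_dominated_convergence[where w = "\<lambda>x. (cmod (f x))\<^sup>2"])
    show "integrable lborel (\<lambda>x. (cmod (f x))\<^sup>2)"
      by (rule L2_square_integrable[OF f])
    note [measurable] = f
    show "(\<lambda>x. (cmod (indicator {-real n..real n} x * f x - f x))\<^sup>2) \<in> borel_measurable lborel" for n
      by measurable
    show "AE x in lborel. (\<lambda>n. (cmod (indicator {-real n..real n} x * f x - f x))\<^sup>2) \<longlonglongrightarrow> 0"
    proof (rule AE_I2)
      fix x :: real
      obtain N where N: "\<bar>x\<bar> \<le> real N"
        using real_arch_simple by blast
      have "\<forall>\<^sub>F n in sequentially. (cmod (indicator {-real n..real n} x * f x - f x))\<^sup>2 = 0"
        using eventually_ge_at_top[of N]
      proof eventually_elim
        case (elim n)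
        hence "\<bar>x\<bar> \<le> real n" using N by linarith
        hence "x \<in> {-real n..real n}" by auto
        thus ?case by simp
      qed
      thus "(\<lambda>n. (cmod (indicator {-real n..real n} x * f x - f x))\<^sup>2) \<longlonglongrightarrow> 0"
        by (rule tendsto_eventually)
    qed
    show "AE x in lborel. norm ((cmod (indicator {-real n..real n} x * f x - f x))\<^sup>2) \<le> (cmod (f x))\<^sup>2" for n
      by (auto simp: indicator_def)
  qed simp
  thus ?thesis by (simp add: L2_sq_def)
qed

lemma fourier_truncation_L2: "f \<in> L2 \<Longrightarrow> truncated_fourier f R \<in> L2"
  unfolding truncated_fourier_eq
  by (rule Plancherel_compact_support[OF truncation_L2 vanishes_outside_truncation])

lemma is_fourier_transformD:
  assumes "is_fourier_transform u v" "u \<in> L2"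
  shows "v \<in> L2" "(\<lambda>n. L2_sq (\<lambda>\<omega>. truncated_fourier u (real n) \<omega> - v \<omega>)) \<longlonglongrightarrow> 0"
proof -
  show v: "v \<in> L2" using assms by (simp add: is_fourier_transform_def)
  have "(\<lambda>n. ennreal (L2_sq (\<lambda>\<omega>. truncated_fourier u (real n) \<omega> - v \<omega>))) \<longlonglongrightarrow> ennreal 0"
    using assms by (simp add: is_fourier_transform_def nn_integral_L2[OF L2_diff[OF fourier_truncation_L2 v]])
  thus "(\<lambda>n. L2_sq (\<lambda>\<omega>. truncated_fourier u (real n) \<omega> - v \<omega>)) \<longlonglongrightarrow> 0"
    by (subst (asm) tendsto_ennreal_iff) auto
qed

text \<open>
  The truncations converge to \<open>f\<close> in \<open>L2\<close>, and their transforms form a Cauchy sequence because the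
  transform is isometric on functions with bounded support.
\<close>
theorem fourier_transform_exists:
  assumes f: "f \<in> L2"
  shows "\<exists>v. is_fourier_transform f v"
proof -
  let ?f = "\<lambda>n x. indicator {-real n..real n} x * f x"
  have trunc: "?f n \<in> L2" "vanishes_outside (real n) (?f n)" for n
    by (rule truncation_L2[OF f], rule vanishes_outside_truncation)
  have isometry: "L2_sq (\<lambda>\<omega>. truncated_fourier f (real m) \<omega> - truncated_fourier f (real n) \<omega>)
      = L2_sq (\<lambda>x. ?f m x - ?f n x)" for m n
  proof -
    have "vanishes_outside (real (max m n)) (\<lambda>x. ?f m x - ?f n x)"
      by (intro vanishes_outside_diff vanishes_outside_mono[OF trunc(2)]) auto
    hence "L2_sq (fourier_integral (\<lambda>x. ?f m x - ?f n x)) = L2_sq (\<lambda>x. ?f m x - ?f n x)"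
      by (intro Plancherel_compact_support L2_diff trunc)
    thus ?thesis
      unfolding truncated_fourier_eq
        fourier_integral_diff[OF integrable_vanishes_outside[OF trunc] integrable_vanishes_outside[OF trunc]] .
  qed
  have "\<exists>v\<in>L2. (\<lambda>n. L2_sq (\<lambda>\<omega>. truncated_fourier f (real n) \<omega> - v \<omega>)) \<longlonglongrightarrow> 0"
  proof (rule L2_complete)
    fix e :: real assume "e > 0"
    hence "\<forall>\<^sub>F n in sequentially. L2_sq (\<lambda>x. ?f n x - f x) < e / 4"
      by (intro order_tendstoD(2)[OF truncation_tendsto[OF f]]) simp
    then obtain N where N: "\<And>n. n \<ge> N \<Longrightarrow> L2_sq (\<lambda>x. ?f n x - f x) < e / 4"
      by (auto simp: eventually_sequentially)
    have "L2_sq (\<lambda>\<omega>. truncated_fourier f (real m) \<omega> - truncated_fourier f (real n) \<omega>) < e"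
      if "m \<ge> N" "n \<ge> N" for m n
      using L2_sq_diff_triangle[OF trunc(1)[of m] f trunc(1)[of n]] N[OF that(1)] N[OF that(2)]
        L2_sq_minus_commute[of f "?f n"] unfolding isometry by linarith
    thus "\<exists>N. \<forall>m\<ge>N. \<forall>n\<ge>N. L2_sq (\<lambda>x. truncated_fourier f (real m) x - truncated_fourier f (real n) x) < e"
      by blast
  qed (rule fourier_truncation_L2[OF f])
  then obtain v where v: "v \<in> L2" "(\<lambda>n. L2_sq (\<lambda>\<omega>. truncated_fourier f (real n) \<omega> - v \<omega>)) \<longlonglongrightarrow> 0"
    by blast
  have "(\<lambda>n. ennreal (L2_sq (\<lambda>\<omega>. truncated_fourier f (real n) \<omega> - v \<omega>))) \<longlonglongrightarrow> ennreal 0"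
    by (intro tendsto_ennrealI v)
  hence "is_fourier_transform f v"
    using v by (simp add: is_fourier_transform_def nn_integral_L2[OF L2_diff[OF fourier_truncation_L2[OF f] v(1)]])
  thus ?thesis by (rule exI[of _ v])
qed

lemma is_fourier_transform_fourier: "f \<in> L2 \<Longrightarrow> is_fourier_transform f (fourier f)"
  unfolding fourier_def using fourier_transform_exists by (rule someI_ex)

text \<open>
  The freedom to repair a Fourier transform on a null set, which later makes almost everywhere
  conditions hold everywhere.
\<close>
lemma is_fourier_transform_cong_AE:
  assumes "is_fourier_transform u v" "v' \<in> borel_measurable borel" "AE \<omega> in lborel. v \<omega> = v' \<omega>"
  shows "is_fourier_transform u v'"
proof -
  have "v' \<in> L2"
    using assms by (auto intro: L2_cong_AE simp: is_fourier_transform_def)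
  moreover have "(\<integral>\<^sup>+\<omega>. ennreal ((cmod (truncated_fourier u (real n) \<omega> - v \<omega>))\<^sup>2) \<partial>lborel)
      = (\<integral>\<^sup>+\<omega>. ennreal ((cmod (truncated_fourier u (real n) \<omega> - v' \<omega>))\<^sup>2) \<partial>lborel)" for n
    using assms(3) by (intro nn_integral_cong_AE) (auto elim!: eventually_mono)
  ultimately show ?thesis
    using assms(1) by (simp add: is_fourier_transform_def)
qed

lemma L2_sq_shift: "L2_sq (\<lambda>x. f (x - y)) = L2_sq f"
  unfolding L2_sq_def
  by (subst (2) lborel_integral_real_affine[where c = 1 and t = "-y"]) auto

lemma fourier_integral_shift_modulate:
  "fourier_integral (\<lambda>t. cis (2 * pi * \<eta> * (t - y)) * f (t - y)) \<omega>
    = cis (- (2 * pi * y * \<omega>)) * fourier_integral f (\<omega> - \<eta>)"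
proof -
  have "fourier_integral (\<lambda>t. cis (2 * pi * \<eta> * (t - y)) * f (t - y)) \<omega>
      = (LINT t|lborel. cis (- (2 * pi * (y + t) * \<omega>)) * (cis (2 * pi * \<eta> * t) * f t))"
    unfolding fourier_integral_def
    by (subst lborel_integral_real_affine[where c = 1 and t = y]) auto
  also have "\<dots> = (LINT t|lborel. cis (- (2 * pi * y * \<omega>)) * (cis (- (2 * pi * t * (\<omega> - \<eta>))) * f t))"
  proof (intro Bochner_Integration.integral_cong refl)
    fix t
    have "cis (- (2 * pi * (y + t) * \<omega>)) * cis (2 * pi * \<eta> * t)
        = cis (- (2 * pi * y * \<omega>)) * cis (- (2 * pi * t * (\<omega> - \<eta>)))"
      unfolding cis_mult by (rule arg_cong[where f = cis]) (simp add: algebra_simps)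
    thus "cis (- (2 * pi * (y + t) * \<omega>)) * (cis (2 * pi * \<eta> * t) * f t)
        = cis (- (2 * pi * y * \<omega>)) * (cis (- (2 * pi * t * (\<omega> - \<eta>))) * f t)"
      by (metis mult.assoc)
  qed
  also have "\<dots> = cis (- (2 * pi * y * \<omega>)) * fourier_integral f (\<omega> - \<eta>)"
    unfolding fourier_integral_def by simp
  finally show ?thesis .
qed

lemma cis_mult_L2:
  assumes "f \<in> L2"
  shows "(\<lambda>x. cis (a * x) * f x) \<in> L2"
  by (rule L2_bounded_mult[where K = 1]) (use assms in auto)

text \<open>
  Parseval's identity for the building blocks of the frame. For truncations of \<open>f\<close> and \<open>\<phi>\<close> both sides
  are integrals of functions with bounded support, where the transform of a shifted and modulated
  function can be computed by substitution; both sides are continuous in \<open>L2\<close>.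
\<close>
lemma L2_inner_shift_modulate:
  assumes f: "f \<in> L2" "is_fourier_transform f g" and \<phi>: "\<phi> \<in> L2" "is_fourier_transform \<phi> \<psi>"
  shows "L2_inner f (\<lambda>t. cis (2 * pi * \<eta> * (t - y)) * \<phi> (t - y))
       = L2_inner g (\<lambda>\<omega>. cis (- (2 * pi * y * \<omega>)) * \<psi> (\<omega> - \<eta>))"
proof -
  let ?f = "\<lambda>n x. indicator {-real n..real n} x * f x"
  let ?\<phi> = "\<lambda>n x. indicator {-real n..real n} x * \<phi> x"
  let ?G = "\<lambda>\<phi> t. cis (2 * pi * \<eta> * (t - y)) * \<phi> (t - y)"
  let ?H = "\<lambda>\<psi> \<omega>. cis (- (2 * pi * y * \<omega>)) * \<psi> (\<omega> - \<eta>)"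
  have G: "?G u \<in> L2" if "u \<in> L2" for u
    using L2_translate[OF cis_mult_L2[OF that]] .
  have H: "?H u \<in> L2" if "u \<in> L2" for u
    using cis_mult_L2[OF L2_translate[OF that], of "- (2 * pi * y)"] by (simp add: mult.assoc)
  have sqG: "L2_sq (\<lambda>x. ?G u x - ?G v x) = L2_sq (\<lambda>x. u x - v x)" for u v
    using L2_sq_shift[of "\<lambda>x. u x - v x" y]
    by (simp add: L2_sq_def norm_mult right_diff_distrib[symmetric])
  have sqH: "L2_sq (\<lambda>x. ?H u x - ?H v x) = L2_sq (\<lambda>x. u x - v x)" for u v
    using L2_sq_shift[of "\<lambda>x. u x - v x" \<eta>]
    by (simp add: L2_sq_def norm_mult right_diff_distrib[symmetric])
  have "L2_sq (\<lambda>x. ?G (?\<phi> n) x - ?G \<phi> x) = L2_sq (\<lambda>x. ?\<phi> n x - \<phi> x)" for n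
    by (rule sqG[of "?\<phi> n" \<phi>])
  hence limG: "(\<lambda>n. L2_sq (\<lambda>x. ?G (?\<phi> n) x - ?G \<phi> x)) \<longlonglongrightarrow> 0"
    using truncation_tendsto[OF \<phi>(1)] by (simp only:)
  have limH: "(\<lambda>n. L2_sq (\<lambda>x. ?H (truncated_fourier \<phi> (real n)) x - ?H \<psi> x)) \<longlonglongrightarrow> 0"
    using is_fourier_transformD(2)[OF \<phi>(2,1)] by (simp only: sqH)
  have "(\<lambda>n. L2_inner (?f n) (?G (?\<phi> n))) \<longlonglongrightarrow> L2_inner f (?G \<phi>)"
    by (rule L2_inner_tendsto[OF f(1) truncation_L2[OF f(1)] truncation_tendsto[OF f(1)] 
          G[OF \<phi>(1)] G[OF truncation_L2[OF \<phi>(1)]] limG])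
  moreover have "(\<lambda>n. L2_inner (truncated_fourier f (real n)) (?H (truncated_fourier \<phi> (real n)))) 
      \<longlonglongrightarrow> L2_inner g (?H \<psi>)"
    by (rule L2_inner_tendsto[OF is_fourier_transformD(1)[OF f(2,1)] fourier_truncation_L2[OF f(1)]
          is_fourier_transformD(2)[OF f(2,1)] H[OF is_fourier_transformD(1)[OF \<phi>(2,1)]] 
          H[OF fourier_truncation_L2[OF \<phi>(1)]] limH])
  moreover have "L2_inner (truncated_fourier f (real n)) (?H (truncated_fourier \<phi> (real n))) 
      = L2_inner (?f n) (?G (?\<phi> n))" for n
  proof -
    have "?H (truncated_fourier \<phi> (real n)) = fourier_integral (?G (?\<phi> n))"
      unfolding truncated_fourier_eq by (intro ext fourier_integral_shift_modulate[symmetric])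
    moreover have "vanishes_outside (real n + \<bar>y\<bar>) (?G (?\<phi> n))"
      by (auto simp: vanishes_outside_def indicator_def)
    ultimately show ?thesis
      unfolding truncated_fourier_eq
      by (simp only:) (intro Parseval_compact_support[where R = "real n + \<bar>y\<bar>"] truncation_L2 f \<phi> G
          vanishes_outside_mono[OF vanishes_outside_truncation]; simp)
  qed
  ultimately show ?thesis
    by (simp only: LIMSEQ_unique)
qed


section \<open>Sampling and aliasing\<close>

lemma Parseval_tile:
  assumes P: "P > 0" and h: "h \<in> L2"
  shows "(\<integral>\<^sup>+n. ennreal ((cmod (LINT x|lborel. indicator (tile c P m) x * (h x * fourier_char P n x)))\<^sup>2) \<partial>count_space UNIV)
       = ennreal P * (\<integral>\<^sup>+x. indicator (tile c P m) x * ennreal ((cmod (h x))\<^sup>2) \<partial>lborel)"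
proof -
  define c' where "c' = c + of_int m * P"
  define h' where "h' x = indicator {c'<..<c'+P} x * h x" for x
  note [measurable] = h
  have h': "h' \<in> L2" "\<And>x. x \<notin> {c'<..<c'+P} \<Longrightarrow> h' x = 0"
    unfolding h'_def[abs_def] using h by (auto intro: L2_indicator)
  have AE: "AE x in lborel. h' x = indicator (tile c P m) x * h x"
    using AE_lborel_singleton[of c']
    by eventually_elim (auto simp: h'_def tile_def c'_def indicator_def)
  have [measurable]: "h' \<in> borel_measurable borel"
    using h' by (simp add: L2_measurable)
  have coeff: "(LINT x|lborel. indicator (tile c P m) x * (h x * fourier_char P n x))
      = (LINT x|lborel. h' x * fourier_char P n x)" for n
    using AE by (intro integral_cong_AE) (auto elim!: eventually_mono)
  have "(\<integral>\<^sup>+x. indicator (tile c P m) x * ennreal ((cmod (h x))\<^sup>2) \<partial>lborel)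
      = (\<integral>\<^sup>+x. ennreal ((cmod (h' x))\<^sup>2) \<partial>lborel)"
    using AE by (intro nn_integral_cong_AE) (auto simp: indicator_def elim!: eventually_mono)
  also have "\<dots> = ennreal (L2_sq h')"
    by (rule nn_integral_L2[OF h'(1)])
  finally show ?thesis
    using P Parseval_interval[OF P h', of c'] by (simp add: coeff ennreal_mult)
qed

lemma sum_inverse_squares_le:
  "(\<Sum>m\<in>{- int M..int M} - {0}. 1 / (real_of_int m)\<^sup>2) \<le> 4 - 2 / real (max 1 M)"
proof (induction M)
  case (Suc M)
  have "{- int (Suc M)..int (Suc M)} - {0} = insert (int (Suc M)) (insert (- int (Suc M)) ({- int M..int M} - {0}))"
    by auto
  moreover have "(- 1 - real M) * (- 1 - real M) = (1 + real M) * (1 + real M)"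
    by (simp add: algebra_simps)
  ultimately have "(\<Sum>m\<in>{- int (Suc M)..int (Suc M)} - {0}. 1 / (real_of_int m)\<^sup>2)
      = 2 / (real (Suc M))\<^sup>2 + (\<Sum>m\<in>{- int M..int M} - {0}. 1 / (real_of_int m)\<^sup>2)"
    by (simp add: power2_eq_square)
  also have "\<dots> \<le> 4 - 2 / real (max 1 (Suc M))"
  proof (cases "M = 0")
    case False
    have "2 / (real (Suc M))\<^sup>2 \<le> 2 / (real M * real (Suc M))"
      using False by (intro divide_left_mono) (auto simp: power2_eq_square)
    also have "\<dots> = 2 / real M - 2 / real (Suc M)"
      using False by (simp add: field_simps)
    finally have "2 / (real (Suc M))\<^sup>2 \<le> 2 / real M - 2 / real (Suc M)" .
    moreover have "max 1 M = M" "max 1 (Suc M) = Suc M" using False by auto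
    ultimately show ?thesis using Suc.IH by simp
  qed simp
  finally show ?case .
qed simp

lemma sum_le_nn_integral_count_space:
  fixes F :: "'a \<Rightarrow> ennreal"
  assumes "finite A"
  shows "sum F A \<le> (\<integral>\<^sup>+x. F x \<partial>count_space UNIV)"
proof -
  have "sum F A = (\<integral>\<^sup>+x. F x * indicator A x \<partial>count_space UNIV)"
    using assms by (subst nn_integral_count_space'[of A]) auto
  also have "\<dots> \<le> (\<integral>\<^sup>+x. F x \<partial>count_space UNIV)"
    by (intro nn_integral_mono) (auto simp: indicator_def)
  finally show ?thesis .
qed

text \<open>
  Cauchy-Schwarz with weights \<open>1 / m\<^sup>2\<close>, whose sum over \<open>m \<noteq> 0\<close> is below \<open>4\<close>. The price is the factor \<open>m\<^sup>2\<close>,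
  which the decay of the far part will absorb.
\<close>
lemma norm_sum_squared_weighted_le:
  fixes d :: "int \<Rightarrow> complex"
  shows "(cmod (\<Sum>m\<in>{- int M..int M} - {0}. d m))\<^sup>2
       \<le> 4 * (\<Sum>m\<in>{- int M..int M} - {0}. (of_int m)\<^sup>2 * (cmod (d m))\<^sup>2)"
proof -
  let ?S = "{- int M..int M} - {0}"
  have "(cmod (\<Sum>m\<in>?S. d m))\<^sup>2 \<le> (\<Sum>m\<in>?S. cmod (d m))\<^sup>2"
    by (intro power_mono norm_sum) simp
  also have "(\<Sum>m\<in>?S. cmod (d m)) = (\<Sum>m\<in>?S. (1 / of_int m) * (of_int m * cmod (d m)))"
    by (intro sum.cong) auto
  also have "\<dots>\<^sup>2 \<le> (\<Sum>m\<in>?S. (1 / of_int m)\<^sup>2) * (\<Sum>m\<in>?S. (of_int m * cmod (d m))\<^sup>2)"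
    by (rule Cauchy_Schwarz_ineq_sum)
  also have "\<dots> \<le> 4 * (\<Sum>m\<in>?S. (of_int m * cmod (d m))\<^sup>2)"
  proof (intro mult_right_mono sum_nonneg)
    have "2 / real (max 1 M) \<ge> 0" by simp
    thus "(\<Sum>m\<in>?S. (1 / real_of_int m)\<^sup>2) \<le> 4"
      using sum_inverse_squares_le[of M] unfolding power_divide power_one by linarith
  qed auto
  finally show ?thesis
    by (simp add: power_mult_distrib)
qed

text \<open>
  A character of period \<open>P\<close> cannot tell the tiles apart, so the coefficients of the part of \<open>h\<close> outside
  the tile \<open>0\<close> are sums of the coefficients of its tiles, each of which obeys Parseval's identity. On
  the tile \<open>0\<close> the weight on the right vanishes.
\<close>
lemma far_coefficients_bound:
  assumes P: "P > 0" and h: "h \<in> L2" "integrable lborel h"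
  shows "(\<integral>\<^sup>+n. ennreal ((cmod (LINT x|lborel. indicator (- tile c P 0) x * (h x * fourier_char P n x)))\<^sup>2) \<partial>count_space UNIV)
       \<le> 4 * ennreal P * (\<integral>\<^sup>+x. ennreal ((of_int \<lfloor>(x - c) / P\<rfloor>)\<^sup>2) * ennreal ((cmod (h x))\<^sup>2) \<partial>lborel)"
proof -
  note [measurable] = h(1)
  define S where "S M = {- int M..int M} - {0}" for M
  define d where "d n m = (LINT x|lborel. indicator (tile c P m) x * (h x * fourier_char P n x))" for n m
  define D where "D n = (LINT x|lborel. indicator (- tile c P 0) x * (h x * fourier_char P n x))" for n
  have ind_sum: "(\<Sum>m\<in>S M. indicator (tile c P m) x) = (indicator (S M) \<lfloor>(x - c) / P\<rfloor> :: complex)" for M x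
  proof -
    have "indicator (tile c P m) x = (if m = \<lfloor>(x - c) / P\<rfloor> then 1 else 0 :: complex)" for m
      by (simp add: indicator_def mem_tile_iff[OF P])
    thus ?thesis by (simp add: S_def indicator_def)
  qed
  have hn: "integrable lborel (\<lambda>x. b x * (h x * fourier_char P n x))"
    if "b \<in> borel_measurable borel" "\<And>x. cmod (b x) \<le> 1" for b n
    by (rule Bochner_Integration.integrable_bound[OF h(2)])
       (use that in \<open>auto simp: norm_mult intro!: mult_left_le_one_le\<close>)
  have lim: "(\<lambda>M. \<Sum>m\<in>S M. d n m) \<longlonglongrightarrow> D n" for n
  proof -
    have "(\<lambda>M. LINT x|lborel. (\<Sum>m\<in>S M. indicator (tile c P m) x) * (h x * fourier_char P n x)) \<longlonglongrightarrow> D n"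
      unfolding D_def
    proof (rule integral_dominated_convergence[where w = "\<lambda>x. cmod (h x)"])
      show "integrable lborel (\<lambda>x. cmod (h x))"
        using h(2) by (rule integrable_norm)
      show "AE x in lborel. (\<lambda>M. (\<Sum>m\<in>S M. indicator (tile c P m) x) * (h x * fourier_char P n x))
          \<longlonglongrightarrow> indicator (- tile c P 0) x * (h x * fourier_char P n x)"
      proof (rule AE_I2, rule tendsto_eventually)
        fix x
        show "\<forall>\<^sub>F M in sequentially. (\<Sum>m\<in>S M. indicator (tile c P m) x) * (h x * fourier_char P n x)
            = indicator (- tile c P 0) x * (h x * fourier_char P n x)"
          using eventually_ge_at_top[of "nat \<bar>\<lfloor>(x - c) / P\<rfloor>\<bar>"]
        proof eventually_elim
          case (elim M)
          hence "\<lfloor>(x - c) / P\<rfloor> \<in> {- int M..int M}"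
            by auto
          hence "indicator (S M) \<lfloor>(x - c) / P\<rfloor> = (indicator (- tile c P 0) x :: complex)"
            using mem_tile_iff[OF P, of x c 0] by (auto simp: S_def indicator_def)
          thus ?case by (simp only: ind_sum)
        qed
      qed
      show "AE x in lborel. norm ((\<Sum>m\<in>S M. indicator (tile c P m) x) * (h x * fourier_char P n x)) \<le> cmod (h x)" for M
        unfolding ind_sum by (auto simp: norm_mult indicator_def)
    qed measurable
    also have "(\<lambda>M. LINT x|lborel. (\<Sum>m\<in>S M. indicator (tile c P m) x) * (h x * fourier_char P n x))
        = (\<lambda>M. \<Sum>m\<in>S M. d n m)"
      unfolding sum_distrib_right d_def
      by (intro ext Bochner_Integration.integral_sum hn) (auto simp: indicator_def)
    finally show ?thesis .
  qed
  \<comment> \<open>pass to the limit in the finite weighted inequality, one coefficient at a time\<close>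
  have pointwise: "ennreal ((cmod (D n))\<^sup>2) \<le> 4 * (\<integral>\<^sup>+m. ennreal ((of_int m)\<^sup>2 * (cmod (d n m))\<^sup>2) \<partial>count_space UNIV)" for n
  proof (rule LIMSEQ_le_const2)
    show "(\<lambda>M. ennreal ((cmod (\<Sum>m\<in>S M. d n m))\<^sup>2)) \<longlonglongrightarrow> ennreal ((cmod (D n))\<^sup>2)"
      by (intro tendsto_intros lim)
    have "ennreal ((cmod (\<Sum>m\<in>S M. d n m))\<^sup>2) \<le> 4 * (\<integral>\<^sup>+m. ennreal ((of_int m)\<^sup>2 * (cmod (d n m))\<^sup>2) \<partial>count_space UNIV)" for M
    proof -
      have "ennreal ((cmod (\<Sum>m\<in>S M. d n m))\<^sup>2) \<le> ennreal (4 * (\<Sum>m\<in>S M. (of_int m)\<^sup>2 * (cmod (d n m))\<^sup>2))"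
        unfolding S_def by (intro ennreal_leI norm_sum_squared_weighted_le)
      also have "\<dots> = 4 * (\<Sum>m\<in>S M. ennreal ((of_int m)\<^sup>2 * (cmod (d n m))\<^sup>2))"
        by (subst sum_ennreal, simp, subst ennreal_mult') simp_all
      also have "\<dots> \<le> 4 * (\<integral>\<^sup>+m. ennreal ((of_int m)\<^sup>2 * (cmod (d n m))\<^sup>2) \<partial>count_space UNIV)"
        by (intro mult_left_mono sum_le_nn_integral_count_space) (auto simp: S_def)
      finally show ?thesis .
    qed
    thus "\<exists>N. \<forall>M\<ge>N. ennreal ((cmod (\<Sum>m\<in>S M. d n m))\<^sup>2) \<le> 4 * (\<integral>\<^sup>+m. ennreal ((of_int m)\<^sup>2 * (cmod (d n m))\<^sup>2) \<partial>count_space UNIV)"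
      by blast
  qed
  have tile: "(\<integral>\<^sup>+n. ennreal ((cmod (d n m))\<^sup>2) \<partial>count_space UNIV)
      = ennreal P * (\<integral>\<^sup>+x. indicator (tile c P m) x * ennreal ((cmod (h x))\<^sup>2) \<partial>lborel)" for m
    unfolding d_def by (rule Parseval_tile[OF P h(1)])
  have "(\<integral>\<^sup>+n. ennreal ((cmod (D n))\<^sup>2) \<partial>count_space UNIV)
      \<le> (\<integral>\<^sup>+n. 4 * (\<integral>\<^sup>+m. ennreal ((of_int m)\<^sup>2 * (cmod (d n m))\<^sup>2) \<partial>count_space UNIV) \<partial>count_space UNIV)"
    by (intro nn_integral_mono pointwise)
  also have "\<dots> = 4 * (\<integral>\<^sup>+n. (\<integral>\<^sup>+m. ennreal ((of_int m)\<^sup>2 * (cmod (d n m))\<^sup>2) \<partial>count_space UNIV) \<partial>count_space UNIV)"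
    by (simp add: nn_integral_cmult)
  also have "(\<integral>\<^sup>+n. (\<integral>\<^sup>+m. ennreal ((of_int m)\<^sup>2 * (cmod (d n m))\<^sup>2) \<partial>count_space UNIV) \<partial>count_space UNIV)
      = (\<integral>\<^sup>+m. (\<integral>\<^sup>+n. ennreal ((of_int m)\<^sup>2 * (cmod (d n m))\<^sup>2) \<partial>count_space UNIV) \<partial>count_space UNIV)"
    by (rule nn_integral_count_space_nn_integral) auto
  also have "\<dots> = (\<integral>\<^sup>+m. ennreal P * (ennreal ((of_int m)\<^sup>2) * (\<integral>\<^sup>+x. indicator (tile c P m) x * ennreal ((cmod (h x))\<^sup>2) \<partial>lborel)) \<partial>count_space UNIV)"
    by (simp add: ennreal_mult nn_integral_cmult tile mult.left_commute)
  also have "\<dots> = ennreal P * (\<integral>\<^sup>+x. ennreal ((of_int \<lfloor>(x - c) / P\<rfloor>)\<^sup>2) * ennreal ((cmod (h x))\<^sup>2) \<partial>lborel)"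
    using nn_integral_tiles[OF P, of "\<lambda>x. ennreal ((cmod (h x))\<^sup>2)" "\<lambda>m. ennreal ((of_int m)\<^sup>2)" c]
    by (simp add: nn_integral_cmult)
  finally show ?thesis
    by (simp add: D_def mult_ac)
qed


lemma ennreal_cmod_add_sq_le:
  "ennreal ((cmod (x + y))\<^sup>2) \<le> 2 * ennreal ((cmod x)\<^sup>2) + 2 * ennreal ((cmod y)\<^sup>2)"
proof -
  have "ennreal ((cmod (x + y))\<^sup>2) \<le> ennreal (2 * (cmod x)\<^sup>2 + 2 * (cmod y)\<^sup>2)"
    by (intro ennreal_leI cmod_add_sq_le)
  also have "\<dots> = 2 * ennreal ((cmod x)\<^sup>2) + 2 * ennreal ((cmod y)\<^sup>2)"
    by (subst ennreal_plus, simp, simp, subst (1 2) ennreal_mult') simp_all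
  finally show ?thesis .
qed

text \<open>
  If \<open>h\<close> lived on the tile \<open>0\<close> alone, its coefficients would have square sum exactly \<open>near\<close>; \<open>far\<close> bounds
  the effect of aliasing. Splitting \<open>h\<close> in this way needs no estimate of cross terms between tiles.
\<close>
lemma sampling_sandwich:
  fixes c P :: real
  assumes P: "P > 0" and h: "h \<in> L2" "integrable lborel h"
  defines "S \<equiv> \<integral>\<^sup>+n. ennreal ((cmod (LINT x|lborel. h x * fourier_char P n x))\<^sup>2) \<partial>count_space UNIV"
    and "near \<equiv> ennreal P * (\<integral>\<^sup>+x. indicator (tile c P 0) x * ennreal ((cmod (h x))\<^sup>2) \<partial>lborel)"
    and "far \<equiv> 4 * ennreal P * (\<integral>\<^sup>+x. ennreal ((of_int \<lfloor>(x - c) / P\<rfloor>)\<^sup>2) * ennreal ((cmod (h x))\<^sup>2) \<partial>lborel)"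
  shows "S \<le> 2 * near + 2 * far" "near \<le> 2 * S + 2 * far"
proof -
  note [measurable] = h(1)
  define u where "u n = (LINT x|lborel. h x * fourier_char P n x)" for n
  define b where "b n = (LINT x|lborel. indicator (tile c P 0) x * (h x * fourier_char P n x))" for n
  define d where "d n = (LINT x|lborel. indicator (- tile c P 0) x * (h x * fourier_char P n x))" for n
  have int: "integrable lborel (\<lambda>x. indicator A x * (h x * fourier_char P n x))" if "A \<in> sets borel" for A n
    by (rule Bochner_Integration.integrable_bound[OF h(2)])
       (use that in \<open>auto simp: norm_mult indicator_def\<close>)
  have split: "u n = b n + d n" for n
  proof -
    have "b n + d n = (LINT x|lborel. indicator (tile c P 0) x * (h x * fourier_char P n x)
        + indicator (- tile c P 0) x * (h x * fourier_char P n x))"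
      unfolding b_def d_def by (rule Bochner_Integration.integral_add[symmetric]) (auto intro!: int)
    also have "\<dots> = u n"
      unfolding u_def by (intro Bochner_Integration.integral_cong) (auto simp: indicator_def)
    finally show ?thesis by simp
  qed
  have near: "near = (\<integral>\<^sup>+n. ennreal ((cmod (b n))\<^sup>2) \<partial>count_space UNIV)"
    unfolding near_def b_def by (rule Parseval_tile[OF P h(1), symmetric])
  have far: "(\<integral>\<^sup>+n. ennreal ((cmod (d n))\<^sup>2) \<partial>count_space UNIV) \<le> far"
    unfolding far_def d_def by (rule far_coefficients_bound[OF P h])
  have "S \<le> (\<integral>\<^sup>+n. 2 * ennreal ((cmod (b n))\<^sup>2) + 2 * ennreal ((cmod (d n))\<^sup>2) \<partial>count_space UNIV)"
    unfolding S_def u_def[symmetric] split by (intro nn_integral_mono ennreal_cmod_add_sq_le)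
  also have "\<dots> = 2 * near + 2 * (\<integral>\<^sup>+n. ennreal ((cmod (d n))\<^sup>2) \<partial>count_space UNIV)"
    by (simp add: nn_integral_add nn_integral_cmult near)
  also have "\<dots> \<le> 2 * near + 2 * far"
    by (intro add_mono mult_left_mono far) auto
  finally show "S \<le> 2 * near + 2 * far" .
  have "near \<le> (\<integral>\<^sup>+n. 2 * ennreal ((cmod (u n))\<^sup>2) + 2 * ennreal ((cmod (d n))\<^sup>2) \<partial>count_space UNIV)"
    unfolding near
  proof (intro nn_integral_mono)
    fix n
    show "ennreal ((cmod (b n))\<^sup>2) \<le> 2 * ennreal ((cmod (u n))\<^sup>2) + 2 * ennreal ((cmod (d n))\<^sup>2)"
      using ennreal_cmod_add_sq_le[of "u n" "- d n"] by (simp add: split)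
  qed
  also have "\<dots> = 2 * S + 2 * (\<integral>\<^sup>+n. ennreal ((cmod (d n))\<^sup>2) \<partial>count_space UNIV)"
    by (simp add: nn_integral_add nn_integral_cmult S_def u_def)
  also have "\<dots> \<le> 2 * S + 2 * far"
    by (intro add_mono mult_left_mono far) auto
  finally show "near \<le> 2 * S + 2 * far" .
qed


section \<open>Dyadic frequency bands\<close>

text \<open>
  \<open>None\<close> stands for the central part \<open>I_centre\<close>, which behaves like a band at scale \<open>0\<close> that contains the
  single integer \<open>0\<close>. All estimates then treat it together with the dyadic bands.
\<close>
type_synonym band = "(nat \<times> freq_sign) option"

fun band_freqs :: "band \<Rightarrow> int set" where
  "band_freqs None = {0}"
| "band_freqs (Some (j, k)) = Z_band j k"

fun band_scale :: "band \<Rightarrow> nat" where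
  "band_scale None = 0"
| "band_scale (Some (j, k)) = j"

lemma UNIV_freq_sign: "(UNIV :: freq_sign set) = {Plus, Minus}"
  using freq_sign.exhaust by blast

lemma countable_bands: "countable (UNIV :: band set)"
proof -
  have "(UNIV :: band set) = insert None (Some ` (UNIV \<times> {Plus, Minus}))"
    unfolding UNIV_freq_sign[symmetric] by (auto simp: UNIV_option_conv)
  moreover have "countable (insert None (Some ` ((UNIV :: nat set) \<times> {Plus, Minus})))"
    by (intro countable_insert countable_image countable_SIGMA) auto
  ultimately show ?thesis by simp
qed

lemma nn_integral_count_space_option:
  fixes F :: "'a option \<Rightarrow> ennreal"
  shows "(\<integral>\<^sup>+b. F b \<partial>count_space UNIV) = F None + (\<integral>\<^sup>+x. F (Some x) \<partial>count_space UNIV)"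
proof -
  have "(\<integral>\<^sup>+b. F b \<partial>count_space UNIV)
      = (\<integral>\<^sup>+b. F b * indicator {None} b + F b * indicator (range Some) b \<partial>count_space UNIV)"
    by (intro nn_integral_cong) (auto simp: indicator_def notin_range_Some)
  also have "\<dots> = F None + (\<integral>\<^sup>+b. F b \<partial>count_space (range Some))"
    by (subst nn_integral_add) (auto simp: nn_integral_count_space_indicator)
  also have "(\<integral>\<^sup>+b. F b \<partial>count_space (range Some)) = (\<integral>\<^sup>+x. F (Some x) \<partial>count_space UNIV)"
    by (rule nn_integral_bij_count_space[symmetric]) (auto simp: bij_betw_def)
  finally show ?thesis .
qed

lemma finite_band_freqs [simp]: "finite (band_freqs b)"
proof (cases b)
  case (Some p)
  thus ?thesis by (cases p; cases "snd p") (auto simp: Z_band_Plus Z_band_Minus)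
qed auto

lemma card_band_freqs: "card (band_freqs b) = 2 ^ band_scale b"
proof (cases b)
  case (Some p)
  obtain j k where "p = (j, k)" by (cases p)
  with Some show ?thesis
    by (cases k) (auto simp: Z_band_Plus Z_band_Minus nat_power_eq)
qed auto

text \<open>
  The summand \<open>1\<close> accommodates the frequency \<open>0\<close> of the central band.
\<close>
lemma band_freqs_size:
  assumes "\<eta> \<in> band_freqs b"
  shows "2 ^ band_scale b \<le> 1 + \<bar>real_of_int \<eta>\<bar>" "\<bar>real_of_int \<eta>\<bar> \<le> 2 * 2 ^ band_scale b"
proof -
  have "2 ^ band_scale b \<le> 1 + \<bar>\<eta>\<bar> \<and> \<bar>\<eta>\<bar> \<le> 2 * 2 ^ band_scale b"
  proof (cases b)
    case (Some p)
    obtain j k where "p = (j, k)" by (cases p)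
    with Some assms show ?thesis
      by (cases k) (auto simp: Z_band_Plus Z_band_Minus)
  qed (use assms in auto)
  hence "real_of_int (2 ^ band_scale b) \<le> real_of_int (1 + \<bar>\<eta>\<bar>)" "real_of_int \<bar>\<eta>\<bar> \<le> real_of_int (2 * 2 ^ band_scale b)"
    by (simp_all only: of_int_le_iff)
  thus "2 ^ band_scale b \<le> 1 + \<bar>real_of_int \<eta>\<bar>" "\<bar>real_of_int \<eta>\<bar> \<le> 2 * 2 ^ band_scale b"
    by simp_all
qed

lemma dyadic_scale_unique:
  assumes "(2::int) ^ i \<le> n" "n < 2 ^ (i + 1)" "2 ^ j \<le> n" "n < 2 ^ (j + 1)"
  shows "i = j"
proof -
  have "(2::int) ^ i < 2 ^ (j + 1)" "(2::int) ^ j < 2 ^ (i + 1)"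
    using assms by linarith+
  hence "i < j + 1" "j < i + 1"
    by (simp_all only: power_strict_increasing_iff)
  thus ?thesis by simp
qed

text \<open>
  The bands partition the integers. Uniqueness bounds sums over all bands by sums over the integers;
  existence is what the lower frame bound rests on.
\<close>
lemma ex1_band: "\<exists>!b. \<eta> \<in> band_freqs b"
proof (cases "\<eta> = 0")
  case True
  have "0 \<notin> Z_band j k" for j k
    by (cases k) (auto simp: Z_band_Plus Z_band_Minus not_le)
  hence "0 \<in> band_freqs b \<longleftrightarrow> b = None" for b
    by (cases b rule: band_freqs.cases) auto
  thus ?thesis using True by auto
next
  case False
  define n where "n = nat \<bar>\<eta>\<bar>"
  obtain j where j: "2 ^ j \<le> n" "n < 2 ^ (j + 1)"
  proof -
    have "n \<ge> 1" using False by (simp add: n_def)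
    thus ?thesis using ex_power_ivl1[of 2 n] that by auto
  qed
  have j': "(2::int) ^ j \<le> \<bar>\<eta>\<bar>" "\<bar>\<eta>\<bar> < 2 ^ (j + 1)"
  proof -
    have "int (2 ^ j) \<le> int n" "int n < int (2 ^ (j + 1))"
      using j by (simp_all only: of_nat_le_iff of_nat_less_iff)
    thus "(2::int) ^ j \<le> \<bar>\<eta>\<bar>" "\<bar>\<eta>\<bar> < 2 ^ (j + 1)"
      by (simp_all add: n_def)
  qed
  have iff: "\<eta> \<in> Z_band i k \<longleftrightarrow> i = j \<and> k = (if \<eta> > 0 then Plus else Minus)" for i k
  proof
    assume *: "\<eta> \<in> Z_band i k"
    have "(2::int) ^ i \<le> \<bar>\<eta>\<bar> \<and> \<bar>\<eta>\<bar> < 2 ^ (i + 1) \<and> k = (if \<eta> > 0 then Plus else Minus)"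
    proof (cases k)
      case Plus
      have "(2::int) ^ i > 0" by simp
      thus ?thesis using * Plus by (auto simp: Z_band_Plus)
    next
      case Minus
      have "(2::int) ^ i > 0" by simp
      thus ?thesis using * Minus by (auto simp: Z_band_Minus)
    qed
    thus "i = j \<and> k = (if \<eta> > 0 then Plus else Minus)"
      using dyadic_scale_unique[of i "\<bar>\<eta>\<bar>" j] j' by blast
  next
    assume "i = j \<and> k = (if \<eta> > 0 then Plus else Minus)"
    thus "\<eta> \<in> Z_band i k"
      using j' False by (auto simp: Z_band_Plus Z_band_Minus)
  qed
  have "\<eta> \<in> band_freqs b \<longleftrightarrow> b = Some (j, if \<eta> > 0 then Plus else Minus)" for b
    using False by (cases b rule: band_freqs.cases) (auto simp: iff)
  thus ?thesis by auto
qed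

text \<open>
  What the decay of the Fourier transform of \<open>\<phi>\<close> leaves of a band at \<open>\<omega>\<close>, after the exponent \<open>s\<close> has been spent
  on the Sobolev weights.
\<close>
definition decay_sum :: "real \<Rightarrow> band \<Rightarrow> real \<Rightarrow> real" where
  "decay_sum \<epsilon> b \<omega> = (\<Sum>\<eta>\<in>band_freqs b. (1 + \<bar>\<omega> - of_int \<eta>\<bar>) powr - (1 + \<epsilon>))"

lemma decay_sum_nonneg: "decay_sum \<epsilon> b \<omega> \<ge> 0"
  unfolding decay_sum_def by (intro sum_nonneg) simp

lemma nn_integral_int_le_nat:
  fixes F :: "nat \<Rightarrow> ennreal"
  shows "(\<integral>\<^sup>+m. F (nat \<bar>m\<bar>) \<partial>count_space (UNIV :: int set)) \<le> 2 * (\<Sum>n. F n)"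
proof -
  have half: "(\<integral>\<^sup>+m. F (nat \<bar>m\<bar>) * indicator (range (\<lambda>n. s * int n)) m \<partial>count_space (UNIV :: int set)) = (\<Sum>n. F n)"
    if "\<bar>s\<bar> = 1" for s
  proof -
    have "(\<integral>\<^sup>+m. F (nat \<bar>m\<bar>) * indicator (range (\<lambda>n. s * int n)) m \<partial>count_space (UNIV :: int set))
        = (\<integral>\<^sup>+m. F (nat \<bar>m\<bar>) \<partial>count_space (range (\<lambda>n. s * int n)))"
      by (simp add: nn_integral_count_space_indicator)
    also have "\<dots> = (\<integral>\<^sup>+n. F (nat \<bar>s * int n\<bar>) \<partial>count_space UNIV)"
      using that by (intro nn_integral_bij_count_space[symmetric]) (auto simp: bij_betw_def inj_on_def)
    also have "\<dots> = (\<Sum>n. F n)"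
      using that by (simp add: abs_mult nn_integral_count_space_nat)
    finally show ?thesis .
  qed
  have "(\<integral>\<^sup>+m. F (nat \<bar>m\<bar>) \<partial>count_space (UNIV :: int set))
      \<le> (\<integral>\<^sup>+m. F (nat \<bar>m\<bar>) * indicator (range (\<lambda>n. 1 * int n)) m + F (nat \<bar>m\<bar>) * indicator (range (\<lambda>n. - 1 * int n)) m
          \<partial>count_space (UNIV :: int set))"
  proof (intro nn_integral_mono)
    fix m :: int
    have "m \<in> range (\<lambda>n. 1 * int n) \<or> m \<in> range (\<lambda>n. - 1 * int n)"
    proof (cases "m \<ge> 0")
      case True
      hence "m = 1 * int (nat m)" by simp
      thus ?thesis by blast
    next
      case False
      hence "m = - 1 * int (nat (- m))" by simp
      thus ?thesis by blast
    qed
    thus "F (nat \<bar>m\<bar>) \<le> F (nat \<bar>m\<bar>) * indicator (range (\<lambda>n. 1 * int n)) m + F (nat \<bar>m\<bar>) * indicator (range (\<lambda>n. - 1 * int n)) m"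
      by (elim disjE) (auto simp: indicator_def intro: add_increasing add_increasing2)
  qed
  also have "\<dots> = 2 * (\<Sum>n. F n)"
    using half[of 1] half[of "-1"] by (subst nn_integral_add) (auto simp: mult_2)
  finally show ?thesis .
qed

text \<open>
  By periodicity in \<open>\<omega>\<close> it is enough to compare with the sum at \<open>\<omega> = 0\<close>, at the cost of a factor
  \<open>2 powr (1 + \<epsilon>)\<close>.
\<close>
lemma decay_lattice_sum_bounded:
  assumes "\<epsilon> > 0"
  shows "\<exists>K>0. \<forall>\<omega>. (\<integral>\<^sup>+\<eta>. ennreal ((1 + \<bar>\<omega> - of_int \<eta>\<bar>) powr - (1 + \<epsilon>)) \<partial>count_space (UNIV :: int set)) \<le> ennreal K"
proof -
  define c where "c n = (real (Suc n)) powr - (1 + \<epsilon>)" for n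
  have sum: "summable c"
    unfolding c_def summable_Suc_iff[of "\<lambda>n. real n powr - (1 + \<epsilon>)"] summable_real_powr_iff using assms by simp
  have c: "c n \<ge> 0" for n by (simp add: c_def)
  define K where "K = 2 powr (1 + \<epsilon>) * (2 * suminf c) + 1"
  have K: "K > 0"
    unfolding K_def by (intro add_nonneg_pos mult_nonneg_nonneg suminf_nonneg sum c) auto
  have bound: "(\<integral>\<^sup>+\<eta>. ennreal ((1 + \<bar>\<omega> - of_int \<eta>\<bar>) powr - (1 + \<epsilon>)) \<partial>count_space (UNIV :: int set)) \<le> ennreal K" for \<omega>
  proof -
    define n where "n = \<lfloor>\<omega>\<rfloor>"
    have "(\<integral>\<^sup>+\<eta>. ennreal ((1 + \<bar>\<omega> - of_int \<eta>\<bar>) powr - (1 + \<epsilon>)) \<partial>count_space (UNIV :: int set))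
        = (\<integral>\<^sup>+m. ennreal ((1 + \<bar>\<omega> - of_int (m + n)\<bar>) powr - (1 + \<epsilon>)) \<partial>count_space (UNIV :: int set))"
      by (rule nn_integral_bij_count_space[symmetric, of "\<lambda>m. m + n"])
         (auto intro!: bij_betwI[where g = "\<lambda>m. m - n"])
    also have "\<dots> \<le> (\<integral>\<^sup>+m. ennreal (2 powr (1 + \<epsilon>)) * ennreal (c (nat \<bar>m\<bar>)) \<partial>count_space (UNIV :: int set))"
    proof (intro nn_integral_mono)
      fix m :: int
      have "\<bar>\<omega> - of_int (m + n)\<bar> \<ge> \<bar>of_int m\<bar> - 1" "\<bar>\<omega> - of_int (m + n)\<bar> \<ge> 0"
        unfolding n_def by (simp_all) linarith
      hence ge: "1 + \<bar>\<omega> - of_int (m + n)\<bar> \<ge> (1 + \<bar>of_int m\<bar>) / 2"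
      proof -
        have "1 + x \<ge> (1 + y) / 2" if "x \<ge> y - 1" "x \<ge> 0" for x y :: real
          using that by (simp add: field_simps)
        thus ?thesis by this fact+
      qed
      have "(1 + \<bar>\<omega> - of_int (m + n)\<bar>) powr - (1 + \<epsilon>) \<le> ((1 + \<bar>of_int m\<bar>) / 2) powr - (1 + \<epsilon>)"
        using assms ge by (intro powr_mono2') auto
      also have "\<dots> = 2 powr (1 + \<epsilon>) * c (nat \<bar>m\<bar>)"
      proof -
        have "(y / 2) powr - e = 2 powr e * y powr - e" if "y \<ge> 0" for y e :: real
          using that by (simp add: powr_divide powr_minus field_simps)
        from this[of "1 + \<bar>of_int m\<bar>" "1 + \<epsilon>"] show ?thesis
          by (simp add: c_def add.commute)
      qed
      finally have "(1 + \<bar>\<omega> - of_int (m + n)\<bar>) powr - (1 + \<epsilon>) \<le> 2 powr (1 + \<epsilon>) * c (nat \<bar>m\<bar>)" .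
      thus "ennreal ((1 + \<bar>\<omega> - of_int (m + n)\<bar>) powr - (1 + \<epsilon>)) \<le> ennreal (2 powr (1 + \<epsilon>)) * ennreal (c (nat \<bar>m\<bar>))"
        by (simp add: ennreal_mult[symmetric] c ennreal_leI)
    qed
    also have "\<dots> \<le> ennreal (2 powr (1 + \<epsilon>)) * (2 * (\<Sum>k. ennreal (c k)))"
      by (simp add: nn_integral_cmult) (intro mult_left_mono nn_integral_int_le_nat[of "\<lambda>k. ennreal (c k)"], simp)
    also have "\<dots> = ennreal (2 powr (1 + \<epsilon>)) * (ennreal 2 * ennreal (suminf c))"
      by (simp add: suminf_ennreal2[OF c sum])
    also have "\<dots> = ennreal (2 powr (1 + \<epsilon>) * (2 * suminf c))"
      by (simp add: ennreal_mult')
    also have "\<dots> \<le> ennreal K"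
      by (rule ennreal_leI) (simp add: K_def)
    finally show ?thesis .
  qed
  show ?thesis using K bound by blast
qed

lemma decay_sums_bounded:
  assumes "\<epsilon> > 0"
  shows "\<exists>K>0. \<forall>\<omega>. (\<integral>\<^sup>+b. ennreal (decay_sum \<epsilon> b \<omega>) \<partial>count_space UNIV) \<le> ennreal K"
proof -
  obtain K where K: "K > 0" 
    "\<And>\<omega>. (\<integral>\<^sup>+\<eta>. ennreal ((1 + \<bar>\<omega> - of_int \<eta>\<bar>) powr - (1 + \<epsilon>)) \<partial>count_space (UNIV :: int set)) \<le> ennreal K"
    using decay_lattice_sum_bounded[OF assms] by blast
  have "(\<integral>\<^sup>+b. ennreal (decay_sum \<epsilon> b \<omega>) \<partial>count_space UNIV) \<le> ennreal K" for \<omega>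
  proof -
    let ?d = "\<lambda>\<eta>. ennreal ((1 + \<bar>\<omega> - of_int \<eta>\<bar>) powr - (1 + \<epsilon>))"
    have "ennreal (decay_sum \<epsilon> b \<omega>) = (\<integral>\<^sup>+\<eta>. ?d \<eta> * indicator (band_freqs b) \<eta> \<partial>count_space UNIV)" for b
      unfolding decay_sum_def
      by (subst nn_integral_count_space'[of "band_freqs b"]) (auto simp: sum_ennreal)
    hence "(\<integral>\<^sup>+b. ennreal (decay_sum \<epsilon> b \<omega>) \<partial>count_space UNIV)
        = (\<integral>\<^sup>+b. (\<integral>\<^sup>+\<eta>. ?d \<eta> * indicator (band_freqs b) \<eta> \<partial>count_space UNIV) \<partial>count_space UNIV)"
      by simp
    also have "\<dots> = (\<integral>\<^sup>+\<eta>. (\<integral>\<^sup>+b. ?d \<eta> * indicator (band_freqs b) \<eta> \<partial>count_space UNIV) \<partial>count_space UNIV)"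
      by (rule nn_integral_count_space_nn_integral) auto
    also have "\<dots> = (\<integral>\<^sup>+\<eta>. ?d \<eta> \<partial>count_space UNIV)"
    proof (intro nn_integral_cong)
      fix \<eta>
      obtain b0 where "\<And>b. \<eta> \<in> band_freqs b \<longleftrightarrow> b = b0"
        using ex1_band[of \<eta>] by blast
      hence "indicator (band_freqs b) \<eta> = (indicator {b0} b :: ennreal)" for b
        by (simp add: indicator_def)
      thus "(\<integral>\<^sup>+b. ?d \<eta> * indicator (band_freqs b) \<eta> \<partial>count_space UNIV) = ?d \<eta>"
        by simp
    qed
    finally show ?thesis using K(2) by simp
  qed
  thus ?thesis using K(1) by blast
qed

text \<open>
  Two bands at each scale and a geometric series; this is where \<open>\<epsilon> > 0\<close> makes the aliasing errors of
  all bands summable.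
\<close>
lemma scale_weights_summable:
  assumes "\<epsilon> > 0"
  shows "\<exists>E>0. (\<integral>\<^sup>+b. ennreal (2 powr (- (2 * \<epsilon> * real (band_scale b)))) \<partial>count_space UNIV) = ennreal E"
proof -
  define q where "q = 2 powr (- (2 * \<epsilon>))"
  have q: "0 < q" "q < 1"
    using assms powr_less_mono[of "- (2 * \<epsilon>)" 0 2] by (simp_all add: q_def)
  have pow: "2 powr (- (2 * \<epsilon> * real j)) = q ^ j" for j
    by (simp add: q_def powr_realpow[symmetric] powr_powr)
  have "(\<integral>\<^sup>+b. ennreal (q ^ band_scale b) \<partial>count_space UNIV)
      = 1 + (\<integral>\<^sup>+p. ennreal (q ^ fst p) \<partial>count_space (UNIV :: (nat \<times> freq_sign) set))"
    by (subst nn_integral_count_space_option) (auto intro!: nn_integral_cong simp: split_paired_all)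
  also have "(\<integral>\<^sup>+p. ennreal (q ^ fst p) \<partial>count_space (UNIV :: (nat \<times> freq_sign) set))
      = (\<integral>\<^sup>+j. (\<integral>\<^sup>+k. ennreal (q ^ j) \<partial>count_space (UNIV :: freq_sign set)) \<partial>count_space UNIV)"
    by (subst nn_integral_fst_count_space[symmetric]) simp
  also have "\<dots> = (\<integral>\<^sup>+j. 2 * ennreal (q ^ j) \<partial>count_space UNIV)"
    by (simp add: UNIV_freq_sign nn_integral_count_space_finite mult_2_right mult.commute[of 2])
  also have "\<dots> = 2 * (\<Sum>j. ennreal (q ^ j))"
    by (simp add: nn_integral_cmult nn_integral_count_space_nat)
  also have "\<dots> = ennreal (2 * (\<Sum>j. q ^ j))"
    using q by (subst suminf_ennreal2) (auto intro!: summable_geometric simp: ennreal_mult')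
  also have "1 + \<dots> = ennreal (1 + 2 * (\<Sum>j. q ^ j))"
    using q by (subst ennreal_plus) (auto intro!: suminf_nonneg summable_geometric)
  finally have "(\<integral>\<^sup>+b. ennreal (2 powr (- (2 * \<epsilon> * real (band_scale b)))) \<partial>count_space UNIV) 
      = ennreal (1 + 2 * (\<Sum>j. q ^ j))"
    by (simp add: pow)
  moreover have "1 + 2 * (\<Sum>j. q ^ j) > 0"
    using q by (intro add_pos_nonneg mult_nonneg_nonneg suminf_nonneg summable_geometric) auto
  ultimately show ?thesis by blast
qed


text \<open>
  The aliasing estimate. A point of the tile \<open>k \<noteq> 0\<close> has modulus at least \<open>\<bar>k\<bar> P / 2\<close>, whereas the band lies in
  \<open>\<bar>\<eta>\<bar> \<le> 2 * 2 ^ band_scale b \<le> P / 4\<close>. Each of the \<open>2 ^ band_scale b\<close> summands is then small, and the product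
  with \<open>\<bar>k\<bar>\<close>, which is the weight that summing over the tiles requires, is still of order \<open>\<nu>\<close>.
\<close>
lemma decay_sum_far:
  fixes b :: band and \<nu> \<epsilon> :: real
  assumes "\<epsilon> > 0" "0 < \<nu>" "\<nu> \<le> 1/8"
  defines "P \<equiv> 2 ^ band_scale b / \<nu>"
  shows "\<bar>real_of_int \<lfloor>(\<omega> - (- (P / 2))) / P\<rfloor>\<bar> * decay_sum \<epsilon> b \<omega> \<le> 4 * \<nu> * 2 powr (- (\<epsilon> * real (band_scale b)))"
proof -
  define k where "k = \<lfloor>(\<omega> - (- (P / 2))) / P\<rfloor>"
  define p where "p = (2::real) ^ band_scale b"
  have P: "P > 0" "P = p / \<nu>" "p > 0"
    using assms by (simp_all add: P_def p_def)
  show ?thesis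
  proof (cases "k = 0")
    case False
    have k: "of_int k \<le> \<omega> / P + 1 / 2" "\<omega> / P + 1 / 2 < of_int k + 1"
    proof -
      have "(\<omega> - (- (P / 2))) / P = \<omega> / P + 1 / 2"
        using P(1) by (simp add: field_simps)
      thus "of_int k \<le> \<omega> / P + 1 / 2" "\<omega> / P + 1 / 2 < of_int k + 1"
        unfolding k_def by linarith+
    qed
    have "\<bar>of_int k\<bar> / 2 \<le> \<bar>\<omega> / P\<bar>"
    proof (cases "k > 0")
      case True
      hence "real_of_int k \<ge> 1" by simp
      thus ?thesis using k by linarith
    next
      case neg: False
      hence "real_of_int k \<le> - 1" using False by linarith
      thus ?thesis using k by linarith
    qed
    hence "\<bar>of_int k\<bar> / 2 \<le> \<bar>\<omega>\<bar> / P"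
      using P(1) by (simp only: abs_divide abs_of_pos)
    hence \<omega>: "\<bar>of_int k\<bar> * P / 2 \<le> \<bar>\<omega>\<bar>"
      using P(1) by (simp add: pos_le_divide_eq)
    have k1: "\<bar>real_of_int k\<bar> \<ge> 1" using False by linarith
    \<comment> \<open>a lower bound for the distance between \<open>\<omega>\<close> and the band\<close>
    define t where "t = \<bar>of_int k\<bar> * P / 4"
    have "p * \<nu> \<le> p * (1 / 8)"
      using P(3) assms(3) by (intro mult_left_mono) auto
    hence "P \<ge> 8 * p"
      unfolding P(2) using assms(2) by (simp add: pos_le_divide_eq)
    moreover have "\<bar>of_int k\<bar> * P \<ge> 1 * P"
      using k1 P by (intro mult_right_mono) auto
    ultimately have t: "t \<ge> 2 * p"
      by (simp add: t_def)
    have dist: "t \<le> 1 + \<bar>\<omega> - of_int \<eta>\<bar>" if "\<eta> \<in> band_freqs b" for \<eta>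
    proof -
      have "\<bar>real_of_int \<eta>\<bar> \<le> t"
        using band_freqs_size(2)[OF that] t by (simp add: p_def)
      moreover have "2 * t \<le> \<bar>\<omega>\<bar>"
        using \<omega> by (simp add: t_def mult.commute)
      ultimately show ?thesis by linarith
    qed
    have "decay_sum \<epsilon> b \<omega> \<le> (\<Sum>\<eta>\<in>band_freqs b. t powr - (1 + \<epsilon>))"
      unfolding decay_sum_def using t P assms(1)
      by (intro sum_mono powr_mono2' dist) auto
    also have "\<dots> = p * t powr - (1 + \<epsilon>)"
      by (simp add: card_band_freqs p_def)
    also have "t powr - (1 + \<epsilon>) = t powr - \<epsilon> / t"
    proof -
      have "- (1 + \<epsilon>) = - \<epsilon> - 1" by simp
      hence "t powr - (1 + \<epsilon>) = t powr - \<epsilon> / t powr 1"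
        by (simp only: powr_diff)
      moreover have "t powr 1 = t"
        using t P by (intro powr_one) auto
      ultimately show ?thesis by (simp only:)
    qed
    also have "p * (t powr - \<epsilon> / t) \<le> p * (p powr - \<epsilon> / t)"
      using t P assms(1) by (intro mult_left_mono divide_right_mono powr_mono2') auto
    also have "\<dots> = 4 * \<nu> / \<bar>of_int k\<bar> * p powr - \<epsilon>"
      using P assms k1 by (simp add: t_def field_simps)
    also have "p powr - \<epsilon> = 2 powr (- (\<epsilon> * real (band_scale b)))"
      by (simp add: p_def powr_realpow[symmetric] powr_powr mult.commute)
    finally have "decay_sum \<epsilon> b \<omega> \<le> 4 * \<nu> / \<bar>of_int k\<bar> * 2 powr (- (\<epsilon> * real (band_scale b)))" .
    hence "\<bar>of_int k\<bar> * decay_sum \<epsilon> b \<omega> \<le> \<bar>of_int k\<bar> * (4 * \<nu> / \<bar>of_int k\<bar> * 2 powr (- (\<epsilon> * real (band_scale b))))"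
      by (intro mult_left_mono) auto
    also have "\<dots> = 4 * \<nu> * 2 powr (- (\<epsilon> * real (band_scale b)))"
      using k1 by simp
    finally show ?thesis by (simp add: k_def)
  qed (use assms in \<open>simp add: k_def\<close>)
qed

definition band_envelope :: "(real \<Rightarrow> complex) \<Rightarrow> band \<Rightarrow> real \<Rightarrow> real" where
  "band_envelope \<psi> b \<omega> = (\<Sum>\<eta>\<in>band_freqs b. cmod (\<psi> (\<omega> - of_int \<eta>)))"

lemma band_envelope_nonneg: "band_envelope \<psi> b \<omega> \<ge> 0"
  by (simp add: band_envelope_def sum_nonneg)

lemma band_envelope_measurable:
  assumes [measurable]: "\<psi> \<in> borel_measurable borel"
  shows "band_envelope \<psi> b \<in> borel_measurable borel"
  unfolding band_envelope_def[abs_def] by measurable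

text \<open>
  The triangle inequality in the form
  \<open>1 + \<bar>\<eta>\<bar> \<le> (1 + \<bar>\<omega>\<bar>) * (1 + \<bar>\<omega> - \<eta>\<bar>)\<close>: the weight of the band is shared between the Sobolev weight at \<open>\<omega>\<close>
  and the decay of \<open>\<psi>\<close>.
\<close>
lemma band_envelope_le:
  assumes decay: "\<And>\<omega>. cmod (\<psi> \<omega>) \<le> C / (1 + \<bar>\<omega>\<bar>) powr (s + 1 + \<epsilon>)" and "s \<ge> 0" "C > 0"
  shows "2 powr (real (band_scale b) * s) * band_envelope \<psi> b \<omega> \<le> C * (1 + \<bar>\<omega>\<bar>) powr s * decay_sum \<epsilon> b \<omega>"
proof -
  have "2 powr (real (band_scale b) * s) * cmod (\<psi> (\<omega> - of_int \<eta>))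
      \<le> C * (1 + \<bar>\<omega>\<bar>) powr s * (1 + \<bar>\<omega> - of_int \<eta>\<bar>) powr - (1 + \<epsilon>)" if \<eta>: "\<eta> \<in> band_freqs b" for \<eta>
  proof -
    define x where "x = 1 + \<bar>\<omega> - of_int \<eta>\<bar>"
    have x: "x \<ge> 1" by (simp add: x_def)
    have "1 + \<bar>real_of_int \<eta>\<bar> \<le> 1 + \<bar>\<omega>\<bar> + \<bar>\<omega> - of_int \<eta>\<bar>"
      by linarith
    also have "\<dots> \<le> (1 + \<bar>\<omega>\<bar>) * x"
      unfolding x_def by (simp add: algebra_simps)
    finally have "2 ^ band_scale b \<le> (1 + \<bar>\<omega>\<bar>) * x"
      using band_freqs_size(1)[OF \<eta>] by linarith
    hence "(2 ^ band_scale b) powr s \<le> ((1 + \<bar>\<omega>\<bar>) * x) powr s"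
      using assms(2) by (intro powr_mono2) auto
    hence w: "2 powr (real (band_scale b) * s) \<le> (1 + \<bar>\<omega>\<bar>) powr s * x powr s"
      using x by (simp add: powr_mult powr_realpow[symmetric] powr_powr)
    have "2 powr (real (band_scale b) * s) * cmod (\<psi> (\<omega> - of_int \<eta>))
        \<le> ((1 + \<bar>\<omega>\<bar>) powr s * x powr s) * (C / x powr (s + 1 + \<epsilon>))"
      using decay[of "\<omega> - of_int \<eta>"] by (intro mult_mono w) (auto simp: x_def)
    also have "\<dots> = C * (1 + \<bar>\<omega>\<bar>) powr s * (x powr s / x powr (s + 1 + \<epsilon>))"
      by simp
    also have "x powr s / x powr (s + 1 + \<epsilon>) = x powr - (1 + \<epsilon>)"
      using x by (simp add: powr_diff[symmetric])
    finally show ?thesis by (simp add: x_def)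
  qed
  thus ?thesis
    unfolding band_envelope_def decay_sum_def sum_distrib_left by (intro sum_mono)
qed

text \<open>
  The witness is the band of the integer nearest to \<open>\<omega>\<close>: the summand of that integer evaluates \<open>\<psi>\<close> in
  \<open>I_centre\<close>. Half-integers are excluded because \<open>I_centre\<close> is open.
\<close>
lemma band_envelope_lower:
  assumes low: "\<And>\<omega>. \<omega> \<in> I_centre \<Longrightarrow> a \<le> cmod (\<psi> \<omega>)" and s: "s \<ge> 0" and a: "a > 0"
    and half: "\<omega> \<notin> range (\<lambda>m::int. of_int m + 1 / 2)"
  shows "\<exists>b. \<bar>\<omega>\<bar> \<le> 3 * 2 ^ band_scale b \<and> 
    a * (1 + \<bar>\<omega>\<bar>) powr s \<le> 4 powr s * (2 powr (real (band_scale b) * s) * band_envelope \<psi> b \<omega>)"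
proof -
  define \<eta> where "\<eta> = \<lfloor>\<omega> + 1 / 2\<rfloor>"
  have "\<omega> \<noteq> of_int (\<eta> - 1) + 1 / 2"
    using half by blast
  hence \<eta>: "\<omega> - of_int \<eta> \<in> I_centre"
    unfolding I_centre_def \<eta>_def greaterThanLessThan_iff of_int_diff by linarith
  hence close: "\<bar>\<omega> - of_int \<eta>\<bar> < 1 / 2"
    unfolding I_centre_def greaterThanLessThan_iff by linarith
  obtain b where b: "\<eta> \<in> band_freqs b"
    using ex1_band by blast
  have one: "1 \<le> (2::real) ^ band_scale b" by simp
  have \<omega>: "\<bar>\<omega>\<bar> \<le> 3 * 2 ^ band_scale b"
    using band_freqs_size(2)[OF b] close one by linarith
  have "a \<le> cmod (\<psi> (\<omega> - of_int \<eta>))"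
    by (rule low[OF \<eta>])
  also have "\<dots> \<le> band_envelope \<psi> b \<omega>"
    unfolding band_envelope_def using b by (intro member_le_sum[of \<eta> _ "\<lambda>\<eta>. cmod (\<psi> (\<omega> - of_int \<eta>))"]) auto
  finally have env: "a \<le> band_envelope \<psi> b \<omega>" .
  have "1 + \<bar>\<omega>\<bar> \<le> 4 * 2 ^ band_scale b"
    using \<omega> one by linarith
  hence "(1 + \<bar>\<omega>\<bar>) powr s \<le> (4 * 2 ^ band_scale b) powr s"
    using s by (intro powr_mono2) auto
  also have "\<dots> = 4 powr s * 2 powr (real (band_scale b) * s)"
    by (simp add: powr_mult powr_realpow[symmetric] powr_powr)
  finally have "(1 + \<bar>\<omega>\<bar>) powr s * a \<le> (4 powr s * 2 powr (real (band_scale b) * s)) * band_envelope \<psi> b \<omega>"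
    using env a by (intro mult_mono) auto
  thus ?thesis
    using \<omega> by (intro exI[of _ b]) (simp add: mult_ac)
qed


definition wave_atom :: "(real \<Rightarrow> complex) \<Rightarrow> band \<Rightarrow> real \<Rightarrow> (real \<Rightarrow> complex)" where
  "wave_atom \<phi> b l = (case b of None \<Rightarrow> translate l \<phi> | Some (j, k) \<Rightarrow> band_atom \<phi> j k l)"

lemma wave_atom_eq:
  "wave_atom \<phi> b l = (\<lambda>t. of_real (1 / 2 powr (real (band_scale b) / 2)) *
     (\<Sum>\<eta>\<in>band_freqs b. cis (2 * pi * of_int \<eta> * (t - l / 2 ^ band_scale b)) * \<phi> (t - l / 2 ^ band_scale b)))"
proof -
  have "exp (2 * complex_of_real pi * \<i> * of_int \<eta> * complex_of_real u) = cis (2 * pi * of_int \<eta> * u)" for \<eta> u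
    by (simp add: cis_conv_exp mult_ac)
  thus ?thesis
    by (cases b rule: band_freqs.cases) (simp_all add: wave_atom_def band_atom_def translate_def)
qed

text \<open>
  The function on the frequency side whose Fourier coefficients, for the period
  \<open>2 ^ band_scale b / \<nu>\<close>, are the frame coefficients of the band.
\<close>
definition band_product :: "(real \<Rightarrow> complex) \<Rightarrow> (real \<Rightarrow> complex) \<Rightarrow> band \<Rightarrow> real \<Rightarrow> complex" where
  "band_product g \<psi> b \<omega> = g \<omega> * cnj (\<Sum>\<eta>\<in>band_freqs b. \<psi> (\<omega> - of_int \<eta>))"

lemma wave_atom_coefficient:
  assumes f: "f \<in> L2" "is_fourier_transform f g" and \<phi>: "\<phi> \<in> L2" "is_fourier_transform \<phi> \<psi>"
    and \<nu>: "\<nu> > 0"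
  shows "L2_inner f (wave_atom \<phi> b (\<nu> * of_int n)) = of_real (1 / 2 powr (real (band_scale b) / 2)) *
    (LINT \<omega>|lborel. band_product g \<psi> b \<omega> * fourier_char (2 ^ band_scale b / \<nu>) n \<omega>)"
proof -
  define y where "y = \<nu> * of_int n / 2 ^ band_scale b"
  note g = is_fourier_transformD(1)[OF f(2,1)] and \<psi> = is_fourier_transformD(1)[OF \<phi>(2,1)]
  have H: "(\<lambda>\<omega>. cis (- (2 * pi * y * \<omega>)) * \<psi> (\<omega> - of_int \<eta>)) \<in> L2" for \<eta>
    using cis_mult_L2[OF L2_translate[OF \<psi>], of "- (2 * pi * y)"] by (simp add: mult.assoc)
  have G: "(\<lambda>t. cis (2 * pi * of_int \<eta> * (t - y)) * \<phi> (t - y)) \<in> L2" for \<eta>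
    using L2_translate[OF cis_mult_L2[OF \<phi>(1)]] .
  have "L2_inner f (wave_atom \<phi> b (\<nu> * of_int n)) = cnj (of_real (1 / 2 powr (real (band_scale b) / 2))) *
      (\<Sum>\<eta>\<in>band_freqs b. L2_inner f (\<lambda>t. cis (2 * pi * of_int \<eta> * (t - y)) * \<phi> (t - y)))"
    unfolding wave_atom_eq y_def[symmetric] L2_inner_cmult_right
    by (simp add: L2_inner_sum_right f G)
  also have "(\<Sum>\<eta>\<in>band_freqs b. L2_inner f (\<lambda>t. cis (2 * pi * of_int \<eta> * (t - y)) * \<phi> (t - y)))
      = (\<Sum>\<eta>\<in>band_freqs b. L2_inner g (\<lambda>\<omega>. cis (- (2 * pi * y * \<omega>)) * \<psi> (\<omega> - of_int \<eta>)))"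
    by (simp only: L2_inner_shift_modulate[OF f \<phi>])
  also have "\<dots> = L2_inner g (\<lambda>\<omega>. \<Sum>\<eta>\<in>band_freqs b. cis (- (2 * pi * y * \<omega>)) * \<psi> (\<omega> - of_int \<eta>))"
    by (simp add: L2_inner_sum_right g H)
  also have "\<dots> = (LINT \<omega>|lborel. band_product g \<psi> b \<omega> * fourier_char (2 ^ band_scale b / \<nu>) n \<omega>)"
    unfolding L2_inner_def
  proof (intro Bochner_Integration.integral_cong refl)
    fix \<omega>
    have "cnj (cis (- (2 * pi * y * \<omega>))) = fourier_char (2 ^ band_scale b / \<nu>) n \<omega>"
      unfolding fourier_char_def cis_cnj by (rule arg_cong[where f = cis]) (simp add: y_def field_simps)
    thus "g \<omega> * cnj (\<Sum>\<eta>\<in>band_freqs b. cis (- (2 * pi * y * \<omega>)) * \<psi> (\<omega> - of_int \<eta>))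
        = band_product g \<psi> b \<omega> * fourier_char (2 ^ band_scale b / \<nu>) n \<omega>"
      unfolding band_product_def sum_distrib_left[symmetric] complex_cnj_mult
      by (simp only: mult.left_commute mult.commute)
  qed
  finally show ?thesis by simp
qed

lemma band_product_L2:
  assumes g: "g \<in> L2" and \<psi>: "\<psi> \<in> L2" and bound: "\<And>\<omega>. cmod (\<psi> \<omega>) \<le> C"
  shows "band_product g \<psi> b \<in> L2" "integrable lborel (band_product g \<psi> b)"
proof -
  have sum: "(\<lambda>\<omega>. \<Sum>\<eta>\<in>band_freqs b. \<psi> (\<omega> - of_int \<eta>)) \<in> L2"
    by (intro L2_sum L2_translate \<psi>)
  show "integrable lborel (band_product g \<psi> b)"
    unfolding band_product_def[abs_def] by (rule L2_inner_integrable[OF g sum])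
  have "(\<lambda>\<omega>. cnj (\<Sum>\<eta>\<in>band_freqs b. \<psi> (\<omega> - of_int \<eta>)) * g \<omega>) \<in> L2"
  proof (rule L2_bounded_mult[OF g])
    show "(\<lambda>\<omega>. cnj (\<Sum>\<eta>\<in>band_freqs b. \<psi> (\<omega> - of_int \<eta>))) \<in> borel_measurable borel"
      using L2_measurable[OF L2_cnj[OF sum]] .
    show "cmod (cnj (\<Sum>\<eta>\<in>band_freqs b. \<psi> (\<omega> - of_int \<eta>))) \<le> (\<Sum>\<eta>\<in>band_freqs b. C)" for \<omega>
      unfolding complex_mod_cnj by (rule sum_norm_le) (rule bound)
  qed
  thus "band_product g \<psi> b \<in> L2"
    unfolding band_product_def[abs_def] by (simp add: mult.commute)
qed

text \<open>
  The definite sign rules out cancellation among the shifted copies of \<open>\<psi>\<close>.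
\<close>
lemma norm_band_product:
  assumes sign: "cmod \<sigma> = 1" "\<And>\<omega>. \<psi> \<omega> = \<sigma> * of_real (cmod (\<psi> \<omega>))"
  shows "cmod (band_product g \<psi> b \<omega>) = cmod (g \<omega>) * band_envelope \<psi> b \<omega>"
proof -
  have "(\<Sum>\<eta>\<in>band_freqs b. \<psi> (\<omega> - of_int \<eta>)) = (\<Sum>\<eta>\<in>band_freqs b. \<sigma> * of_real (cmod (\<psi> (\<omega> - of_int \<eta>))))"
    by (intro sum.cong refl sign)
  also have "\<dots> = \<sigma> * of_real (band_envelope \<psi> b \<omega>)"
    by (simp add: band_envelope_def sum_distrib_left)
  finally show ?thesis
    using sign(1) band_envelope_nonneg[of \<psi> b \<omega>] by (simp add: band_product_def norm_mult)
qed

text \<open>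
  The hypotheses on the Fourier transform hold off a null set. Redefining it there as \<open>\<sigma>\<close> times the
  decay bound makes them hold everywhere; only the constant \<open>a\<close> may have to shrink, so that it lies below
  the decay bound on \<open>I_centre\<close>.
\<close>
lemma regular_fourier_representative:
  assumes \<phi>: "\<phi> \<in> L2" and C: "C > 0" and a: "a > 0" and s: "s \<ge> 0" "\<epsilon> > 0"
    and decay: "AE \<omega> in lborel. cmod (fourier \<phi> \<omega>) \<le> C / (1 + \<bar>\<omega>\<bar>) powr (s + 1 + \<epsilon>)"
    and sign: "definite_sign (fourier \<phi>)"
    and low: "AE \<omega> in lborel. \<omega> \<in> I_centre \<longrightarrow> cmod (fourier \<phi> \<omega>) \<ge> a"
  obtains \<psi> \<sigma> a' where "is_fourier_transform \<phi> \<psi>" "a' > 0" "cmod \<sigma> = 1"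
    "\<And>\<omega>. \<psi> \<omega> = \<sigma> * of_real (cmod (\<psi> \<omega>))"
    "\<And>\<omega>. cmod (\<psi> \<omega>) \<le> C / (1 + \<bar>\<omega>\<bar>) powr (s + 1 + \<epsilon>)"
    "\<And>\<omega>. \<omega> \<in> I_centre \<Longrightarrow> a' \<le> cmod (\<psi> \<omega>)"
proof -
  let ?F = "fourier \<phi>"
  let ?D = "\<lambda>\<omega>. C / (1 + \<bar>\<omega>\<bar>) powr (s + 1 + \<epsilon>)"
  have "\<exists>\<sigma>. cmod \<sigma> = 1 \<and> (AE \<omega> in lborel. ?F \<omega> = \<sigma> * of_real (cmod (?F \<omega>)))"
    using sign unfolding definite_sign_def
  proof (elim disjE)
    assume *: "AE \<omega> in lborel. ?F \<omega> \<in> \<real> \<and> Re (?F \<omega>) \<ge> 0"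
    have "AE \<omega> in lborel. ?F \<omega> = 1 * of_real (cmod (?F \<omega>))"
      using * by eventually_elim (auto elim!: Reals_cases)
    thus ?thesis by (intro exI[of _ 1]) simp
  next
    assume *: "AE \<omega> in lborel. ?F \<omega> \<in> \<real> \<and> Re (?F \<omega>) \<le> 0"
    have "AE \<omega> in lborel. ?F \<omega> = - 1 * of_real (cmod (?F \<omega>))"
      using * by eventually_elim (auto elim!: Reals_cases)
    thus ?thesis by (intro exI[of _ "- 1"]) simp
  qed
  then obtain \<sigma> where \<sigma>: "cmod \<sigma> = 1" "AE \<omega> in lborel. ?F \<omega> = \<sigma> * of_real (cmod (?F \<omega>))"
    by blast
  have "AE \<omega> in lborel. ?F \<omega> = \<sigma> * of_real (cmod (?F \<omega>)) \<and> cmod (?F \<omega>) \<le> ?D \<omega> \<and> (\<omega> \<in> I_centre \<longrightarrow> cmod (?F \<omega>) \<ge> a)"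
    using \<sigma>(2) decay low by eventually_elim simp
  then obtain N where N: "{\<omega> \<in> space lborel. \<not> (?F \<omega> = \<sigma> * of_real (cmod (?F \<omega>)) \<and> cmod (?F \<omega>) \<le> ?D \<omega> \<and> (\<omega> \<in> I_centre \<longrightarrow> cmod (?F \<omega>) \<ge> a))} \<subseteq> N"
     "emeasure lborel N = 0" "N \<in> sets lborel"
    by (rule AE_E)
  define \<psi> where "\<psi> \<omega> = (if \<omega> \<in> N then \<sigma> * of_real (?D \<omega>) else ?F \<omega>)" for \<omega>
  define a' where "a' = min a (C / 2 powr (s + 1 + \<epsilon>))"
  have D: "?D \<omega> \<ge> 0" for \<omega>
    using C by simp
  have [measurable]: "N \<in> sets borel" "?F \<in> borel_measurable borel"
    using N is_fourier_transformD(1)[OF is_fourier_transform_fourier[OF \<phi>] \<phi>] by (auto simp: L2_measurable)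
  have "is_fourier_transform \<phi> \<psi>"
  proof (rule is_fourier_transform_cong_AE[OF is_fourier_transform_fourier[OF \<phi>]])
    show "\<psi> \<in> borel_measurable borel"
      unfolding \<psi>_def[abs_def] by measurable
    have "AE \<omega> in lborel. \<omega> \<notin> N"
      using N by (intro AE_not_in) auto
    thus "AE \<omega> in lborel. ?F \<omega> = \<psi> \<omega>"
      by eventually_elim (simp add: \<psi>_def)
  qed
  moreover have "a' > 0"
    using a C by (simp add: a'_def)
  moreover note \<sigma>(1)
  moreover have "\<psi> \<omega> = \<sigma> * of_real (cmod (\<psi> \<omega>))" for \<omega>
  proof (cases "\<omega> \<in> N")
    case True
    thus ?thesis using D[of \<omega>] C \<sigma>(1) by (simp add: \<psi>_def norm_mult del: of_real_divide)
  next
    case False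
    hence "?F \<omega> = \<sigma> * of_real (cmod (?F \<omega>))" using N(1) by auto
    thus ?thesis using False by (simp only: \<psi>_def if_False)
  qed
  moreover have "cmod (\<psi> \<omega>) \<le> ?D \<omega>" for \<omega>
  proof (cases "\<omega> \<in> N")
    case True
    thus ?thesis using D[of \<omega>] C \<sigma>(1) by (simp add: \<psi>_def norm_mult del: of_real_divide)
  next
    case False
    hence "cmod (?F \<omega>) \<le> ?D \<omega>" using N(1) by auto
    thus ?thesis using False by (simp only: \<psi>_def if_False)
  qed
  moreover have "a' \<le> cmod (\<psi> \<omega>)" if \<omega>: "\<omega> \<in> I_centre" for \<omega>
  proof (cases "\<omega> \<in> N")
    case True
    have "(1 + \<bar>\<omega>\<bar>) powr (s + 1 + \<epsilon>) \<le> 2 powr (s + 1 + \<epsilon>)"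
      using \<omega> s by (intro powr_mono2) (auto simp: I_centre_def)
    hence "C / 2 powr (s + 1 + \<epsilon>) \<le> ?D \<omega>"
      using C by (intro divide_left_mono) auto
    thus ?thesis using True D[of \<omega>] C \<sigma>(1)
      by (simp add: \<psi>_def norm_mult a'_def min.coboundedI2 del: of_real_divide)
  next
    case False
    hence "a \<le> cmod (?F \<omega>)" using N(1) \<omega> by auto
    thus ?thesis using False by (simp add: \<psi>_def a'_def min.coboundedI1)
  qed
  ultimately show ?thesis
    using that by blast
qed


section \<open>The frame bounds\<close>

text \<open>
  The sampling estimate for one band, with the factors \<open>2 powr (2 j s)\<close> of the frame and \<open>1 / 2 ^ j\<close> of the
  normalised atoms distributed. The period contributes \<open>2 ^ j / \<nu>\<close>, so the scale cancels. The far
  part has collapsed to a multiple \<open>\<nu> * 2 powr (- 2 \<epsilon> j)\<close> of the Sobolev norm, smaller by the factor \<open>\<nu>\<^sup>2\<close>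
  than the coefficient \<open>1 / \<nu>\<close> of the near part.
\<close>
lemma band_frame_estimates:
  fixes \<nu> s \<epsilon> C N :: real and b :: band
  assumes f: "f \<in> L2" "is_fourier_transform f g"
    and N: "(\<integral>\<^sup>+\<omega>. ennreal (((1 + \<bar>\<omega>\<bar>) powr s * cmod (g \<omega>))\<^sup>2) \<partial>lborel) = ennreal N"
    and \<phi>: "\<phi> \<in> L2" "is_fourier_transform \<phi> \<psi>"
    and sign: "cmod \<sigma> = 1" "\<And>\<omega>. \<psi> \<omega> = \<sigma> * of_real (cmod (\<psi> \<omega>))"
    and decay: "\<And>\<omega>. cmod (\<psi> \<omega>) \<le> C / (1 + \<bar>\<omega>\<bar>) powr (s + 1 + \<epsilon>)"
    and pos: "s \<ge> 0" "\<epsilon> > 0" "C > 0" and \<nu>: "0 < \<nu>" "\<nu> \<le> 1/8"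
  defines "P \<equiv> 2 ^ band_scale b / \<nu>"
  defines "q \<equiv> \<lambda>\<omega>. 2 powr (real (band_scale b) * s) * band_envelope \<psi> b \<omega>"
  defines "S \<equiv> \<integral>\<^sup>+n. ennreal (2 powr (2 * real (band_scale b) * s) * (cmod (L2_inner f (wave_atom \<phi> b (\<nu> * of_int n))))\<^sup>2)
      \<partial>count_space UNIV"
    and "near \<equiv> ennreal (1 / \<nu>) * (\<integral>\<^sup>+\<omega>. indicator (tile (- (P / 2)) P 0) \<omega> * ennreal ((q \<omega>)\<^sup>2 * (cmod (g \<omega>))\<^sup>2) \<partial>lborel)"
    and "far \<equiv> ennreal (64 * C\<^sup>2 * \<nu>) * ennreal (2 powr (- (2 * \<epsilon> * real (band_scale b)))) * ennreal N"
  shows "S \<le> 2 * near + 2 * far" "near \<le> 2 * S + 2 * far"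
proof -
  define j where "j = band_scale b"
  define c where "c = - (P / 2)"
  define w where "w = 2 powr (2 * real j * s) / 2 ^ j"
  define h where "h = band_product g \<psi> b"
  have w: "w > 0" by (simp add: w_def)
  have P: "P > 0" using \<nu> by (simp add: P_def)
  have wP: "w * P = 2 powr (2 * real j * s) / \<nu>"
    by (simp add: w_def P_def j_def)
  note g = is_fourier_transformD(1)[OF f(2,1)] and \<psi> = is_fourier_transformD(1)[OF \<phi>(2,1)]
  have \<psi>_bound: "cmod (\<psi> \<omega>) \<le> C" for \<omega>
  proof -
    have "1 \<le> (1 + \<bar>\<omega>\<bar>) powr (s + 1 + \<epsilon>)"
      using pos by (intro ge_one_powr_ge_zero) auto
    hence "C / (1 + \<bar>\<omega>\<bar>) powr (s + 1 + \<epsilon>) \<le> C / 1"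
      using pos by (intro divide_left_mono) auto
    thus ?thesis using decay[of \<omega>] by simp
  qed
  have h: "h \<in> L2" "integrable lborel h"
    unfolding h_def by (rule band_product_L2[OF g \<psi> \<psi>_bound])+
  have [measurable]: "g \<in> borel_measurable borel" "h \<in> borel_measurable borel"
    using g h by (auto simp: L2_measurable)
  have [measurable]: "band_envelope \<psi> b \<in> borel_measurable borel"
    by (rule band_envelope_measurable[OF L2_measurable[OF \<psi>]])
  have [measurable]: "q \<in> borel_measurable borel"
    unfolding q_def by measurable
  have wh: "2 powr (2 * real j * s) * (cmod (h \<omega>))\<^sup>2 = (q \<omega>)\<^sup>2 * (cmod (g \<omega>))\<^sup>2" for \<omega>
  proof -
    have "2 powr (2 * real j * s) = (2 powr (real j * s))\<^sup>2"
      by (simp add: power2_eq_square powr_add[symmetric] mult_ac)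
    thus ?thesis
      by (simp add: h_def norm_band_product[OF sign] q_def j_def power_mult_distrib)
  qed
  define S' where "S' = (\<integral>\<^sup>+n. ennreal ((cmod (LINT x|lborel. h x * fourier_char P n x))\<^sup>2) \<partial>count_space UNIV)"
  define near' where "near' = ennreal P * (\<integral>\<^sup>+x. indicator (tile c P 0) x * ennreal ((cmod (h x))\<^sup>2) \<partial>lborel)"
  define far' where "far' = 4 * ennreal P * (\<integral>\<^sup>+x. ennreal ((of_int \<lfloor>(x - c) / P\<rfloor>)\<^sup>2) * ennreal ((cmod (h x))\<^sup>2) \<partial>lborel)"
  have sandwich: "S' \<le> 2 * near' + 2 * far'" "near' \<le> 2 * S' + 2 * far'"
    using sampling_sandwich[OF P h, of c] by (simp_all only: S'_def near'_def far'_def)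
  have S: "S = ennreal w * S'"
  proof -
    have "2 powr (2 * real j * s) * (cmod (L2_inner f (wave_atom \<phi> b (\<nu> * of_int n))))\<^sup>2
        = w * (cmod (LINT x|lborel. h x * fourier_char P n x))\<^sup>2" for n
    proof -
      define r where "r = 1 / 2 powr (real j / 2)"
      have r: "r\<^sup>2 = 1 / 2 ^ j"
        by (simp add: r_def power_divide power2_eq_square powr_add[symmetric] powr_realpow[symmetric])
      have "L2_inner f (wave_atom \<phi> b (\<nu> * of_int n)) = of_real r * (LINT x|lborel. h x * fourier_char P n x)"
        unfolding h_def P_def r_def j_def by (rule wave_atom_coefficient[OF f \<phi> \<nu>(1)])
      hence "(cmod (L2_inner f (wave_atom \<phi> b (\<nu> * of_int n))))\<^sup>2 = r\<^sup>2 * (cmod (LINT x|lborel. h x * fourier_char P n x))\<^sup>2"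
        by (simp only: norm_mult norm_of_real power_mult_distrib power2_abs)
      thus ?thesis
        by (simp add: r w_def)
    qed
    thus ?thesis
      using w by (simp add: S_def S'_def j_def ennreal_mult' nn_integral_cmult)
  qed
  have near: "near = ennreal w * near'"
  proof -
    have "ennreal w * near' = ennreal (1 / \<nu> * 2 powr (2 * real j * s)) * (\<integral>\<^sup>+x. indicator (tile c P 0) x * ennreal ((cmod (h x))\<^sup>2) \<partial>lborel)"
      using w P wP unfolding near'_def by (simp add: ennreal_mult[symmetric] mult.assoc[symmetric])
    also have "\<dots> = ennreal (1 / \<nu>) * (\<integral>\<^sup>+x. ennreal (2 powr (2 * real j * s)) * (indicator (tile c P 0) x * ennreal ((cmod (h x))\<^sup>2)) \<partial>lborel)"
    proof -
      have "ennreal (1 / \<nu> * 2 powr (2 * real j * s)) = ennreal (1 / \<nu>) * ennreal (2 powr (2 * real j * s))"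
        using \<nu> by (intro ennreal_mult) auto
      moreover have "(\<integral>\<^sup>+x. ennreal (2 powr (2 * real j * s)) * (indicator (tile c P 0) x * ennreal ((cmod (h x))\<^sup>2)) \<partial>lborel)
          = ennreal (2 powr (2 * real j * s)) * (\<integral>\<^sup>+x. indicator (tile c P 0) x * ennreal ((cmod (h x))\<^sup>2) \<partial>lborel)"
        by (rule nn_integral_cmult) measurable
      ultimately show ?thesis by (simp only: mult.assoc)
    qed
    also have "\<dots> = near"
      unfolding near_def c_def wh[symmetric]
      by (simp add: ennreal_mult' mult.left_commute)
    finally show ?thesis by simp
  qed
  have far: "ennreal w * far' \<le> far"
  proof -
    have "ennreal w * far' = ennreal (4 / \<nu>) * (\<integral>\<^sup>+x. ennreal (2 powr (2 * real j * s)) * (ennreal ((of_int \<lfloor>(x - c) / P\<rfloor>)\<^sup>2) * ennreal ((cmod (h x))\<^sup>2)) \<partial>lborel)"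
    proof -
      have "ennreal w * (4 * ennreal P) = ennreal (4 / \<nu> * 2 powr (2 * real j * s))"
      proof -
        have "ennreal w * (4 * ennreal P) = ennreal (w * (4 * P))"
          using w P by (simp add: ennreal_mult')
        also have "w * (4 * P) = 4 / \<nu> * 2 powr (2 * real j * s)"
          using wP by (simp add: mult.left_commute)
        finally show ?thesis .
      qed
      moreover have "ennreal (4 / \<nu> * 2 powr (2 * real j * s)) = ennreal (4 / \<nu>) * ennreal (2 powr (2 * real j * s))"
        using \<nu> by (intro ennreal_mult) auto
      moreover have "(\<integral>\<^sup>+x. ennreal (2 powr (2 * real j * s)) * (ennreal ((of_int \<lfloor>(x - c) / P\<rfloor>)\<^sup>2) * ennreal ((cmod (h x))\<^sup>2)) \<partial>lborel)
          = ennreal (2 powr (2 * real j * s)) * (\<integral>\<^sup>+x. ennreal ((of_int \<lfloor>(x - c) / P\<rfloor>)\<^sup>2) * ennreal ((cmod (h x))\<^sup>2) \<partial>lborel)"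
        by (rule nn_integral_cmult) measurable
      ultimately show ?thesis
        unfolding far'_def by (simp only: mult.assoc[symmetric])
    qed
    also have "\<dots> \<le> ennreal (4 / \<nu>) * (\<integral>\<^sup>+x. ennreal (16 * C\<^sup>2 * \<nu>\<^sup>2 * 2 powr (- (2 * \<epsilon> * real j))) * ennreal (((1 + \<bar>x\<bar>) powr s * cmod (g x))\<^sup>2) \<partial>lborel)"
    proof (intro mult_left_mono nn_integral_mono)
      fix x
      define k where "k = \<bar>real_of_int \<lfloor>(x - c) / P\<rfloor>\<bar>"
      have "k * q x \<le> k * (C * (1 + \<bar>x\<bar>) powr s * decay_sum \<epsilon> b x)"
        unfolding q_def by (intro mult_left_mono band_envelope_le decay pos) (simp add: k_def)
      also have "\<dots> = C * (1 + \<bar>x\<bar>) powr s * (k * decay_sum \<epsilon> b x)"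
        by simp
      also have "k * decay_sum \<epsilon> b x \<le> 4 * \<nu> * 2 powr (- (\<epsilon> * real j))"
        using decay_sum_far[OF pos(2) \<nu>, of x b] by (simp only: k_def c_def P_def j_def)
      finally have "k * q x \<le> C * (1 + \<bar>x\<bar>) powr s * (4 * \<nu> * 2 powr (- (\<epsilon> * real j)))"
        using pos by (simp add: mult_left_mono)
      moreover have "k * q x \<ge> 0"
        by (simp add: k_def q_def band_envelope_nonneg)
      ultimately have "(k * q x)\<^sup>2 \<le> (C * (1 + \<bar>x\<bar>) powr s * (4 * \<nu> * 2 powr (- (\<epsilon> * real j))))\<^sup>2"
        by (intro power_mono)
      hence "(k * q x)\<^sup>2 * (cmod (g x))\<^sup>2 \<le> (C * (1 + \<bar>x\<bar>) powr s * (4 * \<nu> * 2 powr (- (\<epsilon> * real j))))\<^sup>2 * (cmod (g x))\<^sup>2"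
        by (rule mult_right_mono) simp
      also have "\<dots> = 16 * C\<^sup>2 * \<nu>\<^sup>2 * 2 powr (- (2 * \<epsilon> * real j)) * ((1 + \<bar>x\<bar>) powr s * cmod (g x))\<^sup>2"
      proof -
        have "2 powr (- (2 * \<epsilon> * real j)) = (2 powr (- (\<epsilon> * real j)))\<^sup>2"
          by (simp add: power2_eq_square powr_add[symmetric] mult.assoc)
        thus ?thesis by (simp add: power_mult_distrib)
      qed
      also have "(k * q x)\<^sup>2 * (cmod (g x))\<^sup>2 = 2 powr (2 * real j * s) * ((of_int \<lfloor>(x - c) / P\<rfloor>)\<^sup>2 * (cmod (h x))\<^sup>2)"
        using wh[of x] by (simp add: k_def power_mult_distrib mult.assoc mult.left_commute)
      finally show "ennreal (2 powr (2 * real j * s)) * (ennreal ((of_int \<lfloor>(x - c) / P\<rfloor>)\<^sup>2) * ennreal ((cmod (h x))\<^sup>2))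
          \<le> ennreal (16 * C\<^sup>2 * \<nu>\<^sup>2 * 2 powr (- (2 * \<epsilon> * real j))) * ennreal (((1 + \<bar>x\<bar>) powr s * cmod (g x))\<^sup>2)"
        by (simp add: ennreal_mult[symmetric] ennreal_leI)
    qed simp
    also have "\<dots> = ennreal (4 / \<nu> * (16 * C\<^sup>2 * \<nu>\<^sup>2 * 2 powr (- (2 * \<epsilon> * real j)))) * ennreal N"
    proof -
      have "(\<integral>\<^sup>+x. ennreal (16 * C\<^sup>2 * \<nu>\<^sup>2 * 2 powr (- (2 * \<epsilon> * real j))) * ennreal (((1 + \<bar>x\<bar>) powr s * cmod (g x))\<^sup>2) \<partial>lborel)
          = ennreal (16 * C\<^sup>2 * \<nu>\<^sup>2 * 2 powr (- (2 * \<epsilon> * real j))) * ennreal N"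
        unfolding N[symmetric] by (rule nn_integral_cmult) measurable
      thus ?thesis
        using \<nu> by (subst ennreal_mult) (simp_all add: mult.assoc)
    qed
    also have "4 / \<nu> * (16 * C\<^sup>2 * \<nu>\<^sup>2 * 2 powr (- (2 * \<epsilon> * real j))) = 64 * C\<^sup>2 * \<nu> * 2 powr (- (2 * \<epsilon> * real j))"
      using \<nu> by (simp add: power2_eq_square)
    also have "ennreal (64 * C\<^sup>2 * \<nu> * 2 powr (- (2 * \<epsilon> * real j))) * ennreal N = far"
      using \<nu> by (simp add: far_def j_def ennreal_mult)
    finally show ?thesis .
  qed
  have "S \<le> ennreal w * (2 * near' + 2 * far')"
    unfolding S by (intro mult_left_mono sandwich) simp
  also have "\<dots> = 2 * near + 2 * (ennreal w * far')"
    by (simp add: near distrib_left mult.left_commute)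
  also have "\<dots> \<le> 2 * near + 2 * far"
    by (intro add_mono mult_left_mono far) auto
  finally show "S \<le> 2 * near + 2 * far" .
  have "near \<le> ennreal w * (2 * S' + 2 * far')"
    unfolding near by (intro mult_left_mono sandwich) simp
  also have "\<dots> = 2 * S + 2 * (ennreal w * far')"
    by (simp add: S distrib_left mult.left_commute)
  also have "\<dots> \<le> 2 * S + 2 * far"
    by (intro add_mono mult_left_mono far) auto
  finally show "near \<le> 2 * S + 2 * far" .
qed

text \<open>
  Summation over the bands. From above, \<open>decay_sum\<close> is at most \<open>K\<close> in each band and in total, so its
  squares add up to at most \<open>K\<^sup>2\<close>. From below, one band already suffices at almost every frequency.
  The far parts add up to a multiple of \<open>\<nu>\<close>, which the lower bound subtracts.
\<close>
lemma wave_frame_bounds: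
  fixes \<nu> s \<epsilon> C N a K E :: real
  assumes f: "f \<in> L2" "is_fourier_transform f g"
    and N: "(\<integral>\<^sup>+\<omega>. ennreal (((1 + \<bar>\<omega>\<bar>) powr s * cmod (g \<omega>))\<^sup>2) \<partial>lborel) = ennreal N" "N \<ge> 0"
    and \<phi>: "\<phi> \<in> L2" "is_fourier_transform \<phi> \<psi>"
    and sign: "cmod \<sigma> = 1" "\<And>\<omega>. \<psi> \<omega> = \<sigma> * of_real (cmod (\<psi> \<omega>))"
    and decay: "\<And>\<omega>. cmod (\<psi> \<omega>) \<le> C / (1 + \<bar>\<omega>\<bar>) powr (s + 1 + \<epsilon>)"
    and low: "\<And>\<omega>. \<omega> \<in> I_centre \<Longrightarrow> a \<le> cmod (\<psi> \<omega>)"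
    and pos: "s \<ge> 0" "\<epsilon> > 0" "C > 0" "a > 0" and \<nu>: "0 < \<nu>" "\<nu> \<le> 1/8"
    and K: "K > 0" "\<And>\<omega>. (\<integral>\<^sup>+b. ennreal (decay_sum \<epsilon> b \<omega>) \<partial>count_space UNIV) \<le> ennreal K"
    and E: "E > 0" "(\<integral>\<^sup>+b. ennreal (2 powr (- (2 * \<epsilon> * real (band_scale b)))) \<partial>count_space UNIV) = ennreal E"
  defines "S \<equiv> \<integral>\<^sup>+b. (\<integral>\<^sup>+n. ennreal (2 powr (2 * real (band_scale b) * s) * (cmod (L2_inner f (wave_atom \<phi> b (\<nu> * of_int n))))\<^sup>2)
      \<partial>count_space UNIV) \<partial>count_space UNIV"
  shows "ennreal ((a\<^sup>2 / 16 powr s / \<nu> - 128 * C\<^sup>2 * E * \<nu>) / 2 * N) \<le> S"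
    and "S \<le> ennreal ((2 * C\<^sup>2 * K\<^sup>2 / \<nu> + 128 * C\<^sup>2 * E * \<nu>) * N)"
proof -
  define P where "P b = 2 ^ band_scale b / \<nu>" for b
  define q where "q b \<omega> = 2 powr (real (band_scale b) * s) * band_envelope \<psi> b \<omega>" for b \<omega>
  define I where "I b \<omega> = indicator (tile (- (P b / 2)) (P b) 0) \<omega> * ennreal ((q b \<omega>)\<^sup>2 * (cmod (g \<omega>))\<^sup>2)" for b \<omega>
  define G where "G \<omega> = ((1 + \<bar>\<omega>\<bar>) powr s * cmod (g \<omega>))\<^sup>2" for \<omega>
  define near where "near = (\<integral>\<^sup>+b. ennreal (1 / \<nu>) * (\<integral>\<^sup>+\<omega>. I b \<omega> \<partial>lborel) \<partial>count_space UNIV)"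
  define far where "far = (\<integral>\<^sup>+b. ennreal (64 * C\<^sup>2 * \<nu>) * ennreal (2 powr (- (2 * \<epsilon> * real (band_scale b)))) * ennreal N \<partial>count_space UNIV)"
  note g = is_fourier_transformD(1)[OF f(2,1)] and \<psi> = is_fourier_transformD(1)[OF \<phi>(2,1)]
  have [measurable]: "g \<in> borel_measurable borel"
    using g by (simp add: L2_measurable)
  have [measurable]: "band_envelope \<psi> b \<in> borel_measurable borel" for b
    by (rule band_envelope_measurable[OF L2_measurable[OF \<psi>]])
  have [measurable]: "I b \<in> borel_measurable borel" for b
    unfolding I_def[abs_def] q_def by measurable
  have [measurable]: "G \<in> borel_measurable borel"
    unfolding G_def[abs_def] by measurable
  have G: "(\<integral>\<^sup>+\<omega>. ennreal (G \<omega>) \<partial>lborel) = ennreal N"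
    using N(1) by (simp only: G_def)
  have G0: "G \<omega> \<ge> 0" for \<omega> by (simp add: G_def)
  note est = band_frame_estimates[OF f N(1) \<phi> sign decay pos(1-3) \<nu>, folded P_def q_def, folded I_def]
  have S_le: "S \<le> 2 * near + 2 * far"
  proof -
    have "S \<le> (\<integral>\<^sup>+b. 2 * (ennreal (1 / \<nu>) * (\<integral>\<^sup>+\<omega>. I b \<omega> \<partial>lborel))
         + 2 * (ennreal (64 * C\<^sup>2 * \<nu>) * ennreal (2 powr (- (2 * \<epsilon> * real (band_scale b)))) * ennreal N) \<partial>count_space UNIV)"
      unfolding S_def by (intro nn_integral_mono est(1))
    also have "\<dots> = 2 * near + 2 * far"
      unfolding near_def far_def by (subst nn_integral_add) (auto simp: nn_integral_cmult)
    finally show ?thesis .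
  qed
  have near_le: "near \<le> 2 * S + 2 * far"
  proof -
    have "near \<le> (\<integral>\<^sup>+b. 2 * (\<integral>\<^sup>+n. ennreal (2 powr (2 * real (band_scale b) * s) * (cmod (L2_inner f (wave_atom \<phi> b (\<nu> * of_int n))))\<^sup>2)
      \<partial>count_space UNIV) + 2 * (ennreal (64 * C\<^sup>2 * \<nu>) * ennreal (2 powr (- (2 * \<epsilon> * real (band_scale b)))) * ennreal N) \<partial>count_space UNIV)"
      unfolding near_def by (intro nn_integral_mono est(2))
    also have "\<dots> = 2 * S + 2 * far"
      unfolding S_def far_def by (subst nn_integral_add) (auto simp: nn_integral_cmult)
    finally show ?thesis .
  qed
  have far: "far = ennreal (64 * C\<^sup>2 * \<nu> * E * N)"
  proof -
    have "far = ennreal (64 * C\<^sup>2 * \<nu>) * ennreal E * ennreal N"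
      unfolding far_def E(2)[symmetric] by (simp add: nn_integral_cmult nn_integral_multc)
    thus ?thesis using \<nu> E N by (simp add: ennreal_mult'')
  qed
  have near: "near = ennreal (1 / \<nu>) * (\<integral>\<^sup>+\<omega>. (\<integral>\<^sup>+b. I b \<omega> \<partial>count_space UNIV) \<partial>lborel)"
    unfolding near_def
    by (subst nn_integral_count_space_nn_integral[OF countable_bands]) (auto simp: nn_integral_cmult)
  have upper: "near \<le> ennreal (C\<^sup>2 * K\<^sup>2 / \<nu> * N)"
  proof -
    have "(\<integral>\<^sup>+b. I b \<omega> \<partial>count_space UNIV) \<le> ennreal (C\<^sup>2 * K\<^sup>2) * ennreal (G \<omega>)" for \<omega>
    proof -
      have "I b \<omega> \<le> ennreal (C\<^sup>2 * K * G \<omega>) * ennreal (decay_sum \<epsilon> b \<omega>)" for b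
      proof -
        have "ennreal (decay_sum \<epsilon> b \<omega>) \<le> ennreal K"
          using sum_le_nn_integral_count_space[of "{b}" "\<lambda>b. ennreal (decay_sum \<epsilon> b \<omega>)"] K(2)[of \<omega>] by simp
        hence D: "decay_sum \<epsilon> b \<omega> \<le> K"
          using K(1) by (simp add: ennreal_le_iff)
        have "(q b \<omega>)\<^sup>2 \<le> (C * (1 + \<bar>\<omega>\<bar>) powr s * decay_sum \<epsilon> b \<omega>)\<^sup>2"
          unfolding q_def by (intro power_mono band_envelope_le decay pos) (simp add: band_envelope_nonneg)
        hence "(q b \<omega>)\<^sup>2 * (cmod (g \<omega>))\<^sup>2 \<le> (C * (1 + \<bar>\<omega>\<bar>) powr s * decay_sum \<epsilon> b \<omega>)\<^sup>2 * (cmod (g \<omega>))\<^sup>2"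
          by (rule mult_right_mono) simp
        also have "\<dots> = C\<^sup>2 * G \<omega> * (decay_sum \<epsilon> b \<omega> * decay_sum \<epsilon> b \<omega>)"
          by (simp add: G_def power_mult_distrib power2_eq_square)
        also have "\<dots> \<le> C\<^sup>2 * G \<omega> * (K * decay_sum \<epsilon> b \<omega>)"
          by (intro mult_left_mono mult_right_mono D decay_sum_nonneg) (simp add: G0)
        finally have "ennreal ((q b \<omega>)\<^sup>2 * (cmod (g \<omega>))\<^sup>2) \<le> ennreal (C\<^sup>2 * K * G \<omega>) * ennreal (decay_sum \<epsilon> b \<omega>)"
          using K(1) G0[of \<omega>] by (simp add: ennreal_mult''[symmetric] decay_sum_nonneg ennreal_leI mult_ac)
        thus ?thesis
          unfolding I_def by (auto simp: indicator_def)
      qed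
      hence "(\<integral>\<^sup>+b. I b \<omega> \<partial>count_space UNIV) \<le> (\<integral>\<^sup>+b. ennreal (C\<^sup>2 * K * G \<omega>) * ennreal (decay_sum \<epsilon> b \<omega>) \<partial>count_space UNIV)"
        by (intro nn_integral_mono)
      also have "\<dots> \<le> ennreal (C\<^sup>2 * K * G \<omega>) * ennreal K"
        using K(2)[of \<omega>] by (simp add: nn_integral_cmult mult_left_mono)
      also have "\<dots> = ennreal (C\<^sup>2 * K\<^sup>2) * ennreal (G \<omega>)"
      proof -
        have "ennreal (C\<^sup>2 * K * G \<omega>) * ennreal K = ennreal (C\<^sup>2 * K * G \<omega> * K)"
          using K(1) by (intro ennreal_mult''[symmetric]) simp
        also have "C\<^sup>2 * K * G \<omega> * K = C\<^sup>2 * K\<^sup>2 * G \<omega>"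
          by (simp add: power2_eq_square)
        also have "ennreal \<dots> = ennreal (C\<^sup>2 * K\<^sup>2) * ennreal (G \<omega>)"
          by (rule ennreal_mult''[OF G0])
        finally show ?thesis .
      qed
      finally show ?thesis .
    qed
    hence "near \<le> ennreal (1 / \<nu>) * (\<integral>\<^sup>+\<omega>. ennreal (C\<^sup>2 * K\<^sup>2) * ennreal (G \<omega>) \<partial>lborel)"
      unfolding near by (intro mult_left_mono nn_integral_mono) auto
    also have "\<dots> = ennreal (C\<^sup>2 * K\<^sup>2 / \<nu> * N)"
    proof -
      have "(\<integral>\<^sup>+\<omega>. ennreal (C\<^sup>2 * K\<^sup>2) * ennreal (G \<omega>) \<partial>lborel) = ennreal (C\<^sup>2 * K\<^sup>2) * ennreal N"
        unfolding G[symmetric] by (rule nn_integral_cmult) measurable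
      thus ?thesis
        using \<nu> N(2) by (simp add: ennreal_mult''[symmetric] mult_ac)
    qed
    finally show ?thesis .
  qed
  have lower: "near \<ge> ennreal (a\<^sup>2 / 16 powr s / \<nu> * N)"
  proof -
    have "AE \<omega> in lborel. \<omega> \<notin> range (\<lambda>m::int. of_int m + 1 / 2)"
      by (intro AE_not_in countable_imp_null_set_lborel countable_image) simp
    hence "AE \<omega> in lborel. ennreal (a\<^sup>2 / 16 powr s) * ennreal (G \<omega>) \<le> (\<integral>\<^sup>+b. I b \<omega> \<partial>count_space UNIV)"
    proof eventually_elim
      fix \<omega> :: real assume half: "\<omega> \<notin> range (\<lambda>m::int. of_int m + 1 / 2)"
      obtain b where b: "\<bar>\<omega>\<bar> \<le> 3 * 2 ^ band_scale b" "a * (1 + \<bar>\<omega>\<bar>) powr s \<le> 4 powr s * q b \<omega>"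
        using band_envelope_lower[of a \<psi>, OF low pos(1,4) half] unfolding q_def by blast
      \<comment> \<open>half the period is at least \<open>4 * 2 ^ band_scale b\<close>, so \<open>\<omega>\<close> lies in the tile \<open>0\<close>\<close>
      have "8 * 2 ^ band_scale b \<le> P b"
        using \<nu> by (simp add: P_def field_simps)
      moreover have "(0::real) < 2 ^ band_scale b" by simp
      ultimately have "- (P b / 2) \<le> \<omega>" "\<omega> < P b / 2"
        using b(1) by linarith+
      hence "\<omega> \<in> tile (- (P b / 2)) (P b) 0"
        by (simp add: tile_def)
      hence I: "I b \<omega> = ennreal ((q b \<omega>)\<^sup>2 * (cmod (g \<omega>))\<^sup>2)"
        by (simp add: I_def)
      have sq: "16 powr s = (4 powr s)\<^sup>2"
        by (simp add: power2_eq_square powr_mult[symmetric])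
      have "(a * (1 + \<bar>\<omega>\<bar>) powr s)\<^sup>2 \<le> (4 powr s * q b \<omega>)\<^sup>2"
        using b(2) pos by (intro power_mono) auto
      hence "(a * (1 + \<bar>\<omega>\<bar>) powr s)\<^sup>2 * (cmod (g \<omega>))\<^sup>2 \<le> (4 powr s * q b \<omega>)\<^sup>2 * (cmod (g \<omega>))\<^sup>2"
        by (rule mult_right_mono) simp
      hence "a\<^sup>2 / 16 powr s * G \<omega> \<le> (q b \<omega>)\<^sup>2 * (cmod (g \<omega>))\<^sup>2"
        unfolding sq G_def by (simp add: power_mult_distrib field_simps)
      hence "ennreal (a\<^sup>2 / 16 powr s) * ennreal (G \<omega>) \<le> I b \<omega>"
        unfolding I by (simp add: ennreal_mult''[symmetric] G0 ennreal_leI)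
      also have "\<dots> \<le> (\<integral>\<^sup>+b. I b \<omega> \<partial>count_space UNIV)"
        using sum_le_nn_integral_count_space[of "{b}" "\<lambda>b. I b \<omega>"] by simp
      finally show "ennreal (a\<^sup>2 / 16 powr s) * ennreal (G \<omega>) \<le> (\<integral>\<^sup>+b. I b \<omega> \<partial>count_space UNIV)" .
    qed
    hence "ennreal (1 / \<nu>) * (\<integral>\<^sup>+\<omega>. ennreal (a\<^sup>2 / 16 powr s) * ennreal (G \<omega>) \<partial>lborel) \<le> near"
      unfolding near by (intro mult_left_mono nn_integral_mono_AE) auto
    moreover have "(\<integral>\<^sup>+\<omega>. ennreal (a\<^sup>2 / 16 powr s) * ennreal (G \<omega>) \<partial>lborel) = ennreal (a\<^sup>2 / 16 powr s) * ennreal N"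
      unfolding G[symmetric] by (rule nn_integral_cmult) measurable
    ultimately show ?thesis
      using \<nu> N(2) by (simp add: ennreal_mult''[symmetric] mult_ac)
  qed
  have "S \<le> 2 * ennreal (C\<^sup>2 * K\<^sup>2 / \<nu> * N) + 2 * ennreal (64 * C\<^sup>2 * \<nu> * E * N)"
    using S_le unfolding far by (rule order_trans) (intro add_mono mult_left_mono upper, auto)
  also have "\<dots> = ennreal ((2 * C\<^sup>2 * K\<^sup>2 / \<nu> + 128 * C\<^sup>2 * E * \<nu>) * N)"
  proof -
    have "0 \<le> C\<^sup>2 * K\<^sup>2 / \<nu> * N" "0 \<le> 64 * C\<^sup>2 * \<nu> * E * N"
      using \<nu> N(2) E(1) by auto
    hence "2 * ennreal (C\<^sup>2 * K\<^sup>2 / \<nu> * N) + 2 * ennreal (64 * C\<^sup>2 * \<nu> * E * N)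
        = ennreal (2 * (C\<^sup>2 * K\<^sup>2 / \<nu> * N) + 2 * (64 * C\<^sup>2 * \<nu> * E * N))"
      by (subst ennreal_plus) (simp_all only: ennreal_mult' ennreal_numeral zero_le_numeral mult_nonneg_nonneg)
    thus ?thesis by (simp add: algebra_simps)
  qed
  finally show "S \<le> ennreal ((2 * C\<^sup>2 * K\<^sup>2 / \<nu> + 128 * C\<^sup>2 * E * \<nu>) * N)" .
  have le: "ennreal (a\<^sup>2 / 16 powr s / \<nu> * N) \<le> 2 * S + 2 * ennreal (64 * C\<^sup>2 * \<nu> * E * N)"
    using lower near_le unfolding far by (rule order_trans)
  show "ennreal ((a\<^sup>2 / 16 powr s / \<nu> - 128 * C\<^sup>2 * E * \<nu>) / 2 * N) \<le> S"
  proof (cases S)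
    case (real r)
    have nn: "0 \<le> 64 * C\<^sup>2 * \<nu> * E * N"
      using \<nu> N(2) E(1) by auto
    have "2 * ennreal r + 2 * ennreal (64 * C\<^sup>2 * \<nu> * E * N) = ennreal (2 * r + 2 * (64 * C\<^sup>2 * \<nu> * E * N))"
      using real(1) nn by (subst ennreal_plus) (simp_all only: ennreal_mult' ennreal_numeral zero_le_numeral mult_nonneg_nonneg)
    hence "ennreal (a\<^sup>2 / 16 powr s / \<nu> * N) \<le> ennreal (2 * r + 2 * (64 * C\<^sup>2 * \<nu> * E * N))"
      using le real by simp
    hence "a\<^sup>2 / 16 powr s / \<nu> * N \<le> 2 * r + 2 * (64 * C\<^sup>2 * \<nu> * E * N)"
      using real(1) nn by (subst (asm) ennreal_le_iff) auto
    hence "(a\<^sup>2 / 16 powr s / \<nu> - 128 * C\<^sup>2 * E * \<nu>) / 2 * N \<le> r"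
      by (simp add: algebra_simps)
    thus ?thesis unfolding real(2) by (rule ennreal_leI)
  qed simp
qed

text \<open>
  Reindexing the frame by bands and integers merges the central atoms with those of the dyadic bands,
  and lets the estimate for a single band be integrated.
\<close>
lemma frame_sum_eq:
  fixes F :: "real \<Rightarrow> ennreal" and H :: "nat \<Rightarrow> freq_sign \<Rightarrow> real \<Rightarrow> ennreal"
  assumes \<nu>: "\<nu> > 0"
  shows "(\<Sum>\<^sub>\<infinity>l\<in>lattice \<nu>. F l) + (\<Sum>\<^sub>\<infinity>(j, k, l)\<in>UNIV \<times> UNIV \<times> lattice \<nu>. H j k l)
    = (\<integral>\<^sup>+b. (\<integral>\<^sup>+n. (case b of None \<Rightarrow> F (\<nu> * of_int n) | Some (j, k) \<Rightarrow> H j k (\<nu> * of_int n)) \<partial>count_space UNIV) \<partial>count_space UNIV)"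
proof -
  have lattice: "countable (lattice \<nu>)"
    by (simp add: lattice_def)
  have bij: "bij_betw (\<lambda>n::int. \<nu> * of_int n) UNIV (lattice \<nu>)"
    using \<nu> by (auto simp: bij_betw_def lattice_def inj_on_def)
  have 1: "(\<Sum>\<^sub>\<infinity>l\<in>lattice \<nu>. F l) = (\<integral>\<^sup>+n. F (\<nu> * of_int n) \<partial>count_space UNIV)"
    by (simp add: infsum_eq_nn_integral_count_space[OF lattice] nn_integral_bij_count_space[OF bij])
  have countable: "countable ((UNIV :: nat set) \<times> (UNIV :: freq_sign set) \<times> lattice \<nu>)"
    using lattice by (intro countable_SIGMA) (auto simp: UNIV_freq_sign)
  have bij2: "bij_betw (\<lambda>((j, k), n::int). (j, k, \<nu> * of_int n)) UNIV ((UNIV :: nat set) \<times> (UNIV :: freq_sign set) \<times> lattice \<nu>)"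
  proof (rule bij_betwI[where g = "\<lambda>(j, k, l). ((j, k), \<lfloor>l / \<nu>\<rfloor>)"])
    show "(\<lambda>((j, k), n::int). (j, k, \<nu> * of_int n)) \<in> UNIV \<rightarrow> (UNIV :: nat set) \<times> (UNIV :: freq_sign set) \<times> lattice \<nu>"
      by (auto simp: lattice_def)
    show "(\<lambda>(j, k, l). ((j, k), \<lfloor>l / \<nu>\<rfloor>)) \<in> (UNIV :: nat set) \<times> (UNIV :: freq_sign set) \<times> lattice \<nu> \<rightarrow> UNIV"
      by simp
  qed (use \<nu> in \<open>auto simp: lattice_def\<close>)
  have "(\<Sum>\<^sub>\<infinity>(j, k, l)\<in>UNIV \<times> UNIV \<times> lattice \<nu>. H j k l)
      = (\<integral>\<^sup>+x. (case x of (j, k, l) \<Rightarrow> H j k l) \<partial>count_space (UNIV \<times> UNIV \<times> lattice \<nu>))"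
    by (rule infsum_eq_nn_integral_count_space[OF countable])
  also have "\<dots> = (\<integral>\<^sup>+x. (case x of ((j, k), n) \<Rightarrow> H j k (\<nu> * of_int n)) \<partial>count_space UNIV)"
    by (subst nn_integral_bij_count_space[OF bij2, symmetric]) (auto intro!: nn_integral_cong split: prod.splits)
  also have "\<dots> = (\<integral>\<^sup>+p. (\<integral>\<^sup>+n. (case p of (j, k) \<Rightarrow> H j k (\<nu> * of_int n)) \<partial>count_space UNIV) \<partial>count_space UNIV)"
    by (subst nn_integral_fst_count_space[symmetric]) simp
  finally show ?thesis
    by (simp add: 1 nn_integral_count_space_option)
qed

theorem theorem6:
  fixes s \<epsilon> C a :: real and \<phi> :: "real \<Rightarrow> complex"
  assumes "s \<ge> 0"
    and "\<phi> \<in> L2"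
    and "\<epsilon> > 0" and "C > 0"
    and "AE \<omega> in lborel. cmod (fourier \<phi> \<omega>) \<le> C / (1 + \<bar>\<omega>\<bar>) powr (s + 1 + \<epsilon>)"
    and "definite_sign (fourier \<phi>)"
    and "a > 0"
    and "AE \<omega> in lborel. \<omega> \<in> I_centre \<longrightarrow> cmod (fourier \<phi> \<omega>) \<ge> a"
  shows "\<exists>\<nu>\<^sub>0>0. \<forall>\<nu>. 0 < \<nu> \<and> \<nu> < \<nu>\<^sub>0 \<longrightarrow>
    (\<exists>A>0. \<exists>B>0. \<forall>f\<in>sobolev_space s.
       (let S = (\<Sum>\<^sub>\<infinity>l\<in>lattice \<nu>. ennreal ((cmod (L2_inner f (translate l \<phi>)))\<^sup>2)) +
                (\<Sum>\<^sub>\<infinity>(j, k, l)\<in>UNIV \<times> UNIV \<times> lattice \<nu>.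
                   ennreal (2 powr (2 * real j * s) * (cmod (L2_inner f (band_atom \<phi> j k l)))\<^sup>2))
        in ennreal (A * (sobolev_norm s f)\<^sup>2) \<le> S \<and> S \<le> ennreal (B * (sobolev_norm s f)\<^sup>2)))"
proof -
  obtain \<psi> \<sigma> a' where \<psi>: "is_fourier_transform \<phi> \<psi>" "a' > 0" "cmod \<sigma> = 1"
    "\<And>\<omega>. \<psi> \<omega> = \<sigma> * of_real (cmod (\<psi> \<omega>))"
    "\<And>\<omega>. cmod (\<psi> \<omega>) \<le> C / (1 + \<bar>\<omega>\<bar>) powr (s + 1 + \<epsilon>)"
    "\<And>\<omega>. \<omega> \<in> I_centre \<Longrightarrow> a' \<le> cmod (\<psi> \<omega>)"
    by (rule regular_fourier_representative[OF assms(2,4,7,1,3,5,6,8)]) (rule that, assumption+)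
  obtain K where K: "K > 0" "\<And>\<omega>. (\<integral>\<^sup>+b. ennreal (decay_sum \<epsilon> b \<omega>) \<partial>count_space UNIV) \<le> ennreal K"
    using decay_sums_bounded[OF assms(3)] by blast
  obtain E where E: "E > 0" "(\<integral>\<^sup>+b. ennreal (2 powr (- (2 * \<epsilon> * real (band_scale b)))) \<partial>count_space UNIV) = ennreal E"
    using scale_weights_summable[OF assms(3)] by blast
  define z where "z = a'\<^sup>2 / 16 powr s"
  define y where "y = 128 * C\<^sup>2 * E"
  have z: "z > 0" and y: "y > 0"
    using \<psi>(2) E(1) assms(4) by (simp_all add: z_def y_def)
  \<comment> \<open>for \<open>\<nu> \<le> 1\<close> the condition \<open>y * \<nu> < z\<close> gives \<open>y * \<nu> < z / \<nu>\<close>, which is positivity of the lower frame bound\<close>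
  define \<nu>\<^sub>0 where "\<nu>\<^sub>0 = min (1/8) (z / y)"
  have "\<nu>\<^sub>0 > 0"
    using z y by (simp add: \<nu>\<^sub>0_def)
  moreover have "\<exists>A>0. \<exists>B>0. \<forall>f\<in>sobolev_space s.
       (let S = (\<Sum>\<^sub>\<infinity>l\<in>lattice \<nu>. ennreal ((cmod (L2_inner f (translate l \<phi>)))\<^sup>2)) +
                (\<Sum>\<^sub>\<infinity>(j, k, l)\<in>UNIV \<times> UNIV \<times> lattice \<nu>.
                   ennreal (2 powr (2 * real j * s) * (cmod (L2_inner f (band_atom \<phi> j k l)))\<^sup>2))
        in ennreal (A * (sobolev_norm s f)\<^sup>2) \<le> S \<and> S \<le> ennreal (B * (sobolev_norm s f)\<^sup>2))"
    if \<nu>: "0 < \<nu> \<and> \<nu> < \<nu>\<^sub>0" for \<nu>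
  proof -
    have \<nu>': "0 < \<nu>" "\<nu> \<le> 1/8" "\<nu> < z / y"
      using \<nu> by (auto simp: \<nu>\<^sub>0_def)
    define A where "A = (z / \<nu> - y * \<nu>) / 2"
    define B where "B = 2 * C\<^sup>2 * K\<^sup>2 / \<nu> + y * \<nu>"
    have "A > 0"
    proof -
      have "y * \<nu> * \<nu> \<le> y * \<nu> * 1"
        using \<nu>' y by (intro mult_left_mono) auto
      also have "\<dots> < z"
        using \<nu>'(3) y by (simp add: field_simps)
      finally show ?thesis
        using \<nu>'(1) by (simp add: A_def field_simps)
    qed
    moreover have "B > 0"
      using \<nu>' y K(1) assms(4) by (simp add: B_def add_pos_pos)
    moreover have "let S = (\<Sum>\<^sub>\<infinity>l\<in>lattice \<nu>. ennreal ((cmod (L2_inner f (translate l \<phi>)))\<^sup>2)) +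
                (\<Sum>\<^sub>\<infinity>(j, k, l)\<in>UNIV \<times> UNIV \<times> lattice \<nu>.
                   ennreal (2 powr (2 * real j * s) * (cmod (L2_inner f (band_atom \<phi> j k l)))\<^sup>2))
        in ennreal (A * (sobolev_norm s f)\<^sup>2) \<le> S \<and> S \<le> ennreal (B * (sobolev_norm s f)\<^sup>2)"
      if f: "f \<in> sobolev_space s" for f
    proof -
      have fL2: "f \<in> L2" and int: "integrable lborel (\<lambda>\<omega>. ((1 + \<bar>\<omega>\<bar>) powr s * cmod (fourier f \<omega>))\<^sup>2)"
        using f by (auto simp: sobolev_space_def)
      have norm: "(sobolev_norm s f)\<^sup>2 = (LINT \<omega>|lborel. ((1 + \<bar>\<omega>\<bar>) powr s * cmod (fourier f \<omega>))\<^sup>2)"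
        unfolding sobolev_norm_def by (rule real_sqrt_pow2) simp
      have N: "(\<integral>\<^sup>+\<omega>. ennreal (((1 + \<bar>\<omega>\<bar>) powr s * cmod (fourier f \<omega>))\<^sup>2) \<partial>lborel) = ennreal ((sobolev_norm s f)\<^sup>2)"
        unfolding norm by (intro nn_integral_eq_integral int) auto
      have "(\<Sum>\<^sub>\<infinity>l\<in>lattice \<nu>. ennreal ((cmod (L2_inner f (translate l \<phi>)))\<^sup>2)) +
                (\<Sum>\<^sub>\<infinity>(j, k, l)\<in>UNIV \<times> UNIV \<times> lattice \<nu>.
                   ennreal (2 powr (2 * real j * s) * (cmod (L2_inner f (band_atom \<phi> j k l)))\<^sup>2))
        = (\<integral>\<^sup>+b. (\<integral>\<^sup>+n. ennreal (2 powr (2 * real (band_scale b) * s) * (cmod (L2_inner f (wave_atom \<phi> b (\<nu> * of_int n))))\<^sup>2)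
            \<partial>count_space UNIV) \<partial>count_space UNIV)"
        unfolding frame_sum_eq[OF \<nu>'(1)]
        by (intro nn_integral_cong) (auto simp: wave_atom_def split: option.splits)
      thus ?thesis
        using wave_frame_bounds[OF fL2 is_fourier_transform_fourier[OF fL2] N zero_le_power2 assms(2) \<psi>(1,3,4,5,6)
            assms(1,3,4) \<psi>(2) \<nu>'(1,2) K E]
        by (simp only: Let_def A_def B_def z_def y_def)
    qed
    ultimately show ?thesis by blast
  qed
  ultimately show ?thesis by blast
qed

end
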